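(* Let $V$ be a finite dimensional vector space over an arbitrary field $k$. For each choice of (ordered) basis $B=\{v_1,\ldots,v_n\}$ of $V$, the map $\Psi_B$ defined in the context, from the bar resolution of $S(V)$ to the Koszul resolution of $S(V)$, is a chain map; that is, $(\Psi_B)_{p-1}\,\delta_p=d_p\,(\Psi_B)_p$ for all $p\geq 1$.
   Context: All tensor and exterior products are over $k$. $S(V)$ is the symmetric algebra, $S(V)^e=S(V)\otimes S(V)^{op}$, and $S(V)$-bimodules are viewed as left $S(V)^e$-modules via $(a\otimes b)m=amb$. Bar resolution: in degree $p\ge 0$ it is $S(V)^{\otimes(p+2)}$, with $\delta_p(a_0\otimes\cdots\otimes a_{p+1})=\sum_{j=0}^p(-1)^j a_0\otimes\cdots\otimes a_ja_{j+1}\otimes\cdots\otimes a_{p+1}$ for $p\ge1$; it is augmented to $S(V)$ by multiplication. Koszul resolution: in degree $p\ge 0$ it is $S(V)^e\otimes\bigwedge^p(V)$, with $S(V)^e$-linear differentials $$d_p(1\otimes1\otimes v_{j_1}\wedge\cdots\wedge v_{j_p})=\sum_{i=1}^p(-1)^{i+1}(v_{j_i}\otimes1-1\otimes v_{j_i})\otimes(v_{j_1}\wedge\cdots\wedge\hat v_{j_i}\wedge\cdots\wedge v_{j_p}).$$ Definition of $\Psi_B$: for an $n$-tuple $\underline\ell=(\ell_1,\ldots,\ell_n)$ of nonnegative integers, write $\underline v^{\underline\ell}=v_1^{\ell_1}\cdots v_n^{\ell_n}$. Let $(\Psi_B)_0$ be the identity map of $S(V)^e$. For $p\ge1$, let $(\Psi_B)_p:S(V)^{\otimes(p+2)}\to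 S(V)^e\otimes\bigwedge^p(V)$ be the $S(V)^e$-linear map with $$(\Psi_B)_p(1\otimes\underline v^{\underline\ell^1}\otimes\cdots\otimes\underline v^{\underline\ell^p}\otimes1)=\sum_{1\le i_1<\cdots<i_p\le n}\ \sum_{0\le a_{i_j}<\ell^j_{i_j}}\underline v^{\underline Q}\otimes\underline v^{\underline{\hat Q}}\otimes v_{i_1}\wedge\cdots\wedge v_{i_p},$$ where the second sum is over all integers $a_{i_1},\ldots,a_{i_p}$ with $0\le a_{i_j}<\ell^j_{i_j}$ for each $j\in\{1,\ldots,p\}$ (it is zero if no such choice exists). Here $\underline Q=\underline Q(\underline\ell^1,\ldots,\underline\ell^p;i_1,\ldots,i_p)$ is the $n$-tuple (depending on the $a_{i_j}$) with $$\underline Q_i=\begin{cases}a_i+\ell_i^1+\cdots+\ell_i^{j-1},& i=i_j,\\ \ell_i^1+\cdots+\ell_i^j,& i_j<i<i_{j+1},\end{cases}$$ with the convention $i_0=0$, $i_{p+1}=n+1$ (empty sums are $0$), and $\underline{\hat Q}$ is the complementary $n$-tuple determined by $\underline v^{\underline Q}\,\underline v^{\underline{\hat Q}}\,v_{i_1}\cdots v_{i_p}=\underline v^{\underline\ell^1}\cdots\underline v^{\underline\ell^p}$. *)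

theory Defs
  imports Complex_Main "HOL-Algebra.Module" "HOL-Library.Poly_Mapping" "HOL-Library.FuncSet"
begin

text \<open>
  The field \<open>k\<close> is a type of class \<^class>\<open>field\<close> and the vector space \<open>V\<close> is a type with a scalar
  multiplication \<open>scale\<close>. All spaces built from \<open>V\<close> are sets of cosets, packaged in the record type
  \<^type>\<open>module_ext\<close> of HOL-Algebra. The record fields for the multiplicative structure are left
  \<^const>\<open>undefined\<close> where a space is only used as a module.
\<close>

section \<open>Vector spaces by generators and relations\<close>

text \<open>\<open>'x \<Rightarrow>\<^sub>0 'k\<close> is the free vector space on \<open>'x\<close>.\<close>

definition fscale :: "'k::field \<Rightarrow> ('x \<Rightarrow>\<^sub>0 'k) \<Rightarrow> ('x \<Rightarrow>\<^sub>0 'k)" where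
  "fscale c f = Poly_Mapping.map (\<lambda>x. c * x) f"

abbreviation pt :: "'x \<Rightarrow> ('x \<Rightarrow>\<^sub>0 'k::field)" where
  "pt x \<equiv> Poly_Mapping.single x 1"

definition lin_ext :: "('x \<Rightarrow> 'y) \<Rightarrow> ('x \<Rightarrow>\<^sub>0 'k::field) \<Rightarrow> ('y \<Rightarrow>\<^sub>0 'k)" where
  "lin_ext h f = (\<Sum>x\<in>Poly_Mapping.keys f. Poly_Mapping.single (h x) (Poly_Mapping.lookup f x))"

definition bilin_ext ::
    "('x \<Rightarrow> 'y \<Rightarrow> 'z) \<Rightarrow> ('x \<Rightarrow>\<^sub>0 'k::field) \<Rightarrow> ('y \<Rightarrow>\<^sub>0 'k) \<Rightarrow> ('z \<Rightarrow>\<^sub>0 'k)" where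
  "bilin_ext h f g = (\<Sum>x\<in>Poly_Mapping.keys f. \<Sum>y\<in>Poly_Mapping.keys g.
     Poly_Mapping.single (h x y) (Poly_Mapping.lookup f x * Poly_Mapping.lookup g y))"

definition rel_coset :: "('x \<Rightarrow>\<^sub>0 'k::field) set \<Rightarrow> ('x \<Rightarrow>\<^sub>0 'k) \<Rightarrow> ('x \<Rightarrow>\<^sub>0 'k) set" where
  "rel_coset R f = {g. g - f \<in> module.span fscale R}"

text \<open>
  The quotient of the free vector space on the set \<open>X\<close> by the span of \<open>R\<close>. As for
  the quotient rings of HOL-Algebra, operations on cosets are unions over representatives;
  for operations compatible with the relations all members of the union coincide.
\<close>

definition pres_space ::
    "'x set \<Rightarrow> ('x \<Rightarrow>\<^sub>0 'k::field) set \<Rightarrow> ('k, ('x \<Rightarrow>\<^sub>0 'k) set) module" where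
  "pres_space X R =
    \<lparr> carrier = rel_coset R ` {f. Poly_Mapping.keys f \<subseteq> X},
      monoid.mult = undefined, one = undefined,
      zero = rel_coset R 0,
      add = (\<lambda>A B. \<Union>f\<in>A. \<Union>g\<in>B. rel_coset R (f + g)),
      smult = (\<lambda>c A. \<Union>f\<in>A. rel_coset R (fscale c f)) \<rparr>"


section \<open>Tensor and exterior products over \<open>k\<close>\<close>

text \<open>In this section \<open>M\<close>, \<open>A\<close>, \<open>B\<close> are vector spaces over the type \<open>'k\<close>.\<close>

definition carrier_lists :: "('k, 'a, 'm) module_scheme \<Rightarrow> nat \<Rightarrow> 'a list set" where
  "carrier_lists M p = {xs. length xs = p \<and> set xs \<subseteq> carrier M}"

definition multilin_rels ::
    "('k::field, 'a, 'm) module_scheme \<Rightarrow> nat \<Rightarrow> ('a list \<Rightarrow>\<^sub>0 'k) set" where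
  "multilin_rels M p =
     {pt (xs[i := x \<oplus>\<^bsub>M\<^esub> y]) - pt (xs[i := x]) - pt (xs[i := y]) | xs i x y.
        xs \<in> carrier_lists M p \<and> i < p \<and> x \<in> carrier M \<and> y \<in> carrier M} \<union>
     {pt (xs[i := c \<odot>\<^bsub>M\<^esub> x]) - fscale c (pt (xs[i := x])) | xs i c x.
        xs \<in> carrier_lists M p \<and> i < p \<and> x \<in> carrier M}"

definition tensor_power ::
    "('k::field, 'a, 'm) module_scheme \<Rightarrow> nat \<Rightarrow> ('k, ('a list \<Rightarrow>\<^sub>0 'k) set) module" where
  "tensor_power M p = pres_space (carrier_lists M p) (multilin_rels M p)"

definition tens :: "('k::field, 'a, 'm) module_scheme \<Rightarrow> 'a list \<Rightarrow> ('a list \<Rightarrow>\<^sub>0 'k) set" where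
  "tens M xs = rel_coset (multilin_rels M (length xs)) (pt xs)"

definition alt_rels ::
    "('k::field, 'a, 'm) module_scheme \<Rightarrow> nat \<Rightarrow> ('a list \<Rightarrow>\<^sub>0 'k) set" where
  "alt_rels M p = multilin_rels M p \<union> {pt xs | xs. xs \<in> carrier_lists M p \<and> \<not> distinct xs}"

definition ext_power ::
    "('k::field, 'a, 'm) module_scheme \<Rightarrow> nat \<Rightarrow> ('k, ('a list \<Rightarrow>\<^sub>0 'k) set) module" where
  "ext_power M p = pres_space (carrier_lists M p) (alt_rels M p)"

definition wedge :: "('k::field, 'a, 'm) module_scheme \<Rightarrow> 'a list \<Rightarrow> ('a list \<Rightarrow>\<^sub>0 'k) set" where
  "wedge M xs = rel_coset (alt_rels M (length xs)) (pt xs)"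

definition bilin_rels ::
    "('k::field, 'a, 'm) module_scheme \<Rightarrow> ('k, 'b, 'l) module_scheme \<Rightarrow> ('a \<times> 'b \<Rightarrow>\<^sub>0 'k) set" where
  "bilin_rels A B =
     {pt (x \<oplus>\<^bsub>A\<^esub> x', y) - pt (x, y) - pt (x', y) | x x' y.
        x \<in> carrier A \<and> x' \<in> carrier A \<and> y \<in> carrier B} \<union>
     {pt (x, y \<oplus>\<^bsub>B\<^esub> y') - pt (x, y) - pt (x, y') | x y y'.
        x \<in> carrier A \<and> y \<in> carrier B \<and> y' \<in> carrier B} \<union>
     {pt (c \<odot>\<^bsub>A\<^esub> x, y) - fscale c (pt (x, y)) | c x y. x \<in> carrier A \<and> y \<in> carrier B} \<union>
     {pt (x, c \<odot>\<^bsub>B\<^esub> y) - fscale c (pt (x, y)) | c x y. x \<in> carrier A \<and> y \<in> carrier B}"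

definition tensor_prod ::
    "('k::field, 'a, 'm) module_scheme \<Rightarrow> ('k, 'b, 'l) module_scheme \<Rightarrow>
     ('k, ('a \<times> 'b \<Rightarrow>\<^sub>0 'k) set) module" where
  "tensor_prod A B = pres_space (carrier A \<times> carrier B) (bilin_rels A B)"

definition tens2 ::
    "('k::field, 'a, 'm) module_scheme \<Rightarrow> ('k, 'b, 'l) module_scheme \<Rightarrow> 'a \<Rightarrow> 'b \<Rightarrow>
     ('a \<times> 'b \<Rightarrow>\<^sub>0 'k) set" where
  "tens2 A B x y = rel_coset (bilin_rels A B) (pt (x, y))"


section \<open>The symmetric algebra and its enveloping algebra\<close>

text \<open>
  \<open>('v \<Rightarrow>\<^sub>0 nat) \<Rightarrow>\<^sub>0 'k\<close> is the polynomial ring with one variable for each vector of \<open>V\<close>;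
  \<open>S(V)\<close> is its quotient by the ideal that makes the inclusion of the variables \<open>k\<close>-linear.
\<close>

type_synonym ('k, 'v) vpoly = "('v \<Rightarrow>\<^sub>0 nat) \<Rightarrow>\<^sub>0 'k"

definition var :: "'v \<Rightarrow> ('k::field, 'v) vpoly" where
  "var x = pt (Poly_Mapping.single x 1)"

definition sym_rels ::
    "('k::field \<Rightarrow> 'v::ab_group_add \<Rightarrow> 'v) \<Rightarrow> ('k, 'v) vpoly set" where
  "sym_rels scale =
     {f * (var (x + y) - var x - var y) | f x y. True} \<union>
     {f * (var (scale c x) - fscale c (var x)) | f c x. True}"

definition Sym ::
    "('k::field \<Rightarrow> 'v::ab_group_add \<Rightarrow> 'v) \<Rightarrow> ('k, ('k, 'v) vpoly set) module" where
  "Sym scale = (pres_space UNIV (sym_rels scale))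
     \<lparr> monoid.mult := (\<lambda>A B. \<Union>f\<in>A. \<Union>g\<in>B. rel_coset (sym_rels scale) (f * g)),
       one := rel_coset (sym_rels scale) 1 \<rparr>"

definition sym_inc ::
    "('k::field \<Rightarrow> 'v::ab_group_add \<Rightarrow> 'v) \<Rightarrow> 'v \<Rightarrow> ('k, 'v) vpoly set" where
  "sym_inc scale x = rel_coset (sym_rels scale) (var x)"

text \<open>
  The action of \<open>a \<otimes> b\<close> on \<open>a\<^sub>0 \<otimes> \<dots> \<otimes> a\<^sub>q\<close> (\<open>q \<ge> 1\<close>), with value
  \<open>a a\<^sub>0 \<otimes> a\<^sub>1 \<otimes> \<dots> \<otimes> a\<^sub>q b\<close>. For \<open>q = 1\<close> it is the product
  \<open>(a \<otimes> b)(c \<otimes> d) = ac \<otimes> db\<close> of \<open>S(V) \<otimes> S(V)\<^sup>o\<^sup>p\<close>.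
\<close>

definition outer_act ::
    "('k, 'a, 'm) module_scheme \<Rightarrow> 'a list \<Rightarrow> 'a list \<Rightarrow> 'a list" where
  "outer_act S ab xs =
     [hd ab \<otimes>\<^bsub>S\<^esub> hd xs] @ butlast (tl xs) @ [last xs \<otimes>\<^bsub>S\<^esub> last ab]"

definition env_act ::
    "('k::field \<Rightarrow> 'v::ab_group_add \<Rightarrow> 'v) \<Rightarrow> nat \<Rightarrow>
     (('k, 'v) vpoly set list \<Rightarrow>\<^sub>0 'k) set \<Rightarrow> (('k, 'v) vpoly set list \<Rightarrow>\<^sub>0 'k) set \<Rightarrow>
     (('k, 'v) vpoly set list \<Rightarrow>\<^sub>0 'k) set" where
  "env_act scale m u A = (\<Union>f\<in>u. \<Union>g\<in>A.
     rel_coset (multilin_rels (Sym scale) m) (bilin_ext (outer_act (Sym scale)) f g))"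

definition Env ::
    "('k::field \<Rightarrow> 'v::ab_group_add \<Rightarrow> 'v) \<Rightarrow>
     ('k, (('k, 'v) vpoly set list \<Rightarrow>\<^sub>0 'k) set) module" where
  "Env scale = (tensor_power (Sym scale) 2)
     \<lparr> monoid.mult := env_act scale 2,
       one := tens (Sym scale) [\<one>\<^bsub>Sym scale\<^esub>, \<one>\<^bsub>Sym scale\<^esub>] \<rparr>"


section \<open>Linear maps and chain maps\<close>

text \<open>Maps are extensional, so that a linear map is determined by its values on the carrier.\<close>

definition lin_maps ::
    "('r, 'n) ring_scheme \<Rightarrow> ('r, 'a, 'm) module_scheme \<Rightarrow> ('r, 'b, 'l) module_scheme \<Rightarrow>
     ('a \<Rightarrow> 'b) set" where
  "lin_maps R M N = {f \<in> carrier M \<rightarrow>\<^sub>E carrier N.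
     (\<forall>x\<in>carrier M. \<forall>y\<in>carrier M. f (x \<oplus>\<^bsub>M\<^esub> y) = f x \<oplus>\<^bsub>N\<^esub> f y) \<and>
     (\<forall>r\<in>carrier R. \<forall>x\<in>carrier M. f (r \<odot>\<^bsub>M\<^esub> x) = r \<odot>\<^bsub>N\<^esub> f x)}"

definition chain_map ::
    "('r, 'n) ring_scheme \<Rightarrow>
     (nat \<Rightarrow> ('r, 'a, 'm) module_scheme) \<Rightarrow> (nat \<Rightarrow> 'a \<Rightarrow> 'a) \<Rightarrow>
     (nat \<Rightarrow> ('r, 'b, 'l) module_scheme) \<Rightarrow> (nat \<Rightarrow> 'b \<Rightarrow> 'b) \<Rightarrow>
     (nat \<Rightarrow> 'a \<Rightarrow> 'b) \<Rightarrow> bool" where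
  "chain_map R C dC D dD f \<longleftrightarrow>
     (\<forall>p. f p \<in> lin_maps R (C p) (D p)) \<and>
     (\<forall>p\<ge>1. \<forall>x\<in>carrier (C p). f (p - 1) (dC p x) = dD p (f p x))"


section \<open>The bar resolution\<close>

definition Bar ::
    "('k::field \<Rightarrow> 'v::ab_group_add \<Rightarrow> 'v) \<Rightarrow> nat \<Rightarrow>
     ((('k, 'v) vpoly set list \<Rightarrow>\<^sub>0 'k) set, (('k, 'v) vpoly set list \<Rightarrow>\<^sub>0 'k) set) module" where
  "Bar scale p = (let T = tensor_power (Sym scale) (p + 2) in
     \<lparr> carrier = carrier T, monoid.mult = undefined, one = undefined,
       zero = zero T, add = add T, smult = env_act scale (p + 2) \<rparr>)"

definition bar_d ::
    "('k::field \<Rightarrow> 'v::ab_group_add \<Rightarrow> 'v) \<Rightarrow> nat \<Rightarrow>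
     (('k, 'v) vpoly set list \<Rightarrow>\<^sub>0 'k) set \<Rightarrow> (('k, 'v) vpoly set list \<Rightarrow>\<^sub>0 'k) set" where
  "bar_d scale p = (let S = Sym scale; E = Env scale; C = Bar scale (p - 1) in
     THE f. f \<in> lin_maps E (Bar scale p) C \<and>
       (\<forall>as \<in> carrier_lists S (p + 2).
          f (tens S as) =
            (\<Oplus>\<^bsub>C\<^esub> j\<in>{0..p}. ((\<ominus>\<^bsub>E\<^esub> \<one>\<^bsub>E\<^esub>) [^]\<^bsub>E\<^esub> j) \<odot>\<^bsub>C\<^esub>
               tens S (take j as @ [as ! j \<otimes>\<^bsub>S\<^esub> as ! (j + 1)] @ drop (j + 2) as))))"


section \<open>The Koszul resolution\<close>

definition Vmod ::
    "('k::field \<Rightarrow> 'v::ab_group_add \<Rightarrow> 'v) \<Rightarrow> ('k, 'v) module" where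
  "Vmod scale = \<lparr> carrier = UNIV, monoid.mult = undefined, one = undefined,
     zero = 0, add = (+), smult = scale \<rparr>"

type_synonym ('k, 'v) kos =
  "((('k, 'v) vpoly set list \<Rightarrow>\<^sub>0 'k) set \<times> ('v list \<Rightarrow>\<^sub>0 'k) set \<Rightarrow>\<^sub>0 'k) set"

definition Kos ::
    "('k::field \<Rightarrow> 'v::ab_group_add \<Rightarrow> 'v) \<Rightarrow> nat \<Rightarrow>
     ((('k, 'v) vpoly set list \<Rightarrow>\<^sub>0 'k) set, ('k, 'v) kos) module" where
  "Kos scale p =
    (let E = Env scale; W = ext_power (Vmod scale) p; T = tensor_prod E W in
     \<lparr> carrier = carrier T, monoid.mult = undefined, one = undefined,
       zero = zero T, add = add T,
       smult = (\<lambda>u A. \<Union>f\<in>A.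
         rel_coset (bilin_rels E W) (lin_ext (\<lambda>(u', w). (u \<otimes>\<^bsub>E\<^esub> u', w)) f)) \<rparr>)"

text \<open>The element \<open>u \<otimes> (w\<^sub>1 \<and> \<dots> \<and> w\<^sub>p)\<close> of \<open>S(V)\<^sup>e \<otimes> \<And>\<^sup>p V\<close>.\<close>

definition kos_tens ::
    "('k::field \<Rightarrow> 'v::ab_group_add \<Rightarrow> 'v) \<Rightarrow>
     (('k, 'v) vpoly set list \<Rightarrow>\<^sub>0 'k) set \<Rightarrow> 'v list \<Rightarrow> ('k, 'v) kos" where
  "kos_tens scale u ws =
     tens2 (Env scale) (ext_power (Vmod scale) (length ws)) u (wedge (Vmod scale) ws)"

text \<open>The differential is prescribed on wedges of arbitrary vectors, so it does not involve a basis.\<close>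

definition kos_d ::
    "('k::field \<Rightarrow> 'v::ab_group_add \<Rightarrow> 'v) \<Rightarrow> nat \<Rightarrow> ('k, 'v) kos \<Rightarrow> ('k, 'v) kos" where
  "kos_d scale p = (let S = Sym scale; E = Env scale; D = Kos scale (p - 1) in
     THE f. f \<in> lin_maps E (Kos scale p) D \<and>
       (\<forall>ws. length ws = p \<longrightarrow>
          f (kos_tens scale \<one>\<^bsub>E\<^esub> ws) =
            (\<Oplus>\<^bsub>D\<^esub> i\<in>{1..p}. ((\<ominus>\<^bsub>E\<^esub> \<one>\<^bsub>E\<^esub>) [^]\<^bsub>E\<^esub> (i + 1)) \<odot>\<^bsub>D\<^esub>
               kos_tens scale
                 (tens S [sym_inc scale (ws ! (i - 1)), \<one>\<^bsub>S\<^esub>] \<ominus>\<^bsub>E\<^esub>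
                  tens S [\<one>\<^bsub>S\<^esub>, sym_inc scale (ws ! (i - 1))])
                 (take (i - 1) ws @ drop i ws))))"


section \<open>The map \<open>\<Psi>\<^sub>B\<close>\<close>

text \<open>
  The basis is \<open>v 1, \<dots>, v n\<close>. The tuples \<open>\<ell>\<^sup>1, \<dots>, \<ell>\<^sup>p\<close> are \<open>l 1, \<dots>, l p\<close>, with entries
  \<open>l j 1, \<dots>, l j n\<close>; the indices \<open>i\<^sub>1 < \<dots> < i\<^sub>p\<close> are \<open>i 1, \<dots>, i p\<close>, and \<open>a\<^bsub>i\<^sub>j\<^esub>\<close> is \<open>a j\<close>.
\<close>

definition monom_pow ::
    "('k::field \<Rightarrow> 'v::ab_group_add \<Rightarrow> 'v) \<Rightarrow> nat \<Rightarrow> (nat \<Rightarrow> 'v) \<Rightarrow> (nat \<Rightarrow> nat) \<Rightarrow>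
     ('k, 'v) vpoly set" where
  "monom_pow scale n v e =
     (\<Otimes>\<^bsub>Sym scale\<^esub> m\<in>{1..n}. sym_inc scale (v m) [^]\<^bsub>Sym scale\<^esub> e m)"

definition index_seqs :: "nat \<Rightarrow> nat \<Rightarrow> (nat \<Rightarrow> nat) set" where
  "index_seqs n p = {i \<in> {1..p} \<rightarrow>\<^sub>E {1..n}. strict_mono_on {1..p} i}"

definition pad :: "nat \<Rightarrow> nat \<Rightarrow> (nat \<Rightarrow> nat) \<Rightarrow> nat \<Rightarrow> nat" where
  "pad n p i j = (if j = 0 then 0 else if j = p + 1 then n + 1 else i j)"

definition Q :: "nat \<Rightarrow> nat \<Rightarrow> (nat \<Rightarrow> nat \<Rightarrow> nat) \<Rightarrow> (nat \<Rightarrow> nat) \<Rightarrow> (nat \<Rightarrow> nat) \<Rightarrow> nat \<Rightarrow> nat" where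
  "Q n p l i a m =
     (if m \<in> i ` {1..p}
      then let j = (THE j. j \<in> {1..p} \<and> m = i j) in a j + (\<Sum>h\<in>{1..<j}. l h m)
      else let j = (THE j. j \<le> p \<and> pad n p i j < m \<and> m < pad n p i (j + 1)) in
        \<Sum>h\<in>{1..j}. l h m)"

text \<open>
  The exponents complementary to \<^const>\<open>Q\<close>. The subtraction does not truncate when \<open>a j < l j (i j)\<close>
  for all \<open>j\<close>.
\<close>

definition Q_hat :: "nat \<Rightarrow> nat \<Rightarrow> (nat \<Rightarrow> nat \<Rightarrow> nat) \<Rightarrow> (nat \<Rightarrow> nat) \<Rightarrow> (nat \<Rightarrow> nat) \<Rightarrow> nat \<Rightarrow> nat" where
  "Q_hat n p l i a m =
     (\<Sum>h\<in>{1..p}. l h m) - (Q n p l i a m + (if m \<in> i ` {1..p} then 1 else 0))"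

text \<open>
  In degree 0 the map is the identity of \<open>S(V)\<^sup>e\<close>, where \<open>S(V)\<^sup>e \<otimes> \<And>\<^sup>0 V\<close> is identified with
  \<open>S(V)\<^sup>e\<close> by means of the empty wedge product \<open>1 \<in> k = \<And>\<^sup>0 V\<close>.
\<close>

definition Psi ::
    "('k::field \<Rightarrow> 'v::ab_group_add \<Rightarrow> 'v) \<Rightarrow> nat \<Rightarrow> (nat \<Rightarrow> 'v) \<Rightarrow> nat \<Rightarrow>
     (('k, 'v) vpoly set list \<Rightarrow>\<^sub>0 'k) set \<Rightarrow> ('k, 'v) kos" where
  "Psi scale n v p =
    (let S = Sym scale; D = Kos scale p; mon = monom_pow scale n v in
     if p = 0 then (\<lambda>u\<in>carrier (Bar scale 0). kos_tens scale u [])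
     else THE f. f \<in> lin_maps (Env scale) (Bar scale p) D \<and>
       (\<forall>l. f (tens S ([\<one>\<^bsub>S\<^esub>] @ map (\<lambda>j. mon (l j)) [1..<p + 1] @ [\<one>\<^bsub>S\<^esub>])) =
          (\<Oplus>\<^bsub>D\<^esub> i\<in>index_seqs n p. \<Oplus>\<^bsub>D\<^esub> a\<in>(\<Pi>\<^sub>E j\<in>{1..p}. {0..<l j (i j)}).
             kos_tens scale
               (tens S [mon (Q n p l i a), mon (Q_hat n p l i a)])
               (map (\<lambda>j. v (i j)) [1..<p + 1]))))"

end

theory Submission
  imports Defs "HOL-Library.Function_Algebras" "HOL-Library.Product_Plus"
begin

text \<open>
  Let \<open>x\<^sub>m = v\<^sub>m \<otimes> 1\<close> and \<open>y\<^sub>m = 1 \<otimes> v\<^sub>m\<close>. A tensor of monomials \<open>v\<^bsup>e\<^sub>0\<^esup> \<otimes> \<dots> \<otimes> v\<^bsup>e\<^sub>p\<^sub>+\<^sub>1\<^esup>\<close> is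
  encoded by its total exponent \<open>T = e\<^sub>0 + \<dots> + e\<^sub>p\<^sub>+\<^sub>1\<close> and by the increasing chain
  \<open>L\<^sub>0 \<le> \<dots> \<le> L\<^sub>p\<close> of the partial sums \<open>L\<^sub>j = e\<^sub>0 + \<dots> + e\<^sub>j\<close>. Multiplying two neighbouring factors
  deletes one member of the chain and keeps \<open>T\<close>. In this encoding the bar differential is
  the boundary of a simplex.

  Put \<open>M\<^sub>m(L) = x\<^sub>m\<^bsup>L m\<^esup> y\<^sub>m\<^bsup>T m - L m\<^esup>\<close>, and let \<open>D\<^sub>m(L, L')\<close> be the sum of
  \<open>x\<^sub>m\<^bsup>s\<^esup> y\<^sub>m\<^bsup>T m - 1 - s\<^esup>\<close> over \<open>L m \<le> s < L' m\<close>. The exponents \<open>Q\<close> and their complements say that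
  the coefficient of \<open>v\<^bsub>i\<^sub>1\<^esub> \<and> \<dots> \<and> v\<^bsub>i\<^sub>p\<^esub>\<close> is the product of the \<open>D\<^bsub>i\<^sub>j\<^esub>(L\<^sub>j\<^sub>-\<^sub>1, L\<^sub>j)\<close> and of the
  \<open>M\<^sub>m(L\<^sub>j)\<close> for the variables \<open>m\<close> strictly between \<open>i\<^sub>j\<close> and \<open>i\<^sub>j\<^sub>+\<^sub>1\<close>. Splitting off the first variable \<open>m\<close> of
  a list of variables gives the recursion
  \<open>G(m # ms, L\<^sub>0 # c) = M\<^sub>m(L\<^sub>0) G(ms, L\<^sub>0 # c) + D\<^sub>m(L\<^sub>0, hd c) v\<^sub>m \<and> G(ms, c)\<close>,
  with no second summand for empty \<open>c\<close>. It defines \<open>kos_chain\<close>; lemma \<open>kos_chain_eq_sum\<close>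
  identifies it with the explicit formula.
  Two facts about the coefficients are used: \<open>(x\<^sub>m - y\<^sub>m) D\<^sub>m(L, L') = M\<^sub>m(L') - M\<^sub>m(L)\<close> by
  telescoping, and \<open>D\<^sub>m(L, L'') = D\<^sub>m(L, L') + D\<^sub>m(L', L'')\<close>. With them, induction on the list of
  variables shows that the Koszul differential of \<open>G(ms, c)\<close> is the alternating sum of the
  \<open>G(ms, c')\<close> over all \<open>c'\<close> that arise from \<open>c\<close> by deleting one member. This is lemma
  \<open>kos_diff_kos_chain\<close>, the theorem in coordinates.

  The remaining work transports this identity to the quotient spaces. The two
  differentials and, in positive degrees, the comparison map are each described as the unique
  linear map with prescribed values, so existence and uniqueness have to be proved. Uniqueness holds because
  the values are prescribed on generators over the enveloping algebra (\<open>bar_map_eqI\<close>,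
  \<open>kos_map_eqI\<close>). For the existence of maps out of the bar modules one needs that the monomials
  form a basis of \<open>S(V)\<close>: coefficients are well defined, every tensor power of \<open>S(V)\<close> has
  a basis indexed by lists of exponents, and maps may be defined on it
  (\<open>bar_map_exists\<close>). The Koszul differential is prescribed on wedges of arbitrary vectors; it exists
  because the contraction of an alternating multilinear map with a linear map is again alternating
  (\<open>contraction_alternating\<close>).
\<close>


section \<open>Linear and bilinear maps between free vector spaces\<close>

lemma lookup_fscale [simp]: "Poly_Mapping.lookup (fscale c f) x = c * Poly_Mapping.lookup f x"
  by (simp add: fscale_def Poly_Mapping.map.rep_eq when_def)

abbreviation supp :: "('x \<Rightarrow>\<^sub>0 'k::zero) \<Rightarrow> 'x set" where
  "supp \<equiv> Poly_Mapping.keys"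

abbreviation words :: "nat \<Rightarrow> 'x list set" where
  "words m \<equiv> {xs. length xs = m}"

interpretation free: vector_space "fscale :: 'k::field \<Rightarrow> ('x \<Rightarrow>\<^sub>0 'k) \<Rightarrow> ('x \<Rightarrow>\<^sub>0 'k)"
  by unfold_locales (auto intro!: poly_mapping_eqI simp: lookup_add algebra_simps)

abbreviation flin :: "(('x \<Rightarrow>\<^sub>0 'k::field) \<Rightarrow> ('y \<Rightarrow>\<^sub>0 'k)) \<Rightarrow> bool" where
  "flin \<equiv> Vector_Spaces.linear fscale fscale"

lemma flinI:
  assumes "\<And>f g. H (f + g) = H f + H g" and "\<And>c f. H (fscale c f) = fscale c (H f)"
  shows "flin H"
  using assms
  by (simp add: Vector_Spaces.linear_iff free.vector_space_axioms)

lemma flin_add: "flin H \<Longrightarrow> H (f + g) = H f + H g"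
  and flin_scale: "flin H \<Longrightarrow> H (fscale c f) = fscale c (H f)"
  by (simp_all add: Vector_Spaces.linear_iff)

lemma flin_hom: "flin H \<Longrightarrow> module_hom fscale fscale H"
  by (rule Vector_Spaces.linear.axioms(3))

lemma flin_0: "flin H \<Longrightarrow> H 0 = 0"
  and flin_diff: "flin H \<Longrightarrow> H (f - g) = H f - H g"
  and flin_minus: "flin H \<Longrightarrow> H (- f) = - H f"
  and flin_sum: "flin H \<Longrightarrow> H (sum F A) = (\<Sum>i\<in>A. H (F i))"
  by (auto dest!: flin_hom simp: module_hom.zero module_hom.diff module_hom.neg module_hom.sum)

lemma flin_id: "flin (\<lambda>f. f)"
  by (rule flinI) auto

lemma flin_comp: "flin G \<Longrightarrow> flin H \<Longrightarrow> flin (\<lambda>f. G (H f))"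
  by (rule flinI) (simp_all add: flin_add flin_scale)

lemma flin_plus: "flin G \<Longrightarrow> flin H \<Longrightarrow> flin (\<lambda>f. G f + H f)"
  and flin_uminus: "flin G \<Longrightarrow> flin (\<lambda>f. - G f)"
  and flin_minus2: "flin G \<Longrightarrow> flin H \<Longrightarrow> flin (\<lambda>f. G f - H f)"
  and flin_fscale: "flin G \<Longrightarrow> flin (\<lambda>f. fscale c (G f))"
  by (rule flinI; simp add: flin_add flin_scale algebra_simps)+

lemma flin_sum_fun: "(\<And>i. i \<in> A \<Longrightarrow> flin (H i)) \<Longrightarrow> flin (\<lambda>f. \<Sum>i\<in>A. H i f)"
  by (rule flinI) (simp_all add: flin_add flin_scale sum.distrib free.scale_sum_right)

lemma fscale_single [simp]: "fscale c (Poly_Mapping.single x d) = Poly_Mapping.single x (c * d)"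
  by (rule poly_mapping_eqI) (simp add: lookup_single when_def)

lemma poly_mapping_expand:
  "f = (\<Sum>x\<in>supp f. fscale (Poly_Mapping.lookup f x) (pt x))"
proof (rule poly_mapping_eqI)
  fix y
  have "(\<Sum>x\<in>supp f. Poly_Mapping.lookup f x * (1 when x = y)) =
      (\<Sum>x\<in>supp f. if x = y then Poly_Mapping.lookup f y else 0)"
    by (rule sum.cong) (auto simp: when_def)
  then show "Poly_Mapping.lookup f y =
      Poly_Mapping.lookup (\<Sum>x\<in>supp f. fscale (Poly_Mapping.lookup f x) (pt x)) y"
    by (simp add: lookup_sum lookup_single in_keys_iff when_def)
qed

lemma flin_eqI:
  fixes G H :: "('x \<Rightarrow>\<^sub>0 'k::field) \<Rightarrow> ('y \<Rightarrow>\<^sub>0 'k)"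
  assumes G: "flin G" and H: "flin H" and eq: "\<And>x. x \<in> supp f \<Longrightarrow> G (pt x) = H (pt x)"
  shows "G f = H f"
proof -
  have expand: "F f = (\<Sum>x\<in>supp f. fscale (Poly_Mapping.lookup f x) (F (pt x)))"
    if "flin F" for F :: "('x \<Rightarrow>\<^sub>0 'k) \<Rightarrow> ('y \<Rightarrow>\<^sub>0 'k)"
  proof -
    have "F f = F (\<Sum>x\<in>supp f. fscale (Poly_Mapping.lookup f x) (pt x))"
      by (rule arg_cong[OF poly_mapping_expand])
    then show ?thesis
      by (simp only: flin_sum[OF that] flin_scale[OF that])
  qed
  show ?thesis
    using eq by (simp add: expand[OF G] expand[OF H])
qed

definition lext :: "('x \<Rightarrow> ('y \<Rightarrow>\<^sub>0 'k)) \<Rightarrow> ('x \<Rightarrow>\<^sub>0 'k::field) \<Rightarrow> ('y \<Rightarrow>\<^sub>0 'k)" where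
  "lext h f = (\<Sum>x\<in>supp f. fscale (Poly_Mapping.lookup f x) (h x))"

lemma lext_superset:
  assumes "finite A" "supp f \<subseteq> A"
  shows "lext h f = (\<Sum>x\<in>A. fscale (Poly_Mapping.lookup f x) (h x))"
  unfolding lext_def using assms by (intro sum.mono_neutral_left) (auto simp: in_keys_iff)

lemma flin_lext:
  fixes h :: "'x \<Rightarrow> ('y \<Rightarrow>\<^sub>0 'k::field)"
  shows "flin (lext h)"
proof (rule flinI)
  fix f g :: "'x \<Rightarrow>\<^sub>0 'k" and c
  let ?A = "supp f \<union> supp g"
  show "lext h (f + g) = lext h f + lext h g"
    using keys_add[of f g]
    by (simp add: lext_superset[of ?A] lookup_add free.scale_left_distrib sum.distrib)
  show "lext h (fscale c f) = fscale c (lext h f)"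
    by (subst (1 2) lext_superset[of "supp f"])
      (auto simp: in_keys_iff free.scale_sum_right)
qed

lemma lext_pt [simp]: "lext h (pt x) = h x"
  by (simp add: lext_def)

lemma lext_1: "lext h 1 = h 0"
  by (simp flip: single_one)

lemma lext_single: "lext h (Poly_Mapping.single x c) = fscale c (h x)"
  using flin_scale[OF flin_lext, of h c "pt x"] by simp

lemma lin_ext_eq_lext: "lin_ext h = lext (\<lambda>x. pt (h x))"
  by (rule ext) (simp add: lin_ext_def lext_def)

lemma flin_lin_ext: "flin (lin_ext h)"
  by (simp add: lin_ext_eq_lext flin_lext)

lemma lin_ext_pt [simp]: "lin_ext h (pt x) = pt (h x)"
  by (simp add: lin_ext_eq_lext)

lemma bilin_ext_eq_lext: "bilin_ext h f g = lext (\<lambda>x. lin_ext (h x) g) f"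
  by (simp add: bilin_ext_def lext_def lin_ext_def free.scale_sum_right)

lemma flin_bilin_ext_left: "flin (\<lambda>f. bilin_ext h f g)"
  by (simp add: bilin_ext_eq_lext flin_lext)

lemma flin_bilin_ext_right: "flin (bilin_ext h f)"
  unfolding bilin_ext_eq_lext lext_def
  by (intro flin_sum_fun flin_fscale flin_lin_ext)

lemma bilin_ext_pt [simp]: "bilin_ext h (pt x) (pt y) = pt (h x y)"
  by (simp add: bilin_ext_eq_lext)

lemma bilin_ext_pt_left: "bilin_ext h (pt x) g = lin_ext (h x) g"
  by (simp add: bilin_ext_eq_lext)

lemma bilin_eqI:
  fixes G H :: "('x \<Rightarrow>\<^sub>0 'k::field) \<Rightarrow> ('y \<Rightarrow>\<^sub>0 'k) \<Rightarrow> ('z \<Rightarrow>\<^sub>0 'k)"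
  assumes "flin (\<lambda>f. G f g)" "flin (\<lambda>f. H f g)" "\<And>x. flin (G (pt x))" "\<And>x. flin (H (pt x))"
    and eq: "\<And>x y. x \<in> supp f \<Longrightarrow> y \<in> supp g \<Longrightarrow>
      G (pt x) (pt y) = H (pt x) (pt y)"
  shows "G f g = H f g"
proof (rule flin_eqI[OF assms(1,2)])
  fix x assume x: "x \<in> supp f"
  show "G (pt x) g = H (pt x) g"
    by (rule flin_eqI[OF assms(3,4)]) (rule eq[OF x])
qed

lemma fscale_times:
  fixes f g :: "'x::comm_monoid_add \<Rightarrow>\<^sub>0 'k::field"
  shows "fscale c f * g = fscale c (f * g)" and "f * fscale c g = fscale c (f * g)"
proof -
  have *: "fscale c f = Poly_Mapping.single 0 c * f" for f :: "'x \<Rightarrow>\<^sub>0 'k"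
    by (simp add: fscale_def mult_map_scale_conv_mult)
  show "fscale c f * g = fscale c (f * g)" "f * fscale c g = fscale c (f * g)"
    by (simp_all add: * mult_ac)
qed

lemma times_eq_bilin_ext:
  fixes f g :: "'x::comm_monoid_add \<Rightarrow>\<^sub>0 'k::field"
  shows "f * g = bilin_ext (+) f g"
proof (rule bilin_eqI[where G = "(*)"])
  show "flin (\<lambda>f. f * g)" "\<And>x. flin ((*) (pt x :: 'x \<Rightarrow>\<^sub>0 'k))"
    by (auto intro!: flinI simp: fscale_times distrib_left distrib_right)
qed (simp_all add: mult_single flin_bilin_ext_left flin_bilin_ext_right)

lemma flin_times_left: "flin (\<lambda>f. f * g)" and flin_times_right: "flin ((*) f)"
  for f g :: "'x::comm_monoid_add \<Rightarrow>\<^sub>0 'k::field"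
  unfolding times_eq_bilin_ext by (rule flin_bilin_ext_left flin_bilin_ext_right)+

lemma pt_plus: "pt (x + y) = pt x * (pt y :: 'a::comm_monoid_add \<Rightarrow>\<^sub>0 'k::field)"
  by (simp add: mult_single)

lemma pt_sum: "finite A \<Longrightarrow> pt (sum F A) = (\<Prod>i\<in>A. pt (F i) :: 'a::comm_monoid_add \<Rightarrow>\<^sub>0 'k::field)"
  by (induction A rule: finite_induct) (simp_all add: pt_plus del: mult_single)

text \<open>Both sides are bilinear, and on two basis elements the claim is the hypothesis. This
  makes every substitution of algebra elements for variables an algebra map.\<close>

lemma lext_mult:
  fixes h :: "'x::comm_monoid_add \<Rightarrow> ('y::comm_monoid_add \<Rightarrow>\<^sub>0 'k::field)"
  assumes h: "\<And>x y. h (x + y) = h x * h y"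
  shows "lext h (f * g) = lext h f * lext h g"
proof (rule bilin_eqI[where G = "\<lambda>f g. lext h (f * g)" and H = "\<lambda>f g. lext h f * lext h g"])
  show "flin (\<lambda>f. lext h (f * g))"
    by (rule flin_comp[OF flin_lext flin_times_left])
  show "flin (\<lambda>f. lext h f * lext h g)"
    by (rule flin_comp[OF flin_times_left flin_lext])
  show "flin (\<lambda>g. lext h (pt x * g))" for x
    by (rule flin_comp[OF flin_lext flin_times_right])
  show "flin (\<lambda>g. lext h (pt x) * lext h g)" for x
    by (rule flin_comp[OF flin_times_right flin_lext])
qed (simp add: mult_single h)

lemma keys_fscale: "supp (fscale c f) \<subseteq> supp f"
  by (auto simp: in_keys_iff)

lemma keys_sum_subset: 
  "(\<And>i. i \<in> A \<Longrightarrow> supp (F i) \<subseteq> X) \<Longrightarrow> supp (sum F A) \<subseteq> X"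
proof (induction A rule: infinite_finite_induct)
  case (insert i A)
  then show ?case using keys_add[of "F i" "sum F A"] by auto
qed auto

lemma subspace_supported: "free.subspace {f :: 'a \<Rightarrow>\<^sub>0 'b::field. supp f \<subseteq> X}"
proof (rule free.subspaceI)
  fix f g :: "'a \<Rightarrow>\<^sub>0 'b"
  show "f \<in> {f. supp f \<subseteq> X} \<Longrightarrow> g \<in> {f. supp f \<subseteq> X} \<Longrightarrow>
      f + g \<in> {f. supp f \<subseteq> X}"
    using keys_add[of f g] by auto
  show "f \<in> {f. supp f \<subseteq> X} \<Longrightarrow> fscale c f \<in> {f. supp f \<subseteq> X}" for c
    using keys_fscale[of c f] by auto
qed simp

lemma keys_lext: 
  "(\<And>x. x \<in> supp f \<Longrightarrow> supp (h x) \<subseteq> X) \<Longrightarrow> 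
   supp (lext h f) \<subseteq> X"
  unfolding lext_def by (intro keys_sum_subset order_trans[OF keys_fscale])

lemma keys_lin_ext:
  "(\<And>x. x \<in> supp f \<Longrightarrow> h x \<in> X) \<Longrightarrow> supp (lin_ext h f) \<subseteq> X"
  by (simp add: lin_ext_eq_lext keys_lext)

lemma keys_bilin_ext:
  "(\<And>x y. x \<in> supp f \<Longrightarrow> y \<in> supp g \<Longrightarrow> h x y \<in> X) \<Longrightarrow> 
   supp (bilin_ext h f g) \<subseteq> X"
  by (simp add: bilin_ext_eq_lext keys_lext keys_lin_ext)


section \<open>Spaces given by generators and relations\<close>

lemma flin_span:
  assumes H: "flin H" and R: "\<And>r. r \<in> R \<Longrightarrow> H r \<in> free.span R'" and f: "f \<in> free.span R"
  shows "H f \<in> free.span R'"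
  using f
proof (induction rule: free.span_induct)
  case base
  show ?case
    unfolding free.subspace_def mem_Collect_eq flin_0[OF H] flin_add[OF H] flin_scale[OF H]
    by (simp add: free.span_zero free.span_add free.span_scale)
next
  case (step x)
  then show ?case by (rule R)
qed

lemma flin_span_0:
  assumes H: "flin H" and R: "\<And>r. r \<in> R \<Longrightarrow> H r = 0" and f: "f \<in> free.span R"
  shows "H f = 0"
  using flin_span[OF H _ f, of "{}"] R by simp

lemma rel_coset_eq_iff: "rel_coset R f = rel_coset R g \<longleftrightarrow> f - g \<in> free.span R"
proof
  assume "rel_coset R f = rel_coset R g"
  moreover have "f \<in> rel_coset R f" by (simp add: rel_coset_def free.span_zero)
  ultimately show "f - g \<in> free.span R" by (auto simp: rel_coset_def)
next
  assume *: "f - g \<in> free.span R"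
  have "h - f \<in> free.span R \<longleftrightarrow> h - g \<in> free.span R" for h
    using free.span_add[OF _ *, of "h - f"] free.span_diff[OF _ *, of "h - g"] by auto
  then show "rel_coset R f = rel_coset R g" by (auto simp: rel_coset_def)
qed

lemma mem_rel_coset_iff: "g \<in> rel_coset R f \<longleftrightarrow> rel_coset R g = rel_coset R f"
  by (simp add: rel_coset_eq_iff) (simp add: rel_coset_def)

lemma mem_rel_coset_self [simp]: "f \<in> rel_coset R f"
  by (simp add: mem_rel_coset_iff)

lemma rel_coset_add_cong:
  "rel_coset R f = rel_coset R f' \<Longrightarrow> rel_coset R g = rel_coset R g' \<Longrightarrow>
   rel_coset R (f + g) = rel_coset R (f' + g')"
  unfolding rel_coset_eq_iff by (drule (1) free.span_add) (simp add: algebra_simps)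

lemma rel_coset_scale_cong:
  "rel_coset R f = rel_coset R f' \<Longrightarrow> rel_coset R (fscale c f) = rel_coset R (fscale c f')"
  unfolding rel_coset_eq_iff free.scale_right_diff_distrib[symmetric] by (rule free.span_scale)

text \<open>The operations on cosets are unions over representatives. Such a union collapses as
  soon as all representatives have the same image.\<close>

lemma UN_rel_coset:
  assumes "\<And>f'. rel_coset R f' = rel_coset R f \<Longrightarrow> F f' = F f"
  shows "(\<Union>f'\<in>rel_coset R f. F f') = F f"
proof
  show "(\<Union>f'\<in>rel_coset R f. F f') \<subseteq> F f"
    using assms by (intro UN_least) (metis mem_rel_coset_iff order_refl)
  show "F f \<subseteq> (\<Union>f'\<in>rel_coset R f. F f')"
    by (rule UN_upper) simp
qed

lemma pres_space_carrier: "carrier (pres_space X R) = rel_coset R ` {f. supp f \<subseteq> X}"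
  by (simp add: pres_space_def)

lemma pres_space_zero: "\<zero>\<^bsub>pres_space X R\<^esub> = rel_coset R 0"
  by (simp add: pres_space_def)

lemma pres_space_add: "rel_coset R f \<oplus>\<^bsub>pres_space X R\<^esub> rel_coset R g = rel_coset R (f + g)"
proof -
  have "(\<Union>g'\<in>rel_coset R g. rel_coset R (f' + g')) = rel_coset R (f' + g)" for f'
    by (rule UN_rel_coset) (rule rel_coset_add_cong[OF refl])
  moreover have "(\<Union>f'\<in>rel_coset R f. rel_coset R (f' + g)) = rel_coset R (f + g)"
    by (rule UN_rel_coset) (rule rel_coset_add_cong[OF _ refl])
  ultimately show ?thesis
    by (simp add: pres_space_def)
qed

lemma pres_space_smult: "c \<odot>\<^bsub>pres_space X R\<^esub> rel_coset R f = rel_coset R (fscale c f)"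
proof -
  have "(\<Union>f'\<in>rel_coset R f. rel_coset R (fscale c f')) = rel_coset R (fscale c f)"
    by (rule UN_rel_coset) (rule rel_coset_scale_cong)
  then show ?thesis
    by (simp add: pres_space_def)
qed

text \<open>A linear projection with kernel the span of the relations. It turns congruences modulo
  the relations into equations in a free space, where maps can be compared by linear
  extension.\<close>

definition nf :: "('x \<Rightarrow>\<^sub>0 'k::field) set \<Rightarrow> ('x \<Rightarrow>\<^sub>0 'k) \<Rightarrow> ('x \<Rightarrow>\<^sub>0 'k)" where
  "nf R = (SOME N. flin N \<and> (\<forall>f. N f = 0 \<longleftrightarrow> f \<in> free.span R))"

lemma nf_spec:
  fixes R :: "('x \<Rightarrow>\<^sub>0 'k::field) set"
  shows "flin (nf R) \<and> (\<forall>f. nf R f = 0 \<longleftrightarrow> f \<in> free.span R)"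
proof -
  interpret vector_space_pair "fscale :: 'k::field \<Rightarrow> ('x \<Rightarrow>\<^sub>0 'k) \<Rightarrow> ('x \<Rightarrow>\<^sub>0 'k)"
      "fscale :: 'k::field \<Rightarrow> ('x \<Rightarrow>\<^sub>0 'k) \<Rightarrow> ('x \<Rightarrow>\<^sub>0 'k)" ..
  obtain P where P: "range P \<subseteq> free.span R" "flin P" "\<And>f. f \<in> free.span R \<Longrightarrow> P f = f"
    using linear_exists_left_inverse_on[OF flin_id free.subspace_span, of R] by auto
  have "flin (\<lambda>f. f - P f)"
    by (intro flin_minus2 flin_id P)
  moreover have "f - P f = 0 \<longleftrightarrow> f \<in> free.span R" for f
  proof
    assume "f - P f = 0"
    then have "f = P f" by simp
    also have "P f \<in> free.span R" using P(1) by blast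
    finally show "f \<in> free.span R" .
  qed (simp add: P(3))
  ultimately have "flin (\<lambda>f. f - P f) \<and> (\<forall>f. f - P f = 0 \<longleftrightarrow> f \<in> free.span R)"
    by blast
  then show ?thesis
    unfolding nf_def
    by (rule someI[where P = "\<lambda>N. flin N \<and> (\<forall>f. N f = 0 \<longleftrightarrow> f \<in> free.span R)"])
qed

lemma flin_nf: "flin (nf R)"
  using nf_spec by blast

lemma nf_eq_iff: "nf R f = nf R g \<longleftrightarrow> rel_coset R f = rel_coset R g"
proof -
  have "nf R f = nf R g \<longleftrightarrow> nf R (f - g) = 0"
    by (simp add: flin_diff[OF flin_nf])
  then show ?thesis
    using nf_spec[of R] by (simp add: rel_coset_eq_iff)
qed

lemma nf_rel: "r \<in> R \<Longrightarrow> nf R r = 0"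
  using nf_spec[of R] by (simp add: free.span_base)

text \<open>The spaces of the two resolutions share their underlying groups with presented spaces
  but differ from them in the other record fields.\<close>

locale presented_group =
  fixes C :: "('r, ('x \<Rightarrow>\<^sub>0 'k::field) set, 'm) module_scheme" (structure)
    and X :: "'x set" and R :: "('x \<Rightarrow>\<^sub>0 'k) set"
  assumes carrier_eq: "carrier C = rel_coset R ` {f. supp f \<subseteq> X}"
    and zero_eq: "\<zero> = rel_coset R 0"
    and add_eq: "rel_coset R f \<oplus> rel_coset R g = rel_coset R (f + g)"
begin

lemma in_carrier: "supp f \<subseteq> X \<Longrightarrow> rel_coset R f \<in> carrier C"
  by (simp add: carrier_eq)

lemma carrierE:
  assumes "A \<in> carrier C"
  obtains f where "A = rel_coset R f" "supp f \<subseteq> X"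
  using assms by (auto simp: carrier_eq)

lemma keys_plus_subset:
  "supp f \<subseteq> X \<Longrightarrow> supp g \<subseteq> X \<Longrightarrow> supp (f + g) \<subseteq> X"
  using keys_add[of f g] by auto

lemma group: "abelian_group C"
proof (rule abelian_groupI)
  show "\<exists>y\<in>carrier C. y \<oplus> x = \<zero>" if "x \<in> carrier C" for x
    using that
  proof (elim carrierE)
    fix f assume f: "x = rel_coset R f" "supp f \<subseteq> X"
    then have "rel_coset R (- f) \<in> carrier C"
      by (intro in_carrier) (auto simp: in_keys_iff)
    then show ?thesis
      using f by (intro bexI[of _ "rel_coset R (- f)"]) (simp_all add: add_eq zero_eq)
  qed
qed (auto elim!: carrierE simp: add_eq zero_eq in_carrier keys_plus_subset add_ac)

sublocale abelian_group C
  by (rule group)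

lemma a_inv_eq: "supp f \<subseteq> X \<Longrightarrow> \<ominus> rel_coset R f = rel_coset R (- f)"
  by (rule minus_equality[OF _ in_carrier in_carrier])
    (auto simp: add_eq zero_eq in_keys_iff)

lemma a_minus_eq:
  assumes "supp f \<subseteq> X" "supp g \<subseteq> X"
  shows "rel_coset R f \<ominus> rel_coset R g = rel_coset R (f - g)"
  using assms by (simp add: a_minus_def a_inv_eq add_eq)

lemma finsum_eq:
  assumes "finite A" and "\<And>i. i \<in> A \<Longrightarrow> supp (F i) \<subseteq> X"
  shows "(\<Oplus>i\<in>A. rel_coset R (F i)) = rel_coset R (\<Sum>i\<in>A. F i)"
  using assms by (induction A rule: finite_induct) (simp_all add: zero_eq add_eq in_carrier)

end

lemma presented_group_pres_space: "presented_group (pres_space X R) X R"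
  by unfold_locales (simp_all add: pres_space_carrier pres_space_zero pres_space_add)


section \<open>The symmetric algebra\<close>

lemma keys_UNIV: "supp f \<subseteq> UNIV"
  by simp

lemma presented_Sym: "presented_group (Sym scale) UNIV (sym_rels scale)"
  by unfold_locales
    (use pres_space_carrier pres_space_zero pres_space_add in \<open>force simp: Sym_def pres_space_def\<close>)+

lemma Sym_smult: "c \<odot>\<^bsub>Sym scale\<^esub> rel_coset (sym_rels scale) f = rel_coset (sym_rels scale) (fscale c f)"
  using pres_space_smult[where X = UNIV and R = "sym_rels scale"] by (simp add: Sym_def pres_space_def)

text \<open>The set of relations is closed under multiplication, so its linear span is an ideal.\<close>

lemma span_sym_rels_ideal:
  assumes "f \<in> free.span (sym_rels scale)"
  shows "g * f \<in> free.span (sym_rels scale)"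
proof (rule flin_span[OF flin_times_right _ assms])
  fix r assume "r \<in> sym_rels scale"
  then have "g * r \<in> sym_rels scale"
    unfolding sym_rels_def by (auto simp: mult.assoc[symmetric]) blast+
  then show "g * r \<in> free.span (sym_rels scale)"
    by (rule free.span_base)
qed

lemma Sym_mult:
  "rel_coset (sym_rels scale) f \<otimes>\<^bsub>Sym scale\<^esub> rel_coset (sym_rels scale) g =
   rel_coset (sym_rels scale) (f * g)"
proof -
  have cong: "rel_coset (sym_rels scale) (f' * g') = rel_coset (sym_rels scale) (f' * g)"
    if "rel_coset (sym_rels scale) g' = rel_coset (sym_rels scale) g" for f' g g'
    using span_sym_rels_ideal[of "g' - g" scale f'] that
    by (simp add: rel_coset_eq_iff right_diff_distrib)
  have "(\<Union>g'\<in>rel_coset (sym_rels scale) g. rel_coset (sym_rels scale) (f' * g')) =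
      rel_coset (sym_rels scale) (f' * g)" for f'
    by (rule UN_rel_coset) (rule cong)
  moreover have "(\<Union>f'\<in>rel_coset (sym_rels scale) f. rel_coset (sym_rels scale) (f' * g)) =
      rel_coset (sym_rels scale) (f * g)"
    by (rule UN_rel_coset) (metis cong mult.commute)
  ultimately show ?thesis
    by (simp add: Sym_def)
qed

lemma Sym_one: "\<one>\<^bsub>Sym scale\<^esub> = rel_coset (sym_rels scale) 1"
  by (simp add: Sym_def)

lemma Sym_carrierE:
  assumes "a \<in> carrier (Sym scale)"
  obtains f where "a = rel_coset (sym_rels scale) f"
  using presented_group.carrierE[OF presented_Sym assms] by blast

lemma rel_coset_in_Sym: "rel_coset (sym_rels scale) f \<in> carrier (Sym scale)"
  using presented_group.in_carrier[OF presented_Sym keys_UNIV] .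

lemma comm_monoid_Sym: "comm_monoid (Sym scale)"
  by (rule comm_monoidI)
    (auto elim!: Sym_carrierE simp: Sym_mult Sym_one rel_coset_in_Sym mult_ac)

lemma Sym_pow:
  "rel_coset (sym_rels scale) f [^]\<^bsub>Sym scale\<^esub> (k::nat) = rel_coset (sym_rels scale) (f ^ k)"
proof -
  interpret comm_monoid "Sym scale" by (rule comm_monoid_Sym)
  show ?thesis
    by (induction k) (simp_all add: Sym_one Sym_mult mult.commute)
qed

lemma Sym_prod:
  assumes "finite A"
  shows "(\<Otimes>\<^bsub>Sym scale\<^esub>i\<in>A. rel_coset (sym_rels scale) (F i)) =
    rel_coset (sym_rels scale) (\<Prod>i\<in>A. F i)"
proof -
  interpret comm_monoid "Sym scale" by (rule comm_monoid_Sym)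
  show ?thesis
    using assms by (induction A rule: finite_induct)
      (simp_all add: Sym_one Sym_mult rel_coset_in_Sym)
qed

lemma Sym_var_add:
  "rel_coset (sym_rels scale) (var (x + y)) = rel_coset (sym_rels scale) (var x + var y)"
proof -
  have "1 * (var (x + y) - var x - var y) \<in> sym_rels scale"
    unfolding sym_rels_def by blast
  from free.span_base[OF this] show ?thesis
    by (simp add: rel_coset_eq_iff diff_diff_eq)
qed

lemma Sym_var_scale:
  "rel_coset (sym_rels scale) (var (scale c x)) = rel_coset (sym_rels scale) (fscale c (var x))"
proof -
  have "1 * (var (scale c x) - fscale c (var x)) \<in> sym_rels scale"
    unfolding sym_rels_def by blast
  from free.span_base[OF this] show ?thesis
    by (simp add: rel_coset_eq_iff)
qed

section \<open>The basis of monomials\<close>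

type_synonym 'k npoly = "(nat \<Rightarrow> nat) \<Rightarrow>\<^sub>0 'k"

definition unit_exp :: "nat \<Rightarrow> nat \<Rightarrow> nat" where
  "unit_exp m = (\<lambda>i. if i = m then 1 else 0)"

lemma sum_fun_apply: "sum F A i = (\<Sum>m\<in>A. F m i)"
  for F :: "'a \<Rightarrow> 'b \<Rightarrow> 'c::comm_monoid_add"
  by (induction A rule: infinite_finite_induct) simp_all

(* Index sets keep the form {1..n}, in which the facts about the basis are stated. *)
declare One_nat_def [simp del]

locale based_space =
  fixes scale :: "'k::field \<Rightarrow> 'v::ab_group_add \<Rightarrow> 'v" and n :: nat and v :: "nat \<Rightarrow> 'v"
  assumes finite_dim: "finite_dimensional_vector_space scale (v ` {1..n})"
    and inj_v: "inj_on v {1..n}"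
begin

sublocale V: finite_dimensional_vector_space scale "v ` {1..n}"
  by (rule finite_dim)

abbreviation "S \<equiv> Sym scale"

abbreviation "symc \<equiv> rel_coset (sym_rels scale)"

abbreviation "smon \<equiv> monom_pow scale n v"

definition coord :: "'v \<Rightarrow> nat \<Rightarrow> 'k" where
  "coord x m = V.representation (v ` {1..n}) x (v m)"

lemma coord_add: "coord (x + y) m = coord x m + coord y m"
  and coord_scale: "coord (scale c x) m = c * coord x m"
  by (simp_all add: coord_def V.representation_add V.representation_scale V.independent_Basis V.span_Basis)

lemma coord_basis: "m \<in> {1..n} \<Longrightarrow> i \<in> {1..n} \<Longrightarrow> coord (v i) m = (if i = m then 1 else 0)"
  using inj_on_eq_iff[OF inj_v, of m i]
  by (simp add: coord_def V.representation_basis[OF V.independent_Basis])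

lemma sum_coord: "(\<Sum>m\<in>{1..n}. scale (coord x m) (v m)) = x"
proof -
  have "(\<Sum>b\<in>v ` {1..n}. scale (V.representation (v ` {1..n}) x b) b) = x"
    by (rule V.sum_representation_eq) (simp_all add: V.independent_Basis V.span_Basis)
  then show ?thesis
    by (simp add: sum.reindex[OF inj_v] coord_def)
qed

definition vmono :: "(nat \<Rightarrow> nat) \<Rightarrow> ('k, 'v) vpoly" where
  "vmono e = (\<Prod>m\<in>{1..n}. var (v m) ^ e m)"

lemma smon_eq: "smon e = symc (vmono e)"
  by (simp add: monom_pow_def vmono_def sym_inc_def Sym_pow Sym_prod)

lemma vmono_add: "vmono (e + e') = vmono e * vmono e'"
  by (simp add: vmono_def power_add prod.distrib)

lemma vmono_0: "vmono 0 = 1"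
  by (simp add: vmono_def)

lemma vmono_unit_exp: "m \<in> {1..n} \<Longrightarrow> vmono (unit_exp m) = var (v m)"
  by (simp add: vmono_def unit_exp_def if_distrib prod.delta cong: if_cong)

text \<open>Exponents are functions on all of \<open>nat\<close>, but a monomial depends only on their values at
  the indices of the basis; truncated exponents correspond to monomials bijectively.\<close>

definition trunc :: "(nat \<Rightarrow> nat) \<Rightarrow> nat \<Rightarrow> nat" where
  "trunc e = (\<lambda>m. if m \<in> {1..n} then e m else 0)"

lemma smon_trunc: "smon (trunc e) = smon e"
  by (simp add: smon_eq vmono_def trunc_def)

definition vec_poly :: "'v \<Rightarrow> 'k npoly" where
  "vec_poly x = (\<Sum>m\<in>{1..n}. fscale (coord x m) (pt (unit_exp m)))"

text \<open>The algebra map that replaces each vector by the linear form of its coordinates. It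
  descends to \<open>S(V)\<close> and reads off the coefficients of an element in the basis of monomials.\<close>

definition coeffs :: "('k, 'v) vpoly \<Rightarrow> 'k npoly" where
  "coeffs = lext (\<lambda>e. \<Prod>x\<in>supp e. vec_poly x ^ Poly_Mapping.lookup e x)"

lemma flin_coeffs: "flin coeffs"
  by (simp add: coeffs_def flin_lext)

lemma coeffs_mult: "coeffs (f * g) = coeffs f * coeffs g"
  unfolding coeffs_def
proof (rule lext_mult)
  fix d e :: "'v \<Rightarrow>\<^sub>0 nat"
  let ?A = "supp d \<union> supp e"
  have superset: "(\<Prod>x\<in>supp c. vec_poly x ^ Poly_Mapping.lookup c x) =
      (\<Prod>x\<in>?A. vec_poly x ^ Poly_Mapping.lookup c x)" if "supp c \<subseteq> ?A" for c
    using that by (intro prod.mono_neutral_left) (auto simp: in_keys_iff)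
  show "(\<Prod>x\<in>supp (d + e). vec_poly x ^ Poly_Mapping.lookup (d + e) x) =
      (\<Prod>x\<in>supp d. vec_poly x ^ Poly_Mapping.lookup d x) *
      (\<Prod>x\<in>supp e. vec_poly x ^ Poly_Mapping.lookup e x)"
    unfolding superset[OF keys_add] superset[OF Un_upper1] superset[OF Un_upper2]
    by (simp only: lookup_add power_add prod.distrib)
qed

lemma coeffs_1: "coeffs 1 = 1"
  by (simp add: coeffs_def lext_1)

lemma coeffs_var: "coeffs (var x) = vec_poly x"
  by (simp add: coeffs_def var_def)

lemma coeffs_prod: "finite A \<Longrightarrow> coeffs (prod F A) = (\<Prod>i\<in>A. coeffs (F i))"
  by (induction A rule: finite_induct) (simp_all add: coeffs_1 coeffs_mult)

lemma coeffs_power: "coeffs (f ^ k) = coeffs f ^ k"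
  by (induction k) (simp_all add: coeffs_1 coeffs_mult)

lemma vec_poly_basis: "m \<in> {1..n} \<Longrightarrow> vec_poly (v m) = pt (unit_exp m)"
  by (simp add: vec_poly_def coord_basis if_distrib[of "\<lambda>c. Poly_Mapping.single _ c"] cong: if_cong)

lemma pt_unit_exp_power: "pt (unit_exp m) ^ k = (pt (\<lambda>i. if i = m then k else 0) :: 'k npoly)"
proof (induction k)
  case 0
  have "(\<lambda>i. if i = m then 0 else 0) = (0 :: nat \<Rightarrow> nat)" by auto
  then show ?case by simp
next
  case (Suc k)
  have "unit_exp m + (\<lambda>i. if i = m then k else 0) = (\<lambda>i. if i = m then Suc k else 0)"
    by (auto simp: unit_exp_def)
  then show ?case by (simp add: Suc mult_single)
qed

lemma coeffs_vmono: "coeffs (vmono e) = pt (trunc e)"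
proof -
  have "coeffs (vmono e) = (\<Prod>m\<in>{1..n}. pt (\<lambda>i. if i = m then e m else 0))"
    by (simp add: vmono_def coeffs_prod coeffs_power coeffs_var vec_poly_basis pt_unit_exp_power
        cong: prod.cong_simp)
  also have "\<dots> = pt (\<Sum>m\<in>{1..n}. (\<lambda>i. if i = m then e m else 0))"
    by (rule pt_sum[symmetric]) simp
  also have "(\<Sum>m\<in>{1..n}. (\<lambda>i. if i = m then e m else 0)) = trunc e"
    by (rule ext) (auto simp: trunc_def sum_fun_apply)
  finally show ?thesis .
qed

lemma vec_poly_add: "vec_poly (x + y) = vec_poly x + vec_poly y"
  and vec_poly_scale: "vec_poly (scale c x) = fscale c (vec_poly x)"
  by (simp_all only: vec_poly_def coord_add coord_scale free.scale_left_distrib sum.distrib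
      free.scale_scale[symmetric] free.scale_sum_right)

text \<open>The coordinates are linear in the vector, so the relations of \<open>S(V)\<close> are sent to zero.
  This is the linear independence of the monomials.\<close>

lemma coeffs_cong:
  assumes "symc f = symc g"
  shows "coeffs f = coeffs g"
proof -
  have "coeffs (f - g) = 0"
  proof (rule flin_span_0[OF flin_coeffs])
    show "f - g \<in> free.span (sym_rels scale)"
      using assms by (simp add: rel_coset_eq_iff)
    show "coeffs r = 0" if "r \<in> sym_rels scale" for r
      using that unfolding sym_rels_def
      by (auto simp: coeffs_mult flin_diff[OF flin_coeffs] flin_scale[OF flin_coeffs] coeffs_var
          vec_poly_add vec_poly_scale)
  qed
  then show ?thesis
    by (simp add: flin_diff[OF flin_coeffs])
qed

lemma sym_cong_mult: "symc f = symc f' \<Longrightarrow> symc g = symc g' \<Longrightarrow> symc (f * g) = symc (f' * g')"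
  by (simp add: Sym_mult[symmetric])

text \<open>The monomials span: both sides are multiplicative in \<open>f\<close>, and on a variable the claim is
  the expansion of a vector in the basis.\<close>

lemma sym_lext_vmono_coeffs: "symc (lext vmono (coeffs f)) = symc f"
proof -
  let ?E = "\<lambda>f. lext vmono (coeffs f)"
  have flinE: "flin ?E"
    by (rule flin_comp[OF flin_lext flin_coeffs])
  have E_mult: "?E (f * g) = ?E f * ?E g" for f g
    by (simp add: coeffs_mult) (rule lext_mult, rule vmono_add)
  have E_1: "?E 1 = 1"
    using lext_pt[of vmono 0] by (simp add: coeffs_1 vmono_0)
  have E_var: "symc (?E (var x)) = symc (var x)" for x
  proof -
    have "?E (var x) = (\<Sum>m\<in>{1..n}. fscale (coord x m) (var (v m)))"
      by (simp add: coeffs_var vec_poly_def flin_sum[OF flin_lext] lext_single vmono_unit_exp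
          cong: sum.cong_simp)
    moreover have "symc (\<Sum>m\<in>A. fscale (coord x m) (var (v m))) =
        symc (var (\<Sum>m\<in>A. scale (coord x m) (v m)))" if "finite A" for A
      using that
    proof (induction A rule: finite_induct)
      case empty
      show ?case
        using Sym_var_scale[of scale 0 0] by simp
    next
      case (insert m A)
      have "symc (fscale (coord x m) (var (v m)) + (\<Sum>m\<in>A. fscale (coord x m) (var (v m)))) =
          symc (var (scale (coord x m) (v m)) + var (\<Sum>m\<in>A. scale (coord x m) (v m)))"
        by (rule rel_coset_add_cong[OF Sym_var_scale[symmetric] insert.IH])
      then show ?case
        using insert.hyps by (simp add: Sym_var_add)
    qed
    ultimately show ?thesis
      by (simp add: sum_coord)
  qed
  have E_power: "symc (?E (f ^ k)) = symc (f ^ k)" if "symc (?E f) = symc f" for f k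
    using that by (induction k) (simp_all add: E_1, simp only: E_mult, intro sym_cong_mult)
  have E_prod: "symc (?E (prod F A)) = symc (prod F A)"
    if "\<And>x. symc (?E (F x)) = symc (F x)" for F :: "'v \<Rightarrow> ('k, 'v) vpoly" and A
    using that by (induction A rule: infinite_finite_induct) (simp_all add: E_1, simp only: E_mult, intro sym_cong_mult)
  have E_pt: "symc (?E (pt e)) = symc (pt e)" for e :: "'v \<Rightarrow>\<^sub>0 nat"
  proof -
    have pow: "var x ^ k = (pt (Poly_Mapping.single x k) :: ('k, 'v) vpoly)" for x k
      by (induction k) (simp_all add: var_def mult_single single_add[symmetric] One_nat_def)
    have "(\<Prod>x\<in>supp e. var x ^ Poly_Mapping.lookup e x) =
        (pt (\<Sum>x\<in>supp e. Poly_Mapping.single x (Poly_Mapping.lookup e x)) ::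
          ('k, 'v) vpoly)"
      by (simp only: pow pt_sum finite_keys)
    also have "(\<Sum>x\<in>supp e. Poly_Mapping.single x (Poly_Mapping.lookup e x)) = e"
      by (rule poly_mapping_eqI) (auto simp: lookup_sum lookup_single when_def in_keys_iff)
    finally have "pt e = (\<Prod>x\<in>supp e. var x ^ Poly_Mapping.lookup e x :: ('k, 'v) vpoly)"
      by (rule HOL.sym)
    then show ?thesis
      by (simp add: E_prod E_power E_var)
  qed
  have "nf (sym_rels scale) (?E f) = nf (sym_rels scale) f"
    by (rule flin_eqI[OF flin_comp[OF flin_nf flinE] flin_nf]) (simp add: nf_eq_iff E_pt)
  then show ?thesis
    by (simp add: nf_eq_iff)
qed

definition sym_coeffs :: "('k, 'v) vpoly set \<Rightarrow> 'k npoly" where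
  "sym_coeffs a = coeffs (SOME f. f \<in> a)"

lemma sym_coeffs_sym [simp]: "sym_coeffs (symc f) = coeffs f"
  unfolding sym_coeffs_def
  by (rule coeffs_cong) (metis (no_types, lifting) mem_rel_coset_iff mem_rel_coset_self someI_ex)

lemma sym_coeffs_smon: "sym_coeffs (smon e) = pt (trunc e)"
  by (simp add: smon_eq coeffs_vmono)

end

section \<open>Tensor powers in coordinates\<close>

lemma flin_bilin_left: "flin F \<Longrightarrow> flin (\<lambda>x. bilin_ext h (F x) g)"
  by (rule flin_comp[OF flin_bilin_ext_left])

lemma flin_bilin_right: "flin F \<Longrightarrow> flin (\<lambda>x. bilin_ext h f (F x))"
  by (rule flin_comp[OF flin_bilin_ext_right])

lemma flin_lin_ext_comp: "flin F \<Longrightarrow> flin (\<lambda>x. lin_ext h (F x))"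
  by (rule flin_comp[OF flin_lin_ext])

lemma flin_lext_comp: "flin F \<Longrightarrow> flin (\<lambda>x. lext h (F x))"
  by (rule flin_comp[OF flin_lext])

lemma flin_nf_comp: "flin F \<Longrightarrow> flin (\<lambda>x. nf R (F x))"
  by (rule flin_comp[OF flin_nf])

lemma flin_times_left_comp:
  fixes F :: "_ \<Rightarrow> ('x::comm_monoid_add \<Rightarrow>\<^sub>0 'k::field)"
  shows "flin F \<Longrightarrow> flin (\<lambda>x. F x * g)"
  by (rule flin_comp[OF flin_times_left])

lemma flin_times_right_comp:
  fixes F :: "_ \<Rightarrow> ('x::comm_monoid_add \<Rightarrow>\<^sub>0 'k::field)"
  shows "flin F \<Longrightarrow> flin (\<lambda>x. f * F x)"
  by (rule flin_comp[OF flin_times_right])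

lemmas flin_intros = flin_id flin_bilin_left flin_bilin_right flin_lin_ext_comp flin_lext_comp
  flin_nf_comp flin_times_left_comp flin_times_right_comp flin_plus flin_uminus flin_minus2
  flin_fscale flin_sum_fun

primrec tens_poly :: "('e \<Rightarrow>\<^sub>0 'k::field) list \<Rightarrow> ('e list \<Rightarrow>\<^sub>0 'k)" where
  "tens_poly [] = pt []"
| "tens_poly (f # fs) = bilin_ext (#) f (tens_poly fs)"

lemma flin_tens_poly: "flin (\<lambda>f. tens_poly (as @ f # bs))"
  by (induction as) (simp_all add: flin_intros)

lemma tens_poly_pt: "tens_poly (map pt es) = pt es"
  by (induction es) simp_all

lemma keys_tens_poly: "supp (tens_poly fs) \<subseteq> words (length fs)"
  by (induction fs) (auto intro!: keys_bilin_ext)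

lemma tens_poly_snoc: "tens_poly (fs @ [f]) = bilin_ext (\<lambda>es e. es @ [e]) (tens_poly fs) f"
proof (induction fs)
  case Nil
  show ?case
    by (rule flin_eqI[where G = "\<lambda>f. tens_poly ([] @ [f])"]; simp; intro flin_intros)
next
  case (Cons g fs)
  have "bilin_ext (#) g (bilin_ext (\<lambda>es e. es @ [e]) t f) =
      bilin_ext (\<lambda>es e. es @ [e]) (bilin_ext (#) g t) f" (is "?G g t f = ?H g t f")
    for t :: "'a list \<Rightarrow>\<^sub>0 'b"
  proof -
    have on_pt: "?G (pt x) (pt y) f = ?H (pt x) (pt y) f" for x y
      by (rule flin_eqI[where G = "?G (pt x) (pt y)"]; (intro flin_intros | simp))
    show ?thesis
      by (rule bilin_eqI[where G = "\<lambda>g t. ?G g t f" and H = "\<lambda>g t. ?H g t f"]; (intro flin_intros | rule on_pt))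
  qed
  with Cons show ?case by simp
qed

definition face :: "('e \<Rightarrow> 'e \<Rightarrow> 'e) \<Rightarrow> nat \<Rightarrow> 'e list \<Rightarrow> 'e list" where
  "face mul j es = take j es @ [mul (es ! j) (es ! (j + 1))] @ drop (j + 2) es"

lemma face_Suc_Cons: "face mul (Suc j) (e # es) = e # face mul j es"
  by (simp add: face_def)

lemma face_0_Cons: "face mul 0 (e # d # es) = mul e d # es"
  by (simp add: face_def)

lemma length_face: "j + 1 < length es \<Longrightarrow> length (face mul j es) = length es - 1"
  by (simp add: face_def)

text \<open>Both sides are multilinear in the factors, and on monomials a product of factors is a
  sum of exponents. Multiplying the factors \<open>j\<close> and \<open>j + 1\<close> leaves the first \<open>j\<close> untouched, which
  allows induction on \<open>j\<close>.\<close>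

lemma tens_poly_face:
  fixes fs :: "('e::comm_monoid_add \<Rightarrow>\<^sub>0 'k::field) list"
  assumes "j + 1 < length fs"
  shows "lin_ext (face (+) j) (tens_poly fs) = tens_poly (face (*) j fs)"
  using assms
proof (induction j arbitrary: fs)
  case 0
  then obtain f g hs where fs: "fs = f # g # hs"
    by (cases fs; cases "tl fs") auto
  have "lin_ext (face (+) 0) (bilin_ext (#) f (bilin_ext (#) g t)) = bilin_ext (#) (f * g) t"
    (is "?G f g t = ?H f g t") for t :: "'e list \<Rightarrow>\<^sub>0 'k"
  proof -
    have on_pt: "?G (pt x) (pt y) t = ?H (pt x) (pt y) t" for x y
      by (rule flin_eqI[where G = "?G (pt x) (pt y)"]; (intro flin_intros | simp add: mult_single face_0_Cons))
    show ?thesis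
      by (rule bilin_eqI[where G = "\<lambda>f g. ?G f g t" and H = "\<lambda>f g. ?H f g t"]; (intro flin_intros | rule on_pt))
  qed
  then show ?case
    by (simp add: fs face_0_Cons)
next
  case (Suc j)
  then obtain f gs where fs: "fs = f # gs"
    by (cases fs) auto
  have "lin_ext (face (+) (Suc j)) (bilin_ext (#) f t) =
      bilin_ext (#) f (lin_ext (face (+) j) t)" for t :: "'e list \<Rightarrow>\<^sub>0 'k"
    by (rule bilin_eqI[where G = "\<lambda>f t. lin_ext (face (+) (Suc j)) (bilin_ext (#) f t)"];
        (intro flin_intros | simp add: face_Suc_Cons))
  then show ?case
    using Suc by (simp add: fs face_Suc_Cons)
qed

text \<open>The pattern of the action of \<open>S(V)\<^sup>e\<close> on the two outer factors. The first argument is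
  multiplication in \<open>S(V)\<close>, or addition of exponents in coordinates.\<close>

definition outer :: "('e \<Rightarrow> 'e \<Rightarrow> 'e) \<Rightarrow> 'e list \<Rightarrow> 'e list \<Rightarrow> 'e list" where
  "outer mul ab xs = [mul (hd ab) (hd xs)] @ butlast (tl xs) @ [mul (last xs) (last ab)]"

lemma outer_act_eq_outer: "outer_act M = outer (mult M)"
  by (intro ext) (simp add: outer_act_def outer_def)

lemma outer_Cons_snoc: "outer mul [a, b] (x # ms @ [y]) = mul a x # ms @ [mul y b]"
  by (simp add: outer_def)

lemma length_ge_2E:
  assumes "length xs \<ge> 2"
  obtains x ms y where "xs = x # ms @ [y]"
  using assms by (cases xs; cases "tl xs" rule: rev_cases) auto

text \<open>Both sides are linear in each of \<open>f\<close>, \<open>g\<close>, \<open>x\<close>, \<open>y\<close> and in the tensor of the middle factors,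
  so it suffices to compare them on monomials.\<close>

lemma tens_poly_outer:
  fixes f g x y :: "'e::comm_monoid_add \<Rightarrow>\<^sub>0 'k::field"
  shows "bilin_ext (outer (+)) (tens_poly [f, g]) (tens_poly (x # ms @ [y])) =
    tens_poly ((f * x) # ms @ [y * g])"
proof -
  let ?snoc = "\<lambda>es e. es @ [e]"
  let ?G = "\<lambda>f g x M y. bilin_ext (outer (+)) (bilin_ext (#) f (bilin_ext (#) g (pt [])))
    (bilin_ext (#) x (bilin_ext ?snoc M y)) :: 'e list \<Rightarrow>\<^sub>0 'k"
  let ?H = "\<lambda>f g x M y. bilin_ext (#) (f * x) (bilin_ext ?snoc M (y * g)) :: 'e list \<Rightarrow>\<^sub>0 'k"
  have 1: "?G (pt a) (pt b) (pt c) M (pt d) = ?H (pt a) (pt b) (pt c) M (pt d)" for a b c d M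
    by (rule flin_eqI[where G = "\<lambda>M. ?G (pt a) (pt b) (pt c) M (pt d)"]; (intro flin_intros | simp add: mult_single outer_Cons_snoc))
  have 2: "?G (pt a) (pt b) x M y = ?H (pt a) (pt b) x M y" for a b x M y
    by (rule bilin_eqI[where G = "\<lambda>x y. ?G (pt a) (pt b) x M y"]; (intro flin_intros | rule 1))
  have "?G f g x M y = ?H f g x M y" for M
    by (rule bilin_eqI[where G = "\<lambda>f g. ?G f g x M y"]; (intro flin_intros | rule 2))
  then show ?thesis
    by (simp add: tens_poly_snoc)
qed


lemma multilin_rels_cases:
  assumes "r \<in> multilin_rels M m"
  obtains (add) as x y bs where "length as + length bs + 1 = m"
      "set as \<subseteq> carrier M" "set bs \<subseteq> carrier M" "x \<in> carrier M" "y \<in> carrier M"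
      "r = pt (as @ (x \<oplus>\<^bsub>M\<^esub> y) # bs) - pt (as @ x # bs) - pt (as @ y # bs)"
  | (scale) as c x bs where "length as + length bs + 1 = m"
      "set as \<subseteq> carrier M" "set bs \<subseteq> carrier M" "x \<in> carrier M"
      "r = pt (as @ (c \<odot>\<^bsub>M\<^esub> x) # bs) - fscale c (pt (as @ x # bs))"
proof -
  have split: "length (take i xs) + length (drop (Suc i) xs) + 1 = m"
    "set (take i xs) \<subseteq> carrier M" "set (drop (Suc i) xs) \<subseteq> carrier M"
    "xs[i := z] = take i xs @ z # drop (Suc i) xs"
    if "xs \<in> carrier_lists M m" "i < m" for xs i z
    using that set_take_subset[of i xs] set_drop_subset[of "Suc i" xs]
    by (auto simp: carrier_lists_def upd_conv_take_nth_drop)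
  from assms show ?thesis
    unfolding multilin_rels_def
  proof (elim UnE CollectE exE conjE)
    fix xs i x y
    assume "r = pt (xs[i := x \<oplus>\<^bsub>M\<^esub> y]) - pt (xs[i := x]) - pt (xs[i := y])"
      "xs \<in> carrier_lists M m" "i < m" "x \<in> carrier M" "y \<in> carrier M"
    then show thesis
      using add[of "take i xs" "drop (Suc i) xs" x y] split[of xs i] by simp
  next
    fix xs i c x
    assume "r = pt (xs[i := c \<odot>\<^bsub>M\<^esub> x]) - fscale c (pt (xs[i := x]))"
      "xs \<in> carrier_lists M m" "i < m" "x \<in> carrier M"
    then show thesis
      using scale[of "take i xs" "drop (Suc i) xs" x c] split[of xs i] by simp
  qed
qed

text \<open>The universal property of tensor powers, for maps into a free space: a linear map
  kills the relations once it is multilinear in the factors.\<close>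

lemma flin_multilin_rels_0:
  assumes H: "flin H"
    and add: "\<And>as x y bs. length as + length bs + 1 = m \<Longrightarrow> set as \<subseteq> carrier M \<Longrightarrow>
      set bs \<subseteq> carrier M \<Longrightarrow> x \<in> carrier M \<Longrightarrow> y \<in> carrier M \<Longrightarrow>
      H (pt (as @ (x \<oplus>\<^bsub>M\<^esub> y) # bs)) = H (pt (as @ x # bs)) + H (pt (as @ y # bs))"
    and scale: "\<And>as c x bs. length as + length bs + 1 = m \<Longrightarrow> set as \<subseteq> carrier M \<Longrightarrow>
      set bs \<subseteq> carrier M \<Longrightarrow> x \<in> carrier M \<Longrightarrow>
      H (pt (as @ (c \<odot>\<^bsub>M\<^esub> x) # bs)) = fscale c (H (pt (as @ x # bs)))"
    and r: "r \<in> multilin_rels M m"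
  shows "H r = 0"
  using r
proof (cases rule: multilin_rels_cases)
  case (add as x y bs)
  with assms(2)[of as bs x y] show ?thesis
    by (simp add: flin_diff[OF H])
next
  case (scale as c x bs)
  with assms(3)[of as bs x c] show ?thesis
    by (simp add: flin_diff[OF H] flin_scale[OF H, symmetric])
qed

lemma
  assumes R: "multilin_rels M m \<subseteq> R" and "length as + length bs + 1 = m"
    and "set as \<subseteq> carrier M" "set bs \<subseteq> carrier M" "x \<in> carrier M"
  shows nf_multilin_add: "y \<in> carrier M \<Longrightarrow>
      nf R (pt (as @ (x \<oplus>\<^bsub>M\<^esub> y) # bs)) = nf R (pt (as @ x # bs)) + nf R (pt (as @ y # bs))"
    and nf_multilin_scale: "nf R (pt (as @ (c \<odot>\<^bsub>M\<^esub> x) # bs)) = fscale c (nf R (pt (as @ x # bs)))"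
proof -
  have xs: "as @ x # bs \<in> carrier_lists M m" and i: "length as < m"
    using assms by (auto simp: carrier_lists_def)
  have upd: "(as @ x # bs)[length as := z] = as @ z # bs" for z
    by simp
  have "pt ((as @ x # bs)[length as := c \<odot>\<^bsub>M\<^esub> x]) - fscale c (pt ((as @ x # bs)[length as := x]))
      \<in> multilin_rels M m"
    unfolding multilin_rels_def using xs i assms(5) by blast
  then have "nf R (pt (as @ (c \<odot>\<^bsub>M\<^esub> x) # bs) - fscale c (pt (as @ x # bs))) = 0"
    using R by (intro nf_rel) (auto simp: upd)
  then show "nf R (pt (as @ (c \<odot>\<^bsub>M\<^esub> x) # bs)) = fscale c (nf R (pt (as @ x # bs)))"
    by (simp only: flin_diff[OF flin_nf] flin_scale[OF flin_nf] right_minus_eq)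
  assume y: "y \<in> carrier M"
  have "pt ((as @ x # bs)[length as := x \<oplus>\<^bsub>M\<^esub> y]) - pt ((as @ x # bs)[length as := x]) -
      pt ((as @ x # bs)[length as := y]) \<in> multilin_rels M m"
    unfolding multilin_rels_def using xs i assms(5) y by blast
  then have "nf R (pt (as @ (x \<oplus>\<^bsub>M\<^esub> y) # bs) - pt (as @ x # bs) - pt (as @ y # bs)) = 0"
    using R by (intro nf_rel) (auto simp: upd)
  then show "nf R (pt (as @ (x \<oplus>\<^bsub>M\<^esub> y) # bs)) = nf R (pt (as @ x # bs)) + nf R (pt (as @ y # bs))"
    by (simp only: flin_diff[OF flin_nf]) (simp add: algebra_simps)
qed

context based_space
begin

abbreviation "T_rels \<equiv> multilin_rels S"

text \<open>The coordinates of a formal combination of tensors: expand every factor into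
  monomials.\<close>

definition tcoeffs :: "(('k, 'v) vpoly set list \<Rightarrow>\<^sub>0 'k) \<Rightarrow> ((nat \<Rightarrow> nat) list \<Rightarrow>\<^sub>0 'k)" where
  "tcoeffs = lext (\<lambda>as. tens_poly (map sym_coeffs as))"

text \<open>Conversely, a combination of lists of exponents as a combination of tensors of
  monomials.\<close>

definition tmon :: "((nat \<Rightarrow> nat) list \<Rightarrow>\<^sub>0 'k) \<Rightarrow> (('k, 'v) vpoly set list \<Rightarrow>\<^sub>0 'k)" where
  "tmon = lin_ext (map smon)"

definition trunc_list :: "((nat \<Rightarrow> nat) list \<Rightarrow>\<^sub>0 'k) \<Rightarrow> ((nat \<Rightarrow> nat) list \<Rightarrow>\<^sub>0 'k)" where
  "trunc_list = lin_ext (map trunc)"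

lemma flin_tcoeffs: "flin tcoeffs" and flin_tmon: "flin tmon" and flin_trunc_list: "flin trunc_list"
  by (simp_all add: tcoeffs_def tmon_def trunc_list_def flin_lext flin_lin_ext)

lemma smon_in_carrier [simp]: "smon e \<in> carrier S"
  by (simp add: smon_eq rel_coset_in_Sym)

lemma tcoeffs_tmon: "tcoeffs (tmon b) = trunc_list b"
proof (rule flin_eqI[OF flin_comp[OF flin_tcoeffs flin_tmon] flin_trunc_list])
  fix es
  have "map sym_coeffs (map smon es) = map pt (map trunc es)"
    by (simp add: sym_coeffs_smon)
  then show "tcoeffs (tmon (pt es)) = trunc_list (pt es)"
    by (simp only: tcoeffs_def tmon_def trunc_list_def lin_ext_pt lext_pt tens_poly_pt)
qed

lemma tmon_trunc_list: "tmon (trunc_list b) = tmon b"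
  by (rule flin_eqI[OF flin_comp[OF flin_tmon flin_trunc_list] flin_tmon])
    (simp add: tmon_def trunc_list_def smon_trunc comp_def)

lemma sym_coeffs_add: "a \<in> carrier S \<Longrightarrow> b \<in> carrier S \<Longrightarrow>
    sym_coeffs (a \<oplus>\<^bsub>S\<^esub> b) = sym_coeffs a + sym_coeffs b"
  and sym_coeffs_smult: "a \<in> carrier S \<Longrightarrow> sym_coeffs (c \<odot>\<^bsub>S\<^esub> a) = fscale c (sym_coeffs a)"
  and sym_coeffs_mult: "a \<in> carrier S \<Longrightarrow> b \<in> carrier S \<Longrightarrow>
    sym_coeffs (a \<otimes>\<^bsub>S\<^esub> b) = sym_coeffs a * sym_coeffs b"
  by (auto elim!: Sym_carrierE simp: presented_group.add_eq[OF presented_Sym] Sym_smult Sym_mult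
      flin_add[OF flin_coeffs] flin_scale[OF flin_coeffs] coeffs_mult)

lemma tcoeffs_cong:
  assumes "rel_coset (T_rels m) f = rel_coset (T_rels m) g"
  shows "tcoeffs f = tcoeffs g"
proof -
  have rels: "tcoeffs r = 0" if "r \<in> T_rels m" for r
    by (rule flin_multilin_rels_0[OF flin_tcoeffs _ _ that])
      (simp_all add: tcoeffs_def sym_coeffs_add sym_coeffs_smult flin_add[OF flin_tens_poly]
        flin_scale[OF flin_tens_poly])
  have "tcoeffs (f - g) = 0"
    using assms by (intro flin_span_0[OF flin_tcoeffs rels]) (simp_all add: rel_coset_eq_iff)
  then show ?thesis
    by (simp add: flin_diff[OF flin_tcoeffs])
qed

text \<open>The factors are expanded into monomials one after the other, from the left; the prefix
  \<open>es\<close> holds the exponents of the factors that are already expanded.\<close>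

lemma tens_expand_prefix:
  assumes "length es + length as = m" "set as \<subseteq> carrier S"
  shows "nf (T_rels m) (lin_ext (\<lambda>ds. map smon (es @ ds)) (tens_poly (map sym_coeffs as))) =
    nf (T_rels m) (pt (map smon es @ as))"
  using assms
proof (induction as arbitrary: es)
  case (Cons a as)
  let ?N = "nf (T_rels m)" and ?t = "tens_poly (map sym_coeffs as)"
  obtain f where a: "a = symc f"
    using Cons.prems by (auto elim: Sym_carrierE)
  let ?P = "\<lambda>g. ?N (pt (map smon es @ symc (lext vmono g) # as))"
  have P: "flin ?P"
  proof (rule flinI)
    fix g h c
    have "symc (lext vmono (g + h)) = symc (lext vmono g) \<oplus>\<^bsub>S\<^esub> symc (lext vmono h)"
      "symc (lext vmono (fscale c g)) = c \<odot>\<^bsub>S\<^esub> symc (lext vmono g)"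
      by (simp_all add: presented_group.add_eq[OF presented_Sym] Sym_smult flin_add[OF flin_lext]
          flin_scale[OF flin_lext])
    then show "?P (g + h) = ?P g + ?P h" "?P (fscale c g) = fscale c (?P g)"
      using Cons.prems
      by (auto intro!: nf_multilin_add[where m = m] nf_multilin_scale[where m = m]
          simp: rel_coset_in_Sym)
  qed
  have "?N (lin_ext (\<lambda>ds. map smon (es @ ds)) (bilin_ext (#) g ?t)) = ?P g" for g
  proof (rule flin_eqI[OF _ P])
    show "flin (\<lambda>g. ?N (lin_ext (\<lambda>ds. map smon (es @ ds)) (bilin_ext (#) g ?t)))"
      by (intro flin_intros)
    fix e
    have "lin_ext (\<lambda>ds. map smon (es @ ds)) (lin_ext ((#) e) t) =
        lin_ext (\<lambda>ds. map smon ((es @ [e]) @ ds)) t" for t :: "(nat \<Rightarrow> nat) list \<Rightarrow>\<^sub>0 'k"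
      by (rule flin_eqI[where G = "\<lambda>t. lin_ext _ (lin_ext ((#) e) t)"]; (intro flin_intros | simp))
    then have "?N (lin_ext (\<lambda>ds. map smon (es @ ds)) (bilin_ext (#) (pt e) ?t)) =
        ?N (lin_ext (\<lambda>ds. map smon ((es @ [e]) @ ds)) ?t)"
      by (simp only: bilin_ext_pt_left)
    also have "\<dots> = ?N (pt (map smon (es @ [e]) @ as))"
      using Cons.prems by (intro Cons.IH) simp_all
    also have "map smon (es @ [e]) @ as = map smon es @ symc (lext vmono (pt e)) # as"
      by (simp add: smon_eq)
    finally show "?N (lin_ext (\<lambda>ds. map smon (es @ ds)) (bilin_ext (#) (pt e) ?t)) = ?P (pt e)" .
  qed
  from this[of "coeffs f"] show ?case
    by (simp add: a sym_lext_vmono_coeffs)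
qed simp

lemma tmon_tcoeffs:
  assumes "supp f \<subseteq> carrier_lists S m"
  shows "rel_coset (T_rels m) (tmon (tcoeffs f)) = rel_coset (T_rels m) f"
proof -
  have "nf (T_rels m) (tmon (tcoeffs f)) = nf (T_rels m) f"
  proof (rule flin_eqI[OF _ flin_nf])
    show "flin (\<lambda>f. nf (T_rels m) (tmon (tcoeffs f)))"
      by (intro flin_nf_comp flin_comp[OF flin_tmon flin_tcoeffs])
    fix as assume "as \<in> supp f"
    then show "nf (T_rels m) (tmon (tcoeffs (pt as))) = nf (T_rels m) (pt as)"
      using tens_expand_prefix[of "[]" as m] assms
      by (auto simp: carrier_lists_def tmon_def tcoeffs_def)
  qed
  then show ?thesis
    by (simp add: nf_eq_iff)
qed

lemma keys_tcoeffs: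
  assumes "supp f \<subseteq> carrier_lists S m"
  shows "supp (tcoeffs f) \<subseteq> words m"
  unfolding tcoeffs_def
proof (rule keys_lext)
  fix as assume "as \<in> supp f"
  then show "supp (tens_poly (map sym_coeffs as)) \<subseteq> words m"
    using assms keys_tens_poly[of "map sym_coeffs as"] by (auto simp: carrier_lists_def)
qed

lemma keys_tmon:
  "supp b \<subseteq> words m \<Longrightarrow> supp (tmon b) \<subseteq> carrier_lists S m"
  unfolding tmon_def by (rule keys_lin_ext) (auto simp: carrier_lists_def)

text \<open>The element of the \<open>m\<close>-th tensor power of \<open>S(V)\<close> with given coordinates. All elements have
  this form, and two of them agree if and only if their coordinates agree after truncation
  of the exponents.\<close>

definition bar_elt :: "nat \<Rightarrow> ((nat \<Rightarrow> nat) list \<Rightarrow>\<^sub>0 'k) \<Rightarrow> (('k, 'v) vpoly set list \<Rightarrow>\<^sub>0 'k) set" where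
  "bar_elt m b = rel_coset (T_rels m) (tmon b)"

definition bar_coeffs :: "(('k, 'v) vpoly set list \<Rightarrow>\<^sub>0 'k) set \<Rightarrow> ((nat \<Rightarrow> nat) list \<Rightarrow>\<^sub>0 'k)" where
  "bar_coeffs A = tcoeffs (SOME f. f \<in> A)"

lemma bar_coeffs_rel_coset: "bar_coeffs (rel_coset (T_rels m) f) = tcoeffs f"
  unfolding bar_coeffs_def
  by (rule tcoeffs_cong[of m]) (metis (no_types, lifting) mem_rel_coset_iff mem_rel_coset_self someI_ex)

lemma bar_coeffs_bar_elt: "bar_coeffs (bar_elt m b) = trunc_list b"
  by (simp add: bar_elt_def bar_coeffs_rel_coset tcoeffs_tmon)

lemma bar_elt_trunc_list: "bar_elt m (trunc_list b) = bar_elt m b"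
  by (simp add: bar_elt_def tmon_trunc_list)

lemma tens_eq_bar_elt:
  assumes "as \<in> carrier_lists S m"
  shows "tens S as = bar_elt m (tens_poly (map sym_coeffs as))"
  using tmon_tcoeffs[of "pt as" m] assms
  by (simp add: tens_def bar_elt_def tcoeffs_def carrier_lists_def)

lemma tens_smon: "length es = m \<Longrightarrow> tens S (map smon es) = bar_elt m (pt es)"
  by (simp add: tens_def bar_elt_def tmon_def)

lemma carrier_tensor_powerE:
  assumes "A \<in> carrier (tensor_power S m)"
  obtains b where "A = bar_elt m b" "supp b \<subseteq> words m"
  using assms that[OF _ keys_tcoeffs] tmon_tcoeffs
  by (auto simp: tensor_power_def pres_space_carrier bar_elt_def)

end

section \<open>The enveloping algebra and the bar resolution in coordinates\<close>

type_synonym 'k epoly = "((nat \<Rightarrow> nat) \<times> (nat \<Rightarrow> nat)) \<Rightarrow>\<^sub>0 'k"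

definition bar_act :: "'k::field epoly \<Rightarrow> ((nat \<Rightarrow> nat) list \<Rightarrow>\<^sub>0 'k) \<Rightarrow> ((nat \<Rightarrow> nat) list \<Rightarrow>\<^sub>0 'k)" where
  "bar_act = bilin_ext (\<lambda>(q, r). outer (+) [q, r])"

lemma flin_bar_act_left: "flin F \<Longrightarrow> flin (\<lambda>x. bar_act (F x) b)"
  and flin_bar_act_right: "flin G \<Longrightarrow> flin (\<lambda>x. bar_act P (G x))"
  by (simp_all add: bar_act_def flin_bilin_left flin_bilin_right)

lemma bar_act_pt: "bar_act (pt (q, r)) (pt es) = pt (outer (+) [q, r] es)"
  by (simp add: bar_act_def)

lemma keys_length_ge_2E:
  assumes "es \<in> supp b" "m \<ge> 2" "supp b \<subseteq> words m"
  obtains x ms y where "es = x # ms @ [y]"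
  using assms by - (rule length_ge_2E[of es]; auto)

lemma carrier_lists_ge_2E:
  assumes "xs \<in> carrier_lists M m" "m \<ge> 2"
  obtains x ms y where "xs = x # ms @ [y]"
  using assms by - (rule length_ge_2E[of xs]; auto simp: carrier_lists_def)

lemma carrier_lists_2E:
  assumes "ab \<in> carrier_lists M 2"
  obtains a b where "ab = [a, b]"
  using assms that by (auto simp: carrier_lists_def length_Suc_conv numeral_2_eq_2)

lemma length_outer: "length es \<ge> 2 \<Longrightarrow> length (outer mul ab es) = length es"
  by (erule length_ge_2E) (simp add: outer_def)

lemma keys_bar_act:
  assumes "m \<ge> 2" "supp b \<subseteq> words m"
  shows "supp (bar_act P b) \<subseteq> words m"
  unfolding bar_act_def using assms by (intro keys_bilin_ext) (auto simp: length_outer)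

lemma single_0_power: "Poly_Mapping.single 0 c ^ k = Poly_Mapping.single 0 (c ^ k)"
  for c :: "'k::field"
  by (induction k) (simp_all add: mult_single)

lemma minus_one_power: "(- 1 :: 'x::comm_monoid_add \<Rightarrow>\<^sub>0 'k::field) ^ k = Poly_Mapping.single 0 ((- 1) ^ k)"
  by (simp add: single_uminus flip: single_0_power)

lemma bar_act_const:
  assumes "m \<ge> 2" "supp b \<subseteq> words m"
  shows "bar_act (Poly_Mapping.single 0 c) b = fscale c b"
proof (rule flin_eqI[where G = "bar_act (Poly_Mapping.single 0 c)"])
  show "flin (bar_act (Poly_Mapping.single 0 c))" "flin (fscale c :: _ \<Rightarrow> (nat \<Rightarrow> nat) list \<Rightarrow>\<^sub>0 'a)"
    by (rule flin_bar_act_right[OF flin_id] flin_fscale[OF flin_id])+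
  fix es assume "es \<in> supp b"
  then obtain x ms y where es: "es = x # ms @ [y]"
    using assms by (rule keys_length_ge_2E)
  have "bar_act (fscale c (pt (0, 0))) (pt es) = fscale c (bar_act (pt (0, 0)) (pt es))"
    by (rule flin_scale[OF flin_bar_act_left[OF flin_id]])
  then show "bar_act (Poly_Mapping.single 0 c) (pt es) = fscale c (pt es)"
    by (simp add: bar_act_pt zero_prod_def es outer_Cons_snoc)
qed

lemma lin_maps_eqI:
  assumes "f \<in> lin_maps E M N" "g \<in> lin_maps E M N" "\<And>x. x \<in> carrier M \<Longrightarrow> f x = g x"
  shows "f = g"
proof (rule PiE_ext)
  show "f \<in> carrier M \<rightarrow>\<^sub>E carrier N" "g \<in> carrier M \<rightarrow>\<^sub>E carrier N"
    using assms(1,2) by (simp_all add: lin_maps_def)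
qed (rule assms(3))

definition bar_diff :: "nat \<Rightarrow> ((nat \<Rightarrow> nat) list \<Rightarrow>\<^sub>0 'k::field) \<Rightarrow> ((nat \<Rightarrow> nat) list \<Rightarrow>\<^sub>0 'k)" where
  "bar_diff p b = (\<Sum>j\<in>{0..p}. fscale ((- 1) ^ j) (lin_ext (face (+) j) b))"

lemma flin_bar_diff: "flin (bar_diff p)"
  unfolding bar_diff_def by (intro flin_intros)

lemma keys_bar_diff:
  assumes "supp b \<subseteq> words (p + 2)"
  shows "supp (bar_diff p b) \<subseteq> words (p + 1)"
  unfolding bar_diff_def using assms
  by (intro keys_sum_subset order_trans[OF keys_fscale] keys_lin_ext) (auto simp: length_face)

text \<open>The outer action involves the two ends only. As there are at least three factors, a
  product of neighbours meets at most one of them, where the claim is associativity.\<close>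

lemma face_outer:
  fixes es :: "'e::ab_semigroup_add list"
  assumes "j \<le> Suc q" "length es = q + 3"
  shows "face (+) j (outer (+) [a, b] es) = outer (+) [a, b] (face (+) j es)"
proof -
  have "length es \<ge> 2" using assms by simp
  then obtain x ms y where es: "es = x # ms @ [y]"
    by (rule length_ge_2E)
  then have ms: "length ms = q + 1" using assms by simp
  consider "j = 0" | i where "j = Suc i" "i < q" | "j = Suc q"
    using assms by (cases j) force+
  then show ?thesis
  proof cases
    case 1
    then show ?thesis
      using ms by (cases ms) (simp_all add: es outer_def face_0_Cons add_ac)
  next
    case 2
    have "face (+) i (ms @ [z]) = face (+) i ms @ [z]" for z
      using 2 ms by (simp add: face_def nth_append)
    then show ?thesis
      by (simp add: 2 es outer_Cons_snoc face_Suc_Cons)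
  next
    case 3
    have "face (+) q (ms @ [z]) = take q ms @ [ms ! q + z]" for z
      using ms by (simp add: face_def nth_append)
    then show ?thesis
      by (simp add: 3 es outer_Cons_snoc face_Suc_Cons add_ac)
  qed
qed

context based_space
begin

lemma smon_add: "smon (d + e) = smon d \<otimes>\<^bsub>S\<^esub> smon e"
  by (simp add: smon_eq vmono_add Sym_mult)

lemma smon_0: "smon 0 = \<one>\<^bsub>S\<^esub>"
  by (simp add: smon_eq vmono_0 Sym_one)

lemma span_T_rels_supported:
  assumes "f \<in> free.span (T_rels m)"
  shows "supp f \<subseteq> carrier_lists S m"
proof -
  let ?W = "{f :: ('k, 'v) vpoly set list \<Rightarrow>\<^sub>0 'k. supp f \<subseteq> carrier_lists S m}"
  interpret presented_group S UNIV "sym_rels scale"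
    by (rule presented_Sym)
  have smult: "c \<odot>\<^bsub>S\<^esub> x \<in> carrier S" if "x \<in> carrier S" for c x
    using that by (auto elim!: Sym_carrierE simp: Sym_smult rel_coset_in_Sym)
  have pt: "pt xs \<in> ?W" if "xs \<in> carrier_lists S m" for xs
    using that by simp
  have "T_rels m \<subseteq> ?W"
  proof
    fix r assume "r \<in> T_rels m"
    then show "r \<in> ?W"
    proof (cases rule: multilin_rels_cases)
      case (add as x y bs)
      show ?thesis
        unfolding add(6)
        by (intro free.subspace_diff[OF subspace_supported] pt)
          (use add in \<open>auto simp: carrier_lists_def\<close>)
    next
      case (scale as c x bs)
      show ?thesis
        unfolding scale(5)
        by (intro free.subspace_diff[OF subspace_supported] free.subspace_scale[OF subspace_supported] pt)
          (use scale smult in \<open>auto simp: carrier_lists_def\<close>)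
    qed
  qed
  from free.span_minimal[OF this subspace_supported] assms show ?thesis
    by blast
qed

lemma T_rels_coset_supported:
  assumes "rel_coset (T_rels m) f' = rel_coset (T_rels m) f"
    and "supp f \<subseteq> carrier_lists S m"
  shows "supp f' \<subseteq> carrier_lists S m"
proof -
  have "supp (f' - f) \<subseteq> carrier_lists S m"
    using assms(1) by (intro span_T_rels_supported) (simp add: rel_coset_eq_iff)
  then show ?thesis
    using keys_add[of "f' - f" f] assms(2) by auto
qed

text \<open>Coordinates detect equality, so an operation on a tensor power is well defined once it
  can be computed in coordinates.\<close>

lemma T_rels_coset_eqI:
  assumes "supp f \<subseteq> carrier_lists S m" "supp g \<subseteq> carrier_lists S m"
    and "tcoeffs f = tcoeffs g"
  shows "rel_coset (T_rels m) f = rel_coset (T_rels m) g"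
  using tmon_tcoeffs[OF assms(1)] tmon_tcoeffs[OF assms(2)] assms(3) by simp

lemma outer_act_carrier_lists:
  assumes "m \<ge> 2" "ab \<in> carrier_lists S 2" "xs \<in> carrier_lists S m"
  shows "outer_act S ab xs \<in> carrier_lists S m"
proof -
  interpret S: comm_monoid S by (rule comm_monoid_Sym)
  obtain a b where ab: "ab = [a, b]"
    using assms(2) by (rule carrier_lists_2E)
  obtain x ms y where xs: "xs = x # ms @ [y]"
    using assms(3,1) by (rule carrier_lists_ge_2E)
  show ?thesis
    using assms by (auto simp: outer_act_eq_outer ab xs outer_Cons_snoc carrier_lists_def)
qed

lemma tcoeffs_outer_act:
  assumes "m \<ge> 2" and f: "supp f \<subseteq> carrier_lists S 2"
    and g: "supp g \<subseteq> carrier_lists S m"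
  shows "tcoeffs (bilin_ext (outer_act S) f g) = bilin_ext (outer (+)) (tcoeffs f) (tcoeffs g)"
proof (rule bilin_eqI[where G = "\<lambda>f g. tcoeffs (bilin_ext (outer_act S) f g)"])
  show "flin (\<lambda>f. tcoeffs (bilin_ext (outer_act S) f g))"
    "flin (\<lambda>f. bilin_ext (outer (+)) (tcoeffs f) (tcoeffs g))"
    "flin (\<lambda>g. tcoeffs (bilin_ext (outer_act S) (pt x) g))"
    "flin (\<lambda>g. bilin_ext (outer (+)) (tcoeffs (pt x)) (tcoeffs g))" for x
    unfolding tcoeffs_def by (intro flin_intros)+
  fix ab xs assume "ab \<in> supp f" "xs \<in> supp g"
  then have ab: "ab \<in> carrier_lists S 2" and xs: "xs \<in> carrier_lists S m"
    using f g by auto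
  then obtain a b x ms y where *: "ab = [a, b]" "xs = x # ms @ [y]"
    using \<open>m \<ge> 2\<close> by (elim carrier_lists_2E carrier_lists_ge_2E)
  then have "a \<in> carrier S" "b \<in> carrier S" "x \<in> carrier S" "y \<in> carrier S"
    using ab xs by (auto simp: carrier_lists_def)
  then show "tcoeffs (bilin_ext (outer_act S) (pt ab) (pt xs)) =
      bilin_ext (outer (+)) (tcoeffs (pt ab)) (tcoeffs (pt xs))"
    using tens_poly_outer[of "sym_coeffs a" "sym_coeffs b" "sym_coeffs x" "map sym_coeffs ms" "sym_coeffs y"]
    by (simp add: * outer_act_eq_outer outer_Cons_snoc tcoeffs_def sym_coeffs_mult)
qed

text \<open>The action is a union over representatives. Its coordinates are determined by the
  coordinates of the two representatives, hence by their cosets.\<close>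

lemma env_act_rel_coset:
  assumes m: "m \<ge> 2" and f: "supp f \<subseteq> carrier_lists S 2"
    and g: "supp g \<subseteq> carrier_lists S m"
  shows "env_act scale m (rel_coset (T_rels 2) f) (rel_coset (T_rels m) g) =
    rel_coset (T_rels m) (bilin_ext (outer_act S) f g)"
proof -
  let ?act = "bilin_ext (outer_act S)"
  have supp: "supp (?act f' g') \<subseteq> carrier_lists S m"
    if "supp f' \<subseteq> carrier_lists S 2" "supp g' \<subseteq> carrier_lists S m" for f' g'
    using that by (intro keys_bilin_ext outer_act_carrier_lists m) auto
  have "rel_coset (T_rels m) (?act f' g') = rel_coset (T_rels m) (?act f g)"
    if "f' \<in> rel_coset (T_rels 2) f" "g' \<in> rel_coset (T_rels m) g" for f' g'
  proof -
    have f': "rel_coset (T_rels 2) f' = rel_coset (T_rels 2) f"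
      and g': "rel_coset (T_rels m) g' = rel_coset (T_rels m) g"
      using that by (simp_all add: mem_rel_coset_iff)
    note supp' = T_rels_coset_supported[OF f' f] T_rels_coset_supported[OF g' g]
    show ?thesis
    proof (rule T_rels_coset_eqI[OF supp[OF supp'] supp[OF f g]])
      show "tcoeffs (?act f' g') = tcoeffs (?act f g)"
        unfolding tcoeffs_outer_act[OF m supp'] tcoeffs_outer_act[OF m f g]
          tcoeffs_cong[OF f'] tcoeffs_cong[OF g'] ..
    qed
  qed
  then have "(\<Union>f'\<in>rel_coset (T_rels 2) f. \<Union>g'\<in>rel_coset (T_rels m) g.
        rel_coset (T_rels m) (?act f' g')) =
      (\<Union>f'\<in>rel_coset (T_rels 2) f. \<Union>g'\<in>rel_coset (T_rels m) g.
        rel_coset (T_rels m) (?act f g))"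
    by (intro SUP_cong refl)
  also have "\<dots> = rel_coset (T_rels m) (?act f g)"
    using mem_rel_coset_self by blast
  finally show ?thesis
    by (simp add: env_act_def)
qed

text \<open>The evaluation of a polynomial in \<open>x\<close> and \<open>y\<close> at \<open>x\<^sub>m = v\<^sub>m \<otimes> 1\<close> and \<open>y\<^sub>m = 1 \<otimes> v\<^sub>m\<close>.
  It is a surjective ring homomorphism onto \<open>S(V)\<^sup>e\<close> and serves to compute there.\<close>

definition env_elt :: "'k epoly \<Rightarrow> (('k, 'v) vpoly set list \<Rightarrow>\<^sub>0 'k) set" where
  "env_elt P = bar_elt 2 (lin_ext (\<lambda>(q, r). [q, r]) P)"

lemma keys_pairs: "supp (lin_ext (\<lambda>(q, r). [q, r]) P) \<subseteq> words 2"
  by (rule keys_lin_ext) auto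

lemma env_act_elt:
  assumes "m \<ge> 2" and b: "supp b \<subseteq> words m"
  shows "env_act scale m (env_elt P) (bar_elt m b) = bar_elt m (bar_act P b)"
proof -
  let ?pairs = "lin_ext (\<lambda>(q, r). [q, r]) :: 'k epoly \<Rightarrow> _"
  have "bilin_ext (outer_act S) (tmon (?pairs P)) (tmon b) = tmon (bar_act P b)"
  proof (rule bilin_eqI[where G = "\<lambda>P b. bilin_ext (outer_act S) (tmon (?pairs P)) (tmon b)"])
    show "flin (\<lambda>P. bilin_ext (outer_act S) (tmon (?pairs P)) (tmon b))"
      "flin (\<lambda>P. tmon (bar_act P b))"
      "flin (\<lambda>b. bilin_ext (outer_act S) (tmon (?pairs (pt x))) (tmon b))"
      "flin (\<lambda>b. tmon (bar_act (pt x) b))" for x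
      unfolding tmon_def by (intro flin_intros flin_bar_act_left flin_bar_act_right)+
    fix x es assume "es \<in> supp b"
    then obtain d ms e where es: "es = d # ms @ [e]"
      using assms by (rule keys_length_ge_2E)
    then show "bilin_ext (outer_act S) (tmon (?pairs (pt x))) (tmon (pt es)) =
        tmon (bar_act (pt x) (pt es))"
      by (cases x) (simp add: tmon_def bar_act_pt outer_act_eq_outer outer_Cons_snoc smon_add)
  qed
  then show ?thesis
    unfolding env_elt_def bar_elt_def
    by (subst env_act_rel_coset) (simp_all add: assms keys_tmon keys_pairs)
qed

lemma presented_Bar: "presented_group (Bar scale p) (carrier_lists S (p + 2)) (T_rels (p + 2))"
  using presented_group_pres_space[of "carrier_lists S (p + 2)" "T_rels (p + 2)"]
  by (simp add: presented_group_def Bar_def tensor_power_def Let_def)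

lemma presented_Env: "presented_group (Env scale) (carrier_lists S 2) (T_rels 2)"
  using presented_group_pres_space[of "carrier_lists S 2" "T_rels 2"]
  by (simp add: presented_group_def Env_def tensor_power_def Let_def)

lemma Env_smult: "c \<odot>\<^bsub>Env scale\<^esub> rel_coset (T_rels 2) f = rel_coset (T_rels 2) (fscale c f)"
  using pres_space_smult[where X = "carrier_lists S 2" and R = "T_rels 2"]
  by (simp add: Env_def tensor_power_def)

lemma bar_elt_in_Bar:
  "supp b \<subseteq> words (p + 2) \<Longrightarrow> bar_elt (p + 2) b \<in> carrier (Bar scale p)"
  unfolding bar_elt_def by (intro presented_group.in_carrier[OF presented_Bar] keys_tmon)

lemma Bar_carrierE:
  assumes "A \<in> carrier (Bar scale p)"
  obtains b where "A = bar_elt (p + 2) b" "supp b \<subseteq> words (p + 2)"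
  using assms by (auto simp: Bar_def Let_def elim: carrier_tensor_powerE)

lemma Bar_add: "bar_elt (p + 2) b \<oplus>\<^bsub>Bar scale p\<^esub> bar_elt (p + 2) c = bar_elt (p + 2) (b + c)"
  by (simp only: bar_elt_def presented_group.add_eq[OF presented_Bar] flin_add[OF flin_tmon])

lemma Bar_smult:
  assumes "supp b \<subseteq> words (p + 2)"
  shows "env_elt P \<odot>\<^bsub>Bar scale p\<^esub> bar_elt (p + 2) b = bar_elt (p + 2) (bar_act P b)"
  using env_act_elt[of "p + 2" b P] assms by (simp add: Bar_def Let_def)

lemma Bar_finsum:
  assumes "finite A" "\<And>i. i \<in> A \<Longrightarrow> supp (F i) \<subseteq> words (p + 2)"
  shows "(\<Oplus>\<^bsub>Bar scale p\<^esub>i\<in>A. bar_elt (p + 2) (F i)) = bar_elt (p + 2) (\<Sum>i\<in>A. F i)"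
  unfolding bar_elt_def flin_sum[OF flin_tmon]
  by (rule presented_group.finsum_eq[OF presented_Bar]) (use assms keys_tmon in auto)

lemma env_elt_in_Env: "env_elt P \<in> carrier (Env scale)"
  unfolding env_elt_def bar_elt_def
  by (intro presented_group.in_carrier[OF presented_Env] keys_tmon keys_pairs)

lemma Env_carrierE:
  assumes "u \<in> carrier (Env scale)"
  obtains P where "u = env_elt P"
proof -
  have "u \<in> carrier (tensor_power S 2)"
    using assms by (simp add: Env_def)
  then obtain b where b: "u = bar_elt 2 b" "supp b \<subseteq> words 2"
    by (rule carrier_tensor_powerE)
  have "lin_ext (\<lambda>(q, r). [q, r]) (lin_ext (\<lambda>es. (hd es, last es)) b) = b"
  proof (rule flin_eqI[OF _ flin_id])
    fix es assume "es \<in> supp b"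
    then have "length es = 2" using b by auto
    then show "lin_ext (\<lambda>(q, r). [q, r]) (lin_ext (\<lambda>es. (hd es, last es)) (pt es)) = pt es"
      by (auto simp: length_Suc_conv numeral_2_eq_2)
  qed (intro flin_intros)
  then have "u = env_elt (lin_ext (\<lambda>es. (hd es, last es)) b)"
    by (simp add: env_elt_def b)
  then show ?thesis by (rule that)
qed

lemma env_elt_add: "env_elt P \<oplus>\<^bsub>Env scale\<^esub> env_elt P' = env_elt (P + P')"
  by (simp only: env_elt_def bar_elt_def presented_group.add_eq[OF presented_Env]
      flin_add[OF flin_tmon] flin_add[OF flin_lin_ext])

lemma env_elt_smult: "c \<odot>\<^bsub>Env scale\<^esub> env_elt P = env_elt (fscale c P)"
  by (simp only: env_elt_def bar_elt_def Env_smult flin_scale[OF flin_tmon] flin_scale[OF flin_lin_ext])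

lemma env_elt_minus: "env_elt P \<ominus>\<^bsub>Env scale\<^esub> env_elt P' = env_elt (P - P')"
  unfolding env_elt_def bar_elt_def
  by (simp only: presented_group.a_minus_eq[OF presented_Env keys_tmon[OF keys_pairs] keys_tmon[OF keys_pairs]]
      flin_diff[OF flin_tmon] flin_diff[OF flin_lin_ext])

lemma env_elt_uminus: "\<ominus>\<^bsub>Env scale\<^esub> env_elt P = env_elt (- P)"
  unfolding env_elt_def bar_elt_def
  by (simp only: presented_group.a_inv_eq[OF presented_Env keys_tmon[OF keys_pairs]]
      flin_minus[OF flin_tmon] flin_minus[OF flin_lin_ext])

lemma env_elt_pt: "env_elt (pt (q, r)) = tens S [smon q, smon r]"
  using tens_smon[of "[q, r]" 2] by (simp add: env_elt_def)

lemma env_elt_1: "env_elt 1 = \<one>\<^bsub>Env scale\<^esub>"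
  using env_elt_pt[of 0 0] by (simp add: Env_def smon_0 flip: zero_prod_def)

lemma env_elt_mult: "env_elt P \<otimes>\<^bsub>Env scale\<^esub> env_elt P' = env_elt (P * P')"
proof -
  let ?pairs = "lin_ext (\<lambda>(q, r). [q, r]) :: 'k epoly \<Rightarrow> _"
  have "bar_act P (?pairs P') = ?pairs (P * P')"
  proof (rule bilin_eqI[where G = "\<lambda>P P'. bar_act P (?pairs P')"])
    show "flin (\<lambda>P. bar_act P (?pairs P'))" "flin (\<lambda>P. ?pairs (P * P'))"
      "flin (\<lambda>P'. bar_act (pt x) (?pairs P'))" "flin (\<lambda>P'. ?pairs (pt x * P'))" for x
      by (intro flin_intros flin_bar_act_left flin_bar_act_right)+
  qed (auto simp: bar_act_pt mult_single outer_def add_ac split: prod.split)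
  moreover have "env_elt P \<otimes>\<^bsub>Env scale\<^esub> env_elt P' = env_act scale 2 (env_elt P) (bar_elt 2 (?pairs P'))"
    by (simp add: Env_def env_elt_def)
  ultimately show ?thesis
    by (simp add: env_act_elt keys_pairs) (simp add: env_elt_def)
qed

text \<open>The signs in the prescribed differentials are powers of \<open>- 1\<close> in the enveloping algebra.\<close>

lemma Env_minus_one_power: "(\<ominus>\<^bsub>Env scale\<^esub> \<one>\<^bsub>Env scale\<^esub>) [^]\<^bsub>Env scale\<^esub> (k::nat) = env_elt ((- 1) ^ k)"
proof -
  have "(\<ominus>\<^bsub>Env scale\<^esub> \<one>\<^bsub>Env scale\<^esub>) [^]\<^bsub>Env scale\<^esub> k =
      rec_nat (env_elt 1) (\<lambda>u b. b \<otimes>\<^bsub>Env scale\<^esub> env_elt (- 1)) k"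
    by (simp add: nat_pow_def env_elt_uminus flip: env_elt_1)
  also have "\<dots> = env_elt ((- 1) ^ k)"
    by (induction k) (simp_all add: env_elt_mult)
  finally show ?thesis .
qed

text \<open>An element of the bar module determines its coordinates up to truncation of exponents,
  so a map on coordinates descends once truncation does not change its values.\<close>

lemma bar_map_exists:
  assumes closed: "\<And>b. supp b \<subseteq> words (p + 2) \<Longrightarrow> F b \<in> carrier N"
    and trunc_list: "\<And>b. supp b \<subseteq> words (p + 2) \<Longrightarrow> F (trunc_list b) = F b"
    and add: "\<And>b c. supp b \<subseteq> words (p + 2) \<Longrightarrow>
      supp c \<subseteq> words (p + 2) \<Longrightarrow> F (b + c) = F b \<oplus>\<^bsub>N\<^esub> F c"
    and act: "\<And>P b. supp b \<subseteq> words (p + 2) \<Longrightarrow>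
      F (bar_act P b) = env_elt P \<odot>\<^bsub>N\<^esub> F b"
  obtains f where "f \<in> lin_maps (Env scale) (Bar scale p) N"
    and "\<And>b. supp b \<subseteq> words (p + 2) \<Longrightarrow> f (bar_elt (p + 2) b) = F b"
proof
  let ?f = "\<lambda>A\<in>carrier (Bar scale p). F (bar_coeffs A)"
  show f: "?f (bar_elt (p + 2) b) = F b" if "supp b \<subseteq> words (p + 2)" for b
    using that bar_elt_in_Bar[OF that] by (simp add: bar_coeffs_bar_elt trunc_list)
  have plus: "supp (b + c) \<subseteq> words (p + 2)"
    if "supp b \<subseteq> words (p + 2)" "supp c \<subseteq> words (p + 2)"
    for b c :: "(nat \<Rightarrow> nat) list \<Rightarrow>\<^sub>0 'k"
    using that keys_add[of b c] by blast
  have in_N: "?f A \<in> carrier N" if "A \<in> carrier (Bar scale p)" for A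
    using that by (elim Bar_carrierE) (simp only: f closed)
  have additive: "?f (A \<oplus>\<^bsub>Bar scale p\<^esub> B) = ?f A \<oplus>\<^bsub>N\<^esub> ?f B"
    if "A \<in> carrier (Bar scale p)" "B \<in> carrier (Bar scale p)" for A B
    using that by (elim Bar_carrierE) (simp only: Bar_add f plus add)
  have homog: "?f (u \<odot>\<^bsub>Bar scale p\<^esub> A) = u \<odot>\<^bsub>N\<^esub> ?f A"
    if "u \<in> carrier (Env scale)" "A \<in> carrier (Bar scale p)" for u A
    using that by (elim Bar_carrierE Env_carrierE) (simp only: Bar_smult f act keys_bar_act[OF le_add2])
  show "?f \<in> lin_maps (Env scale) (Bar scale p) N"
    unfolding lin_maps_def
    by (intro CollectI conjI ballI PiE_I; (rule in_N additive homog; assumption | simp))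
qed

lemma tens_generator:
  "length es = p \<Longrightarrow> tens S ([\<one>\<^bsub>S\<^esub>] @ map smon es @ [\<one>\<^bsub>S\<^esub>]) = bar_elt (p + 2) (pt (0 # es @ [0]))"
  using tens_smon[of "0 # es @ [0]" "p + 2"] by (simp add: smon_0)

text \<open>An arbitrary tensor of monomials is the result of letting its outer factors act on a
  tensor with outer factors \<open>1\<close>. Hence the latter generate the bar module over the enveloping
  algebra.\<close>

lemma bar_map_eqI:
  assumes f: "f \<in> lin_maps (Env scale) (Bar scale p) N"
    and g: "g \<in> lin_maps (Env scale) (Bar scale p) N"
    and eq: "\<And>es. length es = p \<Longrightarrow>
      f (tens S ([\<one>\<^bsub>S\<^esub>] @ map smon es @ [\<one>\<^bsub>S\<^esub>])) = g (tens S ([\<one>\<^bsub>S\<^esub>] @ map smon es @ [\<one>\<^bsub>S\<^esub>]))"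
  shows "f = g"
proof -
  let ?L = "words (p + 2) :: (nat \<Rightarrow> nat) list set"
  have eq_act: "f (bar_elt (p + 2) (bar_act P (pt (0 # es @ [0])))) =
      g (bar_elt (p + 2) (bar_act P (pt (0 # es @ [0]))))" if "length es = p" for P es
  proof -
    have keys: "supp (pt (0 # es @ [0]) :: _ \<Rightarrow>\<^sub>0 'k) \<subseteq> ?L"
      using that by simp
    have push: "h (bar_elt (p + 2) (bar_act P (pt (0 # es @ [0])))) =
        env_elt P \<odot>\<^bsub>N\<^esub> h (tens S ([\<one>\<^bsub>S\<^esub>] @ map smon es @ [\<one>\<^bsub>S\<^esub>]))"
      if "h \<in> lin_maps (Env scale) (Bar scale p) N" for h
      using that bar_elt_in_Bar[OF keys] env_elt_in_Env[of P]
      unfolding Bar_smult[OF keys, symmetric] tens_generator[OF \<open>length es = p\<close>]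
      by (simp add: lin_maps_def)
    show ?thesis
      unfolding push[OF f] push[OF g] eq[OF that] ..
  qed
  have eq_sum: "f (bar_elt (p + 2) (\<Sum>es\<in>K. fscale (c es) (pt es))) =
      g (bar_elt (p + 2) (\<Sum>es\<in>K. fscale (c es) (pt es)))" if "finite K" "K \<subseteq> ?L" for K c
    using that
  proof (induction K rule: finite_induct)
    case empty
    \<comment> \<open>Zero is the multiple of an arbitrary generator by the zero of the enveloping algebra.\<close>
    have "bar_act 0 (pt (0 # replicate p 0 @ [0])) = (0 :: _ \<Rightarrow>\<^sub>0 'k)"
      by (rule flin_0[OF flin_bar_act_left[OF flin_id]])
    with eq_act[of "replicate p 0" 0] show ?case by simp
  next
    case (insert es K)
    obtain x ms y where es: "es = x # ms @ [y]"
      using insert.prems by - (rule length_ge_2E[of es]; auto)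
    then have ms: "length ms = p" using insert.prems by auto
    have "bar_act (fscale (c es) (pt (x, y))) (pt (0 # ms @ [0])) = fscale (c es) (pt es)"
      by (subst flin_scale[OF flin_bar_act_left[OF flin_id]]) (simp add: bar_act_pt es outer_Cons_snoc)
    then have eq_es: "f (bar_elt (p + 2) (fscale (c es) (pt es))) = g (bar_elt (p + 2) (fscale (c es) (pt es)))"
      using eq_act[OF ms, of "fscale (c es) (pt (x, y))"] by simp
    have keys: "supp (fscale (c es) (pt es)) \<subseteq> ?L"
      "supp (\<Sum>es\<in>K. fscale (c es) (pt es)) \<subseteq> ?L"
      using insert.prems
      by (intro order_trans[OF keys_fscale] keys_sum_subset; force)+
    have push: "h (bar_elt (p + 2) (fscale (c es) (pt es) + (\<Sum>es\<in>K. fscale (c es) (pt es)))) =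
        h (bar_elt (p + 2) (fscale (c es) (pt es))) \<oplus>\<^bsub>N\<^esub>
        h (bar_elt (p + 2) (\<Sum>es\<in>K. fscale (c es) (pt es)))"
      if "h \<in> lin_maps (Env scale) (Bar scale p) N" for h
      using that bar_elt_in_Bar[OF keys(1)] bar_elt_in_Bar[OF keys(2)]
      unfolding Bar_add[symmetric] by (simp only: lin_maps_def mem_Collect_eq)
    have IH: "f (bar_elt (p + 2) (\<Sum>es\<in>K. fscale (c es) (pt es))) =
        g (bar_elt (p + 2) (\<Sum>es\<in>K. fscale (c es) (pt es)))"
      using insert by blast
    show ?case
      unfolding sum.insert[OF insert.hyps] push[OF f] push[OF g] eq_es IH ..
  qed
  have "f A = g A" if A: "A \<in> carrier (Bar scale p)" for A
  proof -
    obtain b where b: "A = bar_elt (p + 2) b" "supp b \<subseteq> ?L"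
      using A by (rule Bar_carrierE)
    show ?thesis
      using eq_sum[OF finite_keys b(2), of "Poly_Mapping.lookup b"]
      unfolding b(1) poly_mapping_expand[of b, symmetric] .
  qed
  with f g show "f = g"
    by (rule lin_maps_eqI)
qed

lemma bar_diff_trunc_list: "bar_diff p (trunc_list b) = trunc_list (bar_diff p b)"
  if b: "supp b \<subseteq> words (p + 2)"
proof (rule flin_eqI[where f = b, OF flin_comp[OF flin_bar_diff flin_trunc_list] flin_comp[OF flin_trunc_list flin_bar_diff]])
  fix es assume "es \<in> supp b"
  then have "length es = p + 2" using b by auto
  moreover have "trunc (d + e) = trunc d + trunc e" for d e
    by (auto simp: trunc_def)
  ultimately show "bar_diff p (trunc_list (pt es)) = trunc_list (bar_diff p (pt es))"
    by (simp add: bar_diff_def trunc_list_def flin_sum[OF flin_lin_ext] flin_scale[OF flin_lin_ext]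
        face_def take_map drop_map del: fscale_single)
qed

lemma bar_diff_bar_act:
  assumes b: "supp b \<subseteq> words (q + 3)"
  shows "bar_diff (Suc q) (bar_act P b) = bar_act P (bar_diff (Suc q) b)"
proof (rule bilin_eqI[where G = "\<lambda>P b. bar_diff (Suc q) (bar_act P b)" and g = b and f = P])
  show "flin (\<lambda>P. bar_diff (Suc q) (bar_act P b))" "flin (\<lambda>P. bar_act P (bar_diff (Suc q) b))"
    "flin (\<lambda>b. bar_diff (Suc q) (bar_act (pt x) b))" "flin (\<lambda>b. bar_act (pt x) (bar_diff (Suc q) b))" for x
    by (intro flin_comp[OF flin_bar_diff] flin_bar_act_left flin_bar_act_right flin_id flin_bar_diff)+
  fix x :: "(nat \<Rightarrow> nat) \<times> (nat \<Rightarrow> nat)" and es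
  assume "es \<in> supp b"
  then have es: "length es = q + 3" using b by auto
  obtain a c where x: "x = (a, c)" by (cases x)
  have "bar_act (pt x) (bar_diff (Suc q) (pt es)) =
      (\<Sum>j\<in>{0..Suc q}. fscale ((- 1) ^ j) (bar_act (pt x) (lin_ext (face (+) j) (pt es))))"
    unfolding bar_diff_def
    by (simp only: flin_sum[OF flin_bar_act_right[OF flin_id]] flin_scale[OF flin_bar_act_right[OF flin_id]])
  also have "\<dots> = bar_diff (Suc q) (bar_act (pt x) (pt es))"
    unfolding bar_diff_def
    by (intro sum.cong refl) (simp add: x bar_act_pt face_outer[OF _ es])
  finally show "bar_diff (Suc q) (bar_act (pt x) (pt es)) = bar_act (pt x) (bar_diff (Suc q) (pt es))" ..
qed

text \<open>The map given by \<open>bar_diff\<close> in coordinates has the values prescribed for the bar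
  differential, since taking coordinates is compatible with multiplying neighbours. It is
  the only such map.\<close>

lemma bar_d_bar_elt:
  assumes "supp b \<subseteq> words (q + 3)"
  shows "bar_d scale (Suc q) (bar_elt (q + 3) b) = bar_elt (q + 2) (bar_diff (Suc q) b)"
proof -
  let ?E = "Env scale" and ?L = "words (Suc q + 2) :: (nat \<Rightarrow> nat) list set"
  let ?term = "\<lambda>as j. ((\<ominus>\<^bsub>?E\<^esub> \<one>\<^bsub>?E\<^esub>) [^]\<^bsub>?E\<^esub> j) \<odot>\<^bsub>Bar scale q\<^esub>
    tens S (take j as @ [as ! j \<otimes>\<^bsub>S\<^esub> as ! (j + 1)] @ drop (j + 2) as)"
  have keys_diff: "supp (bar_diff (Suc q) b) \<subseteq> words (q + 2)"
    if "supp b \<subseteq> ?L" for b :: "(nat \<Rightarrow> nat) list \<Rightarrow>\<^sub>0 'k"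
    using keys_bar_diff[of b "Suc q"] that by (simp add: One_nat_def)
  obtain f where f: "f \<in> lin_maps ?E (Bar scale (Suc q)) (Bar scale q)"
    and f_elt: "\<And>b. supp b \<subseteq> ?L \<Longrightarrow>
      f (bar_elt (Suc q + 2) b) = bar_elt (q + 2) (bar_diff (Suc q) b)"
  proof (rule bar_map_exists[where p = "Suc q" and N = "Bar scale q" and
        F = "\<lambda>b. bar_elt (q + 2) (bar_diff (Suc q) b)"])
    fix b c :: "(nat \<Rightarrow> nat) list \<Rightarrow>\<^sub>0 'k" and P
    assume b: "supp b \<subseteq> ?L"
    show "bar_elt (q + 2) (bar_diff (Suc q) b) \<in> carrier (Bar scale q)"
      by (rule bar_elt_in_Bar[OF keys_diff[OF b]])
    show "bar_elt (q + 2) (bar_diff (Suc q) (trunc_list b)) = bar_elt (q + 2) (bar_diff (Suc q) b)"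
      by (simp only: bar_diff_trunc_list[OF b] bar_elt_trunc_list)
    show "bar_elt (q + 2) (bar_diff (Suc q) (b + c)) = bar_elt (q + 2) (bar_diff (Suc q) b)
        \<oplus>\<^bsub>Bar scale q\<^esub> bar_elt (q + 2) (bar_diff (Suc q) c)"
      by (simp only: Bar_add flin_add[OF flin_bar_diff])
    show "bar_elt (q + 2) (bar_diff (Suc q) (bar_act P b)) =
        env_elt P \<odot>\<^bsub>Bar scale q\<^esub> bar_elt (q + 2) (bar_diff (Suc q) b)"
    proof -
      have "supp b \<subseteq> words (q + 3)"
        using b by (simp add: numeral_3_eq_3)
      then show ?thesis
        by (simp only: Bar_smult[OF keys_diff[OF b]] bar_diff_bar_act)
    qed
  qed blast
  have f_tens: "f (tens S as) = (\<Oplus>\<^bsub>Bar scale q\<^esub>j\<in>{0..Suc q}. ?term as j)"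
    if as: "as \<in> carrier_lists S (Suc q + 2)" for as
  proof -
    let ?t = "tens_poly (map sym_coeffs as)"
    have len: "length as = q + 3" and sub: "set as \<subseteq> carrier S"
      using as by (auto simp: carrier_lists_def)
    have keys: "supp (lin_ext (face (+) j) ?t) \<subseteq> words (q + 2)"
      if "j \<le> Suc q" for j
      using that keys_tens_poly[of "map sym_coeffs as"] len
      by (intro keys_lin_ext) (auto simp: length_face)
    have "?term as j = bar_elt (q + 2) (fscale ((- 1) ^ j) (lin_ext (face (+) j) ?t))"
      if j: "j \<in> {0..Suc q}" for j
    proof -
      interpret S: comm_monoid S by (rule comm_monoid_Sym)
      have "as ! j \<in> carrier S" "as ! (j + 1) \<in> carrier S"
        using j len sub by (auto intro!: subsetD[OF sub] nth_mem)
      moreover from this have "face (\<otimes>\<^bsub>S\<^esub>) j as \<in> carrier_lists S (q + 2)"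
        using j len sub set_take_subset[of j as] set_drop_subset[of "j + 2" as]
        by (auto simp: carrier_lists_def face_def)
      ultimately have tens_face: "tens S (face (\<otimes>\<^bsub>S\<^esub>) j as) = bar_elt (q + 2) (lin_ext (face (+) j) ?t)"
        using j len
        by (simp add: tens_eq_bar_elt tens_poly_face)
          (simp add: face_def take_map drop_map sym_coeffs_mult)
      have "supp (lin_ext (face (+) j) ?t) \<subseteq> words (q + 2)"
        using j by (intro keys) simp
      then show ?thesis
        by (simp only: Env_minus_one_power minus_one_power face_def[symmetric] tens_face Bar_smult
            bar_act_const[OF le_add2])
    qed
    moreover have "bar_elt (q + 2) (fscale ((- 1) ^ j) (lin_ext (face (+) j) ?t)) \<in> carrier (Bar scale q)"
      if "j \<in> {0..Suc q}" for j
      using that keys[of j] by (intro bar_elt_in_Bar order_trans[OF keys_fscale]) simp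
    ultimately have "(\<Oplus>\<^bsub>Bar scale q\<^esub>j\<in>{0..Suc q}. ?term as j) =
        (\<Oplus>\<^bsub>Bar scale q\<^esub>j\<in>{0..Suc q}. bar_elt (q + 2) (fscale ((- 1) ^ j) (lin_ext (face (+) j) ?t)))"
      using presented_group.group[OF presented_Bar, of q]
      by (intro abelian_monoid.finsum_cong' abelian_group.axioms(1)) auto
    also have "\<dots> = bar_elt (q + 2) (bar_diff (Suc q) ?t)"
      unfolding bar_diff_def using keys by (intro Bar_finsum order_trans[OF keys_fscale]) auto
    also have "\<dots> = f (tens S as)"
    proof -
      have "supp ?t \<subseteq> ?L"
        using keys_tens_poly[of "map sym_coeffs as"] len by (simp add: numeral_3_eq_3)
      then show ?thesis
        by (simp only: tens_eq_bar_elt[OF as] f_elt)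
    qed
    finally show ?thesis ..
  qed
  have "bar_d scale (Suc q) = f"
    unfolding bar_d_def Let_def diff_Suc_1
  proof (rule the_equality)
    show "f \<in> lin_maps ?E (Bar scale (Suc q)) (Bar scale q) \<and>
        (\<forall>as\<in>carrier_lists S (Suc q + 2). f (tens S as) = (\<Oplus>\<^bsub>Bar scale q\<^esub>j\<in>{0..Suc q}. ?term as j))"
      using f f_tens by blast
    fix g assume g: "g \<in> lin_maps ?E (Bar scale (Suc q)) (Bar scale q) \<and>
        (\<forall>as\<in>carrier_lists S (Suc q + 2). g (tens S as) = (\<Oplus>\<^bsub>Bar scale q\<^esub>j\<in>{0..Suc q}. ?term as j))"
    show "g = f"
    proof (rule bar_map_eqI[OF _ f])
      fix es :: "(nat \<Rightarrow> nat) list" assume es: "length es = Suc q"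
      have "[\<one>\<^bsub>S\<^esub>] @ map smon es @ [\<one>\<^bsub>S\<^esub>] \<in> carrier_lists S (Suc q + 2)"
        using es smon_in_carrier[of 0] by (auto simp: carrier_lists_def smon_0)
      then show "g (tens S ([\<one>\<^bsub>S\<^esub>] @ map smon es @ [\<one>\<^bsub>S\<^esub>])) = f (tens S ([\<one>\<^bsub>S\<^esub>] @ map smon es @ [\<one>\<^bsub>S\<^esub>]))"
        using g f_tens by (metis (no_types, lifting))
    qed (use g in blast)
  qed
  then show ?thesis
    using f_elt[of b] assms by (simp add: numeral_3_eq_3)
qed

end

section \<open>Contracting an alternating map with a linear map\<close>

definition del :: "nat \<Rightarrow> 'a list \<Rightarrow> 'a list" where
  "del i xs = take i xs @ drop (Suc i) xs"

lemma length_del: "i < length xs \<Longrightarrow> length (del i xs) = length xs - 1"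
  by (simp add: del_def)

lemma del_0_Cons: "del 0 (x # xs) = xs"
  and del_Suc_Cons: "del (Suc i) (x # xs) = x # del i xs"
  by (simp_all add: del_def)

lemma map_del: "map f (del i xs) = del i (map f xs)"
  by (simp add: del_def take_map drop_map)

lemma del_append_left: "i < length as \<Longrightarrow> del i (as @ bs) = del i as @ bs"
  and del_append_right: "del (length as + i) (as @ bs) = as @ del i bs"
  by (simp_all add: del_def)

lemma sum_lessThan_add: "(\<Sum>i<m + n. f i) = (\<Sum>i<m. f i) + (\<Sum>i<n. f (m + i :: nat))"
  for f :: "nat \<Rightarrow> 'a::comm_monoid_add"
  by (induction n) (simp_all add: add_ac)

text \<open>If \<open>D x ws\<close> is the product of a linear function of \<open>x\<close> with the wedge of \<open>ws\<close>, this is the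
  contraction that defines the Koszul differential.\<close>

definition contraction :: "('v \<Rightarrow> 'v list \<Rightarrow> ('y \<Rightarrow>\<^sub>0 'k::field)) \<Rightarrow> 'v list \<Rightarrow> ('y \<Rightarrow>\<^sub>0 'k)" where
  "contraction D ws = (\<Sum>i<length ws. fscale ((- 1) ^ i) (D (ws ! i) (del i ws)))"

text \<open>Isolates the term in which a given vector is removed, so that the dependence on this
  vector can be read off.\<close>

lemma contraction_split:
  "contraction D (as @ x # bs) =
    (\<Sum>i<length as. fscale ((- 1) ^ i) (D (as ! i) (del i as @ x # bs))) +
    fscale ((- 1) ^ length as) (D x (as @ bs)) +
    (\<Sum>i<length bs. fscale ((- 1) ^ (length as + Suc i)) (D (bs ! i) (as @ x # del i bs)))"
proof -
  have len: "length (as @ x # bs) = length as + Suc (length bs)"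
    by simp
  have "contraction D (as @ x # bs) =
      (\<Sum>i<length as. fscale ((- 1) ^ i) (D ((as @ x # bs) ! i) (del i (as @ x # bs)))) +
      (\<Sum>i<Suc (length bs). fscale ((- 1) ^ (length as + i))
        (D ((as @ x # bs) ! (length as + i)) (del (length as + i) (as @ x # bs))))"
    by (simp only: contraction_def len sum_lessThan_add)
  then show ?thesis
    by (simp add: sum.lessThan_Suc_shift nth_append del_append_left del_append_right del_0_Cons
        del_Suc_Cons add.assoc del: sum.lessThan_Suc)
qed

locale koszul_contraction =
  fixes scale :: "'k::field \<Rightarrow> 'v::ab_group_add \<Rightarrow> 'v"
    and D :: "'v \<Rightarrow> 'v list \<Rightarrow> ('y \<Rightarrow>\<^sub>0 'k)" and q :: nat
  assumes add_left: "length ws = q \<Longrightarrow> D (x + y) ws = D x ws + D y ws"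
    and scale_left: "length ws = q \<Longrightarrow> D (scale c x) ws = fscale c (D x ws)"
    and add_right: "length as + length bs + 1 = q \<Longrightarrow>
      D z (as @ (x + y) # bs) = D z (as @ x # bs) + D z (as @ y # bs)"
    and scale_right: "length as + length bs + 1 = q \<Longrightarrow>
      D z (as @ scale c x # bs) = fscale c (D z (as @ x # bs))"
    and alternating: "length ws = q \<Longrightarrow> \<not> distinct ws \<Longrightarrow> D z ws = 0"
begin

lemma contraction_add:
  assumes "length as + length bs = q"
  shows "contraction D (as @ (x + y) # bs) = contraction D (as @ x # bs) + contraction D (as @ y # bs)"
proof -
  have "D (as ! i) (del i as @ (x + y) # bs) = D (as ! i) (del i as @ x # bs) + D (as ! i) (del i as @ y # bs)"
    if "i < length as" for i
    using that assms by (intro add_right) (simp add: length_del)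
  moreover have "D (bs ! i) (as @ (x + y) # del i bs) =
      D (bs ! i) (as @ x # del i bs) + D (bs ! i) (as @ y # del i bs)" if "i < length bs" for i
    using that assms by (intro add_right) (simp add: length_del)
  ultimately show ?thesis
    using assms
    by (simp add: contraction_split add_left free.scale_right_distrib sum.distrib add_ac del: power_Suc)
qed

lemma contraction_scale:
  assumes "length as + length bs = q"
  shows "contraction D (as @ scale c x # bs) = fscale c (contraction D (as @ x # bs))"
proof -
  have "D (as ! i) (del i as @ scale c x # bs) = fscale c (D (as ! i) (del i as @ x # bs))"
    if "i < length as" for i
    using that assms by (intro scale_right) (simp add: length_del)
  moreover have "D (bs ! i) (as @ scale c x # del i bs) = fscale c (D (bs ! i) (as @ x # del i bs))"
    if "i < length bs" for i
    using that assms by (intro scale_right) (simp add: length_del)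
  ultimately show ?thesis
    using assms
    by (simp add: contraction_split scale_left free.scale_right_distrib free.scale_sum_right mult.commute)
qed

text \<open>The usual polarisation: expand the vanishing value at \<open>x + y\<close> in both places.\<close>

lemma swap:
  assumes "length as + length bs + 2 = q"
  shows "D z (as @ x # y # bs) = - D z (as @ y # x # bs)"
proof -
  have split1: "D z (as @ (x + y) # w # bs) = D z (as @ x # w # bs) + D z (as @ y # w # bs)" for w
    using assms by (intro add_right) simp
  have split2: "D z (as @ w # (x + y) # bs) = D z (as @ w # x # bs) + D z (as @ w # y # bs)" for w
    using assms add_right[of "as @ [w]" bs z x y] by simp
  have zero: "D z (as @ w # w # bs) = 0" for w
    using assms by (intro alternating) auto
  have "0 = D z (as @ (x + y) # (x + y) # bs)"
    by (rule zero[symmetric])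
  also have "\<dots> = D z (as @ x # y # bs) + D z (as @ y # x # bs)"
    by (simp only: split1 split2) (simp add: zero)
  finally have "D z (as @ x # y # bs) + D z (as @ y # x # bs) = 0"
    by (rule HOL.sym)
  then show ?thesis
    by (simp only: eq_neg_iff_add_eq_0)
qed

lemma move:
  assumes "length as + length bs + length cs + 1 = q"
  shows "D z (as @ x # bs @ cs) = fscale ((- 1) ^ length bs) (D z (as @ bs @ x # cs))"
  using assms
proof (induction bs arbitrary: as)
  case (Cons b bs)
  have "D z (as @ x # b # (bs @ cs)) = - D z (as @ b # x # (bs @ cs))"
    using Cons.prems by (intro swap) simp
  also have "\<dots> = - fscale ((- 1) ^ length bs) (D z (as @ b # bs @ x # cs))"
    using Cons.IH[of "as @ [b]"] Cons.prems by simp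
  finally show ?case by simp
qed simp

text \<open>Suppose that \<open>x\<close> occurs twice in \<open>ws\<close>. All terms that remove a third vector vanish. The
  other two differ by moving \<open>x\<close> across the vectors in between, and the sign of this move is
  opposite to the quotient of their signs in the sum.\<close>

lemma contraction_alternating:
  assumes "length ws = Suc q" "\<not> distinct ws"
  shows "contraction D ws = 0"
proof -
  obtain as bs cs x where ws: "ws = as @ [x] @ bs @ [x] @ cs"
    using not_distinct_decomp[OF assms(2)] by blast
  have len: "length as + length bs + length cs + 1 = q"
    using assms(1) by (simp add: ws)
  have zero: "D z us = 0" if "length us = q" "us = as' @ x # bs' @ x # cs'" for z us as' bs' cs'
    using that by (intro alternating) auto
  have 1: "D z (del i as @ x # bs @ x # cs) = 0" if "i < length as" for z i
    using that len by (intro zero) (auto simp: length_del)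
  have 2: "D z (as @ x # del i bs @ x # cs) = 0" if "i < length bs" for z i
    using that len by (intro zero) (auto simp: length_del)
  have 3: "D z (as @ x # bs @ x # del i cs) = 0" if "i < length cs" for z i
    using that len by (intro zero[of _ as bs "del i cs"]) (auto simp: length_del)
  have "contraction D (as @ x # bs @ x # cs) =
      fscale ((- 1) ^ length as) (D x (as @ bs @ x # cs)) +
      (\<Sum>i<length (bs @ x # cs). fscale ((- 1) ^ (length as + Suc i))
        (D ((bs @ x # cs) ! i) (as @ x # del i (bs @ x # cs))))"
    by (subst contraction_split) (simp add: 1)
  also have "(\<Sum>i<length (bs @ x # cs). fscale ((- 1) ^ (length as + Suc i))
        (D ((bs @ x # cs) ! i) (as @ x # del i (bs @ x # cs)))) =
      fscale ((- 1) ^ (length as + Suc 0)) (contraction (\<lambda>z ws. D z (as @ x # ws)) (bs @ x # cs))"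
    by (simp add: contraction_def free.scale_sum_right power_add del: sum.lessThan_Suc)
  also have "contraction (\<lambda>z ws. D z (as @ x # ws)) (bs @ x # cs) =
      fscale ((- 1) ^ length bs) (D x (as @ x # bs @ cs))"
    by (subst contraction_split) (simp add: 2 3)
  also have "D x (as @ x # bs @ cs) = fscale ((- 1) ^ length bs) (D x (as @ bs @ x # cs))"
    using len by (intro move) simp
  finally show ?thesis
    by (simp add: ws flip: power_add free.scale_left_distrib power_mult_distrib)
qed

end


section \<open>The Koszul modules\<close>

lemma
  assumes "x \<in> carrier A" "y \<in> carrier B"
  shows nf_bilin_add_left: "x' \<in> carrier A \<Longrightarrow> nf (bilin_rels A B) (pt (x \<oplus>\<^bsub>A\<^esub> x', y)) =
      nf (bilin_rels A B) (pt (x, y)) + nf (bilin_rels A B) (pt (x', y))"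
    and nf_bilin_add_right: "y' \<in> carrier B \<Longrightarrow> nf (bilin_rels A B) (pt (x, y \<oplus>\<^bsub>B\<^esub> y')) =
      nf (bilin_rels A B) (pt (x, y)) + nf (bilin_rels A B) (pt (x, y'))"
    and nf_bilin_scale_left: "nf (bilin_rels A B) (pt (c \<odot>\<^bsub>A\<^esub> x, y)) = fscale c (nf (bilin_rels A B) (pt (x, y)))"
    and nf_bilin_scale_right: "nf (bilin_rels A B) (pt (x, c \<odot>\<^bsub>B\<^esub> y)) = fscale c (nf (bilin_rels A B) (pt (x, y)))"
proof -
  let ?N = "nf (bilin_rels A B)"
  have add: "?N a = ?N b + ?N c" if "a - b - c \<in> bilin_rels A B" for a b c
    using nf_rel[OF that] by (simp only: flin_diff[OF flin_nf]) (simp add: algebra_simps)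
  have scale: "?N a = fscale c (?N b)" if "a - fscale c b \<in> bilin_rels A B" for a b c
    using nf_rel[OF that] by (simp only: flin_diff[OF flin_nf] flin_scale[OF flin_nf]) simp
  show "x' \<in> carrier A \<Longrightarrow> ?N (pt (x \<oplus>\<^bsub>A\<^esub> x', y)) = ?N (pt (x, y)) + ?N (pt (x', y))"
    by (rule add) (use assms in \<open>unfold bilin_rels_def, blast\<close>)
  show "y' \<in> carrier B \<Longrightarrow> ?N (pt (x, y \<oplus>\<^bsub>B\<^esub> y')) = ?N (pt (x, y)) + ?N (pt (x, y'))"
    by (rule add) (use assms in \<open>unfold bilin_rels_def, blast\<close>)
  show "?N (pt (c \<odot>\<^bsub>A\<^esub> x, y)) = fscale c (?N (pt (x, y)))"
    by (rule scale) (use assms in \<open>unfold bilin_rels_def, blast\<close>)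
  show "?N (pt (x, c \<odot>\<^bsub>B\<^esub> y)) = fscale c (?N (pt (x, y)))"
    by (rule scale) (use assms in \<open>unfold bilin_rels_def, blast\<close>)
qed

text \<open>The universal property of the tensor product, for maps into a free space.\<close>

lemma flin_bilin_rels_0:
  assumes H: "flin H"
    and add_left: "\<And>x x' y. x \<in> carrier A \<Longrightarrow> x' \<in> carrier A \<Longrightarrow> y \<in> carrier B \<Longrightarrow>
      H (pt (x \<oplus>\<^bsub>A\<^esub> x', y)) = H (pt (x, y)) + H (pt (x', y))"
    and add_right: "\<And>x y y'. x \<in> carrier A \<Longrightarrow> y \<in> carrier B \<Longrightarrow> y' \<in> carrier B \<Longrightarrow>
      H (pt (x, y \<oplus>\<^bsub>B\<^esub> y')) = H (pt (x, y)) + H (pt (x, y'))"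
    and scale_left: "\<And>c x y. x \<in> carrier A \<Longrightarrow> y \<in> carrier B \<Longrightarrow>
      H (pt (c \<odot>\<^bsub>A\<^esub> x, y)) = fscale c (H (pt (x, y)))"
    and scale_right: "\<And>c x y. x \<in> carrier A \<Longrightarrow> y \<in> carrier B \<Longrightarrow>
      H (pt (x, c \<odot>\<^bsub>B\<^esub> y)) = fscale c (H (pt (x, y)))"
    and r: "r \<in> bilin_rels A B"
  shows "H r = 0"
  using r unfolding bilin_rels_def
  by (elim UnE CollectE exE conjE)
    (simp_all only: flin_diff[OF H] flin_scale[OF H] add_left add_right scale_left scale_right, simp_all)

context based_space
begin

abbreviation "E \<equiv> Env scale"

abbreviation "W \<equiv> ext_power (Vmod scale)"

abbreviation "wdg \<equiv> wedge (Vmod scale)"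

abbreviation "K_rels p \<equiv> bilin_rels E (W p)"

abbreviation "kos_gens p \<equiv> carrier E \<times> carrier (W p)"

lemma carrier_lists_Vmod [simp]: "carrier_lists (Vmod scale) p = words p"
  by (auto simp: carrier_lists_def Vmod_def)

lemma presented_W: "presented_group (W p) (words p) (alt_rels (Vmod scale) p)"
  using presented_group_pres_space[of "words p" "alt_rels (Vmod scale) p"]
  by (simp add: ext_power_def)

lemma W_smult: "c \<odot>\<^bsub>W p\<^esub> rel_coset (alt_rels (Vmod scale) p) f = rel_coset (alt_rels (Vmod scale) p) (fscale c f)"
  by (simp add: ext_power_def pres_space_smult)

lemma wdg_in_W: "length ws = p \<Longrightarrow> wdg ws \<in> carrier (W p)"
  by (auto simp: wedge_def intro: presented_group.in_carrier[OF presented_W])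

lemma
  assumes "length as + length bs + 1 = p"
  shows wdg_add: "wdg (as @ (x + y) # bs) = wdg (as @ x # bs) \<oplus>\<^bsub>W p\<^esub> wdg (as @ y # bs)"
    and wdg_scale: "wdg (as @ scale c x # bs) = c \<odot>\<^bsub>W p\<^esub> wdg (as @ x # bs)"
proof -
  let ?R = "alt_rels (Vmod scale) p"
  have len: "length (as @ z # bs) = p" for z
    using assms by simp
  have R: "multilin_rels (Vmod scale) p \<subseteq> ?R"
    by (auto simp: alt_rels_def)
  have "nf ?R (pt (as @ (x + y) # bs)) = nf ?R (pt (as @ x # bs) + pt (as @ y # bs))"
    using nf_multilin_add[OF R assms, of x y] by (simp add: Vmod_def flin_add[OF flin_nf])
  moreover have "nf ?R (pt (as @ scale c x # bs)) = nf ?R (fscale c (pt (as @ x # bs)))"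
    using nf_multilin_scale[OF R assms, of x c] by (simp only: flin_scale[OF flin_nf]) (simp add: Vmod_def)
  ultimately show "wdg (as @ (x + y) # bs) = wdg (as @ x # bs) \<oplus>\<^bsub>W p\<^esub> wdg (as @ y # bs)"
    "wdg (as @ scale c x # bs) = c \<odot>\<^bsub>W p\<^esub> wdg (as @ x # bs)"
    by (simp_all only: wedge_def len nf_eq_iff W_smult presented_group.add_eq[OF presented_W])
qed

lemma wdg_not_distinct:
  assumes "length ws = p" "\<not> distinct ws"
  shows "wdg ws = \<zero>\<^bsub>W p\<^esub>"
proof -
  have "pt ws \<in> alt_rels (Vmod scale) p"
    using assms by (auto simp: alt_rels_def)
  then show ?thesis
    using assms by (simp add: wedge_def presented_group.zero_eq[OF presented_W] rel_coset_eq_iff free.span_base)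
qed

text \<open>The tensor of an element of \<open>S(V)\<^sup>e\<close> with a wedge of vectors, in normal form: a function
  with values in a free space which is linear in the first argument and alternating
  multilinear in the vectors.\<close>

definition kos_nf :: "nat \<Rightarrow> 'k epoly \<Rightarrow> 'v list \<Rightarrow> _" where
  "kos_nf p P ws = nf (K_rels p) (pt (env_elt P, wdg ws))"

lemma flin_kos_nf: "length ws = p \<Longrightarrow> flin (\<lambda>P. kos_nf p P ws)"
  by (rule flinI)
    (simp_all add: kos_nf_def nf_bilin_add_left nf_bilin_scale_left env_elt_in_Env wdg_in_W
      flip: env_elt_add env_elt_smult)

lemma
  assumes "length as + length bs + 1 = p"
  shows kos_nf_add: "kos_nf p P (as @ (x + y) # bs) = kos_nf p P (as @ x # bs) + kos_nf p P (as @ y # bs)"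
    and kos_nf_scale: "kos_nf p P (as @ scale c x # bs) = fscale c (kos_nf p P (as @ x # bs))"
  using assms
  by (simp_all add: kos_nf_def wdg_add wdg_scale nf_bilin_add_right nf_bilin_scale_right env_elt_in_Env wdg_in_W)

lemma nf_zero_right:
  assumes "u \<in> carrier E"
  shows "nf (K_rels p) (pt (u, \<zero>\<^bsub>W p\<^esub>)) = 0"
proof -
  interpret W: presented_group "W p" "words p" "alt_rels (Vmod scale) p"
    by (rule presented_W)
  have "\<zero>\<^bsub>W p\<^esub> = 0 \<odot>\<^bsub>W p\<^esub> \<zero>\<^bsub>W p\<^esub>"
    by (simp add: W.zero_eq W_smult)
  then have "nf (K_rels p) (pt (u, \<zero>\<^bsub>W p\<^esub>)) = fscale 0 (nf (K_rels p) (pt (u, \<zero>\<^bsub>W p\<^esub>)))"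
    using nf_bilin_scale_right[OF assms W.zero_closed, of 0] by simp
  then show ?thesis by simp
qed

lemma kos_nf_alternating: "length ws = p \<Longrightarrow> \<not> distinct ws \<Longrightarrow> kos_nf p P ws = 0"
  by (simp add: kos_nf_def wdg_not_distinct nf_zero_right env_elt_in_Env)

text \<open>The coordinates of \<open>x \<otimes> 1 - 1 \<otimes> x\<close>.\<close>

definition vec_diff :: "'v \<Rightarrow> 'k epoly" where
  "vec_diff x = lin_ext (\<lambda>e. (e, 0)) (vec_poly x) - lin_ext (\<lambda>e. (0, e)) (vec_poly x)"

lemma vec_diff_add: "vec_diff (x + y) = vec_diff x + vec_diff y"
  and vec_diff_scale: "vec_diff (scale c x) = fscale c (vec_diff x)"
  by (simp_all add: vec_diff_def vec_poly_add vec_poly_scale flin_add[OF flin_lin_ext]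
      flin_scale[OF flin_lin_ext] free.scale_right_diff_distrib)

lemma sym_inc_carrier: "sym_inc scale x \<in> carrier S"
  by (simp add: sym_inc_def rel_coset_in_Sym)

lemma one_carrier: "\<one>\<^bsub>S\<^esub> \<in> carrier S"
  using smon_in_carrier[of 0] by (simp only: smon_0)

lemma env_elt_vec_diff:
  "tens S [sym_inc scale x, \<one>\<^bsub>S\<^esub>] \<ominus>\<^bsub>E\<^esub> tens S [\<one>\<^bsub>S\<^esub>, sym_inc scale x] = env_elt (vec_diff x)"
proof -
  have in_lists: "[sym_inc scale x, \<one>\<^bsub>S\<^esub>] \<in> carrier_lists S 2" "[\<one>\<^bsub>S\<^esub>, sym_inc scale x] \<in> carrier_lists S 2"
    by (simp_all add: carrier_lists_def sym_inc_carrier one_carrier)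
  have coeffs: "sym_coeffs (sym_inc scale x) = vec_poly x" "sym_coeffs \<one>\<^bsub>S\<^esub> = pt 0"
    by (simp_all add: sym_inc_def Sym_one coeffs_var coeffs_1)
  have "bilin_ext (#) f (bilin_ext (#) (pt 0) (pt [])) =
      lin_ext (\<lambda>(q, r). [q, r]) (lin_ext (\<lambda>e. (e, 0)) f)" for f :: "'k npoly"
    by (rule flin_eqI[where G = "\<lambda>f. bilin_ext (#) f (bilin_ext (#) (pt 0) (pt []))"];
        (intro flin_intros | simp only: bilin_ext_pt lin_ext_pt prod.case))
  moreover have "bilin_ext (#) (pt 0) (bilin_ext (#) f (pt [])) =
      lin_ext (\<lambda>(q, r). [q, r]) (lin_ext (\<lambda>e. (0, e)) f)" for f :: "'k npoly"
    by (rule flin_eqI[where G = "\<lambda>f. bilin_ext (#) (pt 0) (bilin_ext (#) f (pt []))"];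
        (intro flin_intros | simp only: bilin_ext_pt lin_ext_pt prod.case))
  ultimately have "tens S [sym_inc scale x, \<one>\<^bsub>S\<^esub>] = env_elt (lin_ext (\<lambda>e. (e, 0)) (vec_poly x))"
    "tens S [\<one>\<^bsub>S\<^esub>, sym_inc scale x] = env_elt (lin_ext (\<lambda>e. (0, e)) (vec_poly x))"
    by (simp_all only: tens_eq_bar_elt[OF in_lists(1)] tens_eq_bar_elt[OF in_lists(2)] env_elt_def
        list.map tens_poly.simps coeffs)
  then show ?thesis
    by (simp only: env_elt_minus vec_diff_def)
qed

lemma contraction_kos_nf: "koszul_contraction scale (\<lambda>x ws. kos_nf q (P * vec_diff x) ws) q"
proof
  fix ws :: "'v list" and x y c assume "length ws = q"
  then show "kos_nf q (P * vec_diff (x + y)) ws = kos_nf q (P * vec_diff x) ws + kos_nf q (P * vec_diff y) ws"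
    "kos_nf q (P * vec_diff (scale c x)) ws = fscale c (kos_nf q (P * vec_diff x) ws)"
    by (simp_all only: vec_diff_add vec_diff_scale distrib_left fscale_times flin_add[OF flin_kos_nf] flin_scale[OF flin_kos_nf])
qed (simp_all add: kos_nf_add kos_nf_scale kos_nf_alternating)

lemma presented_Kos: "presented_group (Kos scale p) (kos_gens p) (K_rels p)"
  using presented_group_pres_space[of "kos_gens p" "K_rels p"]
  by (simp add: presented_group_def Kos_def tensor_prod_def Let_def)

lemma Env_mult_closed: "u \<in> carrier E \<Longrightarrow> u' \<in> carrier E \<Longrightarrow> u \<otimes>\<^bsub>E\<^esub> u' \<in> carrier E"
  by (auto elim!: Env_carrierE simp: env_elt_mult env_elt_in_Env)

lemma Env_mult_assoc:
  "u \<in> carrier E \<Longrightarrow> u' \<in> carrier E \<Longrightarrow> u'' \<in> carrier E \<Longrightarrow> (u \<otimes>\<^bsub>E\<^esub> u') \<otimes>\<^bsub>E\<^esub> u'' = u \<otimes>\<^bsub>E\<^esub> (u' \<otimes>\<^bsub>E\<^esub> u'')"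
  by (auto elim!: Env_carrierE simp: env_elt_mult mult.assoc)

definition env_mult_left where
  "env_mult_left u = lin_ext (\<lambda>(u', w). (u \<otimes>\<^bsub>E\<^esub> u', w))"

lemma flin_env_mult_left: "flin (env_mult_left u)"
  by (simp add: env_mult_left_def flin_lin_ext)

text \<open>Multiplication by \<open>u\<close> is \<open>k\<close>-linear on the first tensor factor, so it maps relations to
  relations.\<close>

lemma Kos_smult:
  assumes u: "u \<in> carrier E"
  shows "u \<odot>\<^bsub>Kos scale p\<^esub> rel_coset (K_rels p) f = rel_coset (K_rels p) (env_mult_left u f)"
proof -
  let ?N = "nf (K_rels p)"
  have H: "flin (\<lambda>f. ?N (env_mult_left u f))"
    by (rule flin_comp[OF flin_nf flin_env_mult_left])
  have kill: "?N (env_mult_left u r) = 0" if "r \<in> K_rels p" for r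
  proof (rule flin_bilin_rels_0[OF H _ _ _ _ that])
    fix x x' y c assume x: "x \<in> carrier E" and y: "y \<in> carrier (W p)"
    obtain P Q where P: "u = env_elt P" "x = env_elt Q"
      using u x by (elim Env_carrierE)
    have "u \<otimes>\<^bsub>E\<^esub> (c \<odot>\<^bsub>E\<^esub> x) = c \<odot>\<^bsub>E\<^esub> (u \<otimes>\<^bsub>E\<^esub> x)"
      by (simp add: P env_elt_mult env_elt_smult fscale_times)
    then show "?N (env_mult_left u (pt (c \<odot>\<^bsub>E\<^esub> x, y))) = fscale c (?N (env_mult_left u (pt (x, y))))"
      using u x y by (simp add: env_mult_left_def nf_bilin_scale_left Env_mult_closed)
    assume x': "x' \<in> carrier E"
    then obtain Q' where Q': "x' = env_elt Q'" by (rule Env_carrierE)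
    have "u \<otimes>\<^bsub>E\<^esub> (x \<oplus>\<^bsub>E\<^esub> x') = (u \<otimes>\<^bsub>E\<^esub> x) \<oplus>\<^bsub>E\<^esub> (u \<otimes>\<^bsub>E\<^esub> x')"
      by (simp add: P Q' env_elt_mult env_elt_add distrib_left)
    then show "?N (env_mult_left u (pt (x \<oplus>\<^bsub>E\<^esub> x', y))) = ?N (env_mult_left u (pt (x, y))) + ?N (env_mult_left u (pt (x', y)))"
      using u x x' y by (simp add: env_mult_left_def nf_bilin_add_left Env_mult_closed)
  qed (use u in \<open>simp_all add: env_mult_left_def nf_bilin_add_right nf_bilin_scale_right Env_mult_closed\<close>)
  have "(\<Union>f'\<in>rel_coset (K_rels p) f. rel_coset (K_rels p) (env_mult_left u f')) = rel_coset (K_rels p) (env_mult_left u f)"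
  proof (rule UN_rel_coset)
    fix f' assume "rel_coset (K_rels p) f' = rel_coset (K_rels p) f"
    then have "?N (env_mult_left u (f' - f)) = 0"
      by (intro flin_span_0[OF H kill]) (simp_all add: rel_coset_eq_iff)
    then show "rel_coset (K_rels p) (env_mult_left u f') = rel_coset (K_rels p) (env_mult_left u f)"
      by (simp add: flin_diff[OF H] nf_eq_iff[symmetric])
  qed
  then show ?thesis
    by (simp add: Kos_def Let_def env_mult_left_def)
qed

lemma kos_tens_eq: "length ws = p \<Longrightarrow> kos_tens scale u ws = rel_coset (K_rels p) (pt (u, wdg ws))"
  by (simp add: kos_tens_def tens2_def)

lemma Kos_smult_pt:
  "u \<in> carrier E \<Longrightarrow> u \<odot>\<^bsub>Kos scale p\<^esub> rel_coset (K_rels p) (pt (u', w)) = rel_coset (K_rels p) (pt (u \<otimes>\<^bsub>E\<^esub> u', w))"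
  by (simp add: Kos_smult env_mult_left_def)

end

section \<open>The Koszul differential\<close>

type_synonym 'k kpoly = "(((nat \<Rightarrow> nat) \<times> (nat \<Rightarrow> nat)) \<times> nat list) \<Rightarrow>\<^sub>0 'k"

definition kos_act :: "'k::field epoly \<Rightarrow> 'k kpoly \<Rightarrow> 'k kpoly" where
  "kos_act = bilin_ext (\<lambda>p (p', is). (p + p', is))"

lemma flin_kos_act_left: "flin F \<Longrightarrow> flin (\<lambda>x. kos_act (F x) w)"
  and flin_kos_act_right: "flin G \<Longrightarrow> flin (\<lambda>x. kos_act P (G x))"
  by (simp_all add: kos_act_def flin_bilin_left flin_bilin_right)

lemma kos_act_pt: "kos_act (pt p) (pt (p', is)) = pt (p + p', is)"
  by (simp add: kos_act_def)

definition var_diff :: "nat \<Rightarrow> 'k::field epoly" where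
  "var_diff m = pt (unit_exp m, 0) - pt (0, unit_exp m)"

definition kos_diff :: "'k::field kpoly \<Rightarrow> 'k kpoly" where
  "kos_diff = lext (\<lambda>(p, is).
    \<Sum>r<length is. fscale ((- 1) ^ r) (kos_act (var_diff (is ! r)) (pt (p, del r is))))"

lemma flin_kos_diff: "flin kos_diff"
  by (simp add: kos_diff_def flin_lext)

abbreviation kpoly_degree :: "nat \<Rightarrow> (((nat \<Rightarrow> nat) \<times> (nat \<Rightarrow> nat)) \<times> nat list) set" where
  "kpoly_degree p \<equiv> {(x, is). length is = p}"

lemma flin_lext_commute: "flin H \<Longrightarrow> H (lext h f) = lext (\<lambda>x. H (h x)) f"
  by (simp add: lext_def flin_sum flin_scale)

context based_space
begin

text \<open>The value of the Koszul differential on the tensor of \<open>u\<close> with the wedge of \<open>ws\<close>, as a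
  formal combination of generators.\<close>

definition kos_contract where
  "kos_contract u ws = (\<Sum>i<length ws. fscale ((- 1) ^ i) (pt (u \<otimes>\<^bsub>E\<^esub> env_elt (vec_diff (ws ! i)), wdg (del i ws))))"

lemma nf_kos_contract:
  "nf (K_rels q) (kos_contract (env_elt P) ws) = contraction (\<lambda>x ws. kos_nf q (P * vec_diff x) ws) ws"
  by (simp add: kos_contract_def contraction_def flin_sum[OF flin_nf] flin_scale[OF flin_nf] kos_nf_def env_elt_mult
      del: fscale_single)

lemma Vmod_add: "x \<oplus>\<^bsub>Vmod scale\<^esub> y = x + y"
  and Vmod_smult: "c \<odot>\<^bsub>Vmod scale\<^esub> x = scale c x"
  by (simp_all add: Vmod_def)

text \<open>For fixed \<open>u\<close> the contraction is alternating multilinear in the vectors, so it descends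
  from lists of vectors to the exterior power.\<close>

lemma kos_contract_cong:
  assumes "rel_coset (alt_rels (Vmod scale) (Suc q)) g = rel_coset (alt_rels (Vmod scale) (Suc q)) g'"
    and u: "u \<in> carrier E"
  shows "nf (K_rels q) (lext (kos_contract u) g) = nf (K_rels q) (lext (kos_contract u) g')"
proof -
  obtain P where P: "u = env_elt P" using u by (rule Env_carrierE)
  let ?H = "\<lambda>g. nf (K_rels q) (lext (kos_contract u) g)"
  interpret koszul_contraction scale "\<lambda>x ws. kos_nf q (P * vec_diff x) ws" q
    by (rule contraction_kos_nf)
  have H: "flin ?H"
    by (intro flin_intros)
  have kill: "?H r = 0" if r: "r \<in> alt_rels (Vmod scale) (Suc q)" for r
  proof -
    consider "r \<in> multilin_rels (Vmod scale) (Suc q)" | ws where "r = pt ws" "length ws = Suc q" "\<not> distinct ws"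
      using r by (auto simp: alt_rels_def)
    then show ?thesis
    proof cases
      case 1
      show ?thesis
        by (rule flin_multilin_rels_0[OF H _ _ 1])
          (simp_all add: P nf_kos_contract contraction_add contraction_scale Vmod_add Vmod_smult)
    next
      case 2
      then show ?thesis
        by (simp add: P nf_kos_contract contraction_alternating)
    qed
  qed
  have "?H (g - g') = 0"
    using assms(1) by (intro flin_span_0[OF H kill]) (simp_all add: rel_coset_eq_iff)
  then show ?thesis
    by (simp add: flin_diff[OF H])
qed

definition wedge_rep :: "nat \<Rightarrow> ('v list \<Rightarrow>\<^sub>0 'k) set \<Rightarrow> ('v list \<Rightarrow>\<^sub>0 'k)" where
  "wedge_rep p w = (SOME g. supp g \<subseteq> words p \<and>
    rel_coset (alt_rels (Vmod scale) p) g = w)"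

lemma wedge_rep:
  assumes "w \<in> carrier (W p)"
  shows "supp (wedge_rep p w) \<subseteq> words p"
    and "rel_coset (alt_rels (Vmod scale) p) (wedge_rep p w) = w"
proof -
  have "\<exists>g. supp g \<subseteq> words p \<and> rel_coset (alt_rels (Vmod scale) p) g = w"
    using presented_group.carrierE[OF presented_W assms] by metis
  from someI_ex[OF this] show "supp (wedge_rep p w) \<subseteq> words p"
    "rel_coset (alt_rels (Vmod scale) p) (wedge_rep p w) = w"
    by (simp_all add: wedge_rep_def)
qed

text \<open>The elements of the exterior power are cosets. A representative with the right number
  of vectors is chosen for each of them; modulo the relations the result does not depend on
  the choice.\<close>

definition kos_lift where
  "kos_lift q = lext (\<lambda>(u, w). lext (kos_contract u) (wedge_rep (Suc q) w))"

lemma flin_kos_lift: "flin (kos_lift q)"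
  by (simp add: kos_lift_def flin_lext)

lemma flin_nf_lext_kos_contract:
  assumes g: "supp g \<subseteq> words (Suc q)"
  shows "flin (\<lambda>P. nf (K_rels q) (lext (kos_contract (env_elt P)) g))"
proof -
  have "flin (\<lambda>P. fscale c (contraction (\<lambda>x ws. kos_nf q (P * vec_diff x) ws) ws))"
    if "ws \<in> supp g" for ws c
  proof -
    have "length ws = Suc q" using that g by auto
    then show ?thesis
      unfolding contraction_def
      by (intro flin_fscale flin_sum_fun flin_comp[OF flin_kos_nf flin_times_left]) (simp add: length_del)
  qed
  then show ?thesis
    unfolding flin_lext_commute[OF flin_nf] nf_kos_contract unfolding lext_def by (intro flin_sum_fun)
qed

text \<open>The second of two descents, from pairs of an element of \<open>S(V)\<^sup>e\<close> and an element of the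
  exterior power to their tensor product. Additivity in the exterior factor holds because
  the sum of chosen representatives is a representative of the sum.\<close>

lemma kos_lift_cong:
  assumes "rel_coset (K_rels (Suc q)) f = rel_coset (K_rels (Suc q)) f'"
  shows "rel_coset (K_rels q) (kos_lift q f) = rel_coset (K_rels q) (kos_lift q f')"
proof -
  let ?N = "nf (K_rels q)" and ?R = "alt_rels (Vmod scale) (Suc q)"
  let ?H = "\<lambda>f. ?N (kos_lift q f)"
  interpret W: presented_group "W (Suc q)" "words (Suc q)" ?R
    by (rule presented_W)
  have H: "flin ?H"
    by (rule flin_comp[OF flin_nf flin_kos_lift])
  have H_pt: "?H (pt (u, w)) = ?N (lext (kos_contract u) (wedge_rep (Suc q) w))" for u w
    by (simp add: kos_lift_def)
  have kill: "?H r = 0" if "r \<in> K_rels (Suc q)" for r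
  proof (rule flin_bilin_rels_0[OF H _ _ _ _ that])
    fix u u' w w' c
    assume u: "u \<in> carrier E" and w: "w \<in> carrier (W (Suc q))"
    obtain P where P: "u = env_elt P" using u by (rule Env_carrierE)
    note flinP = flin_nf_lext_kos_contract[OF wedge_rep(1)[OF w]]
    show "?H (pt (c \<odot>\<^bsub>E\<^esub> u, w)) = fscale c (?H (pt (u, w)))"
      by (simp only: H_pt P env_elt_smult flin_scale[OF flinP])
    show "?H (pt (u, c \<odot>\<^bsub>W (Suc q)\<^esub> w)) = fscale c (?H (pt (u, w)))"
    proof -
      have eq: "c \<odot>\<^bsub>W (Suc q)\<^esub> w = rel_coset ?R (fscale c (wedge_rep (Suc q) w))"
        by (subst (1) wedge_rep(2)[OF w, symmetric]) (simp only: W_smult)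
      then have "c \<odot>\<^bsub>W (Suc q)\<^esub> w \<in> carrier (W (Suc q))"
        by (simp only: W.in_carrier order_trans[OF keys_fscale wedge_rep(1)[OF w]])
      from wedge_rep(2)[OF this] have "rel_coset ?R (wedge_rep (Suc q) (c \<odot>\<^bsub>W (Suc q)\<^esub> w)) =
          rel_coset ?R (fscale c (wedge_rep (Suc q) w))"
        by (rule trans[OF _ eq])
      from kos_contract_cong[OF this u] show ?thesis
        by (simp only: H_pt flin_scale[OF flin_lext] flin_scale[OF flin_nf])
    qed
    {
      assume u': "u' \<in> carrier E"
      obtain P' where P': "u' = env_elt P'" using u' by (rule Env_carrierE)
      show "?H (pt (u \<oplus>\<^bsub>E\<^esub> u', w)) = ?H (pt (u, w)) + ?H (pt (u', w))"
        by (simp only: H_pt P P' env_elt_add flin_add[OF flinP])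
    }
    {
      assume w': "w' \<in> carrier (W (Suc q))"
      have "rel_coset ?R (wedge_rep (Suc q) (w \<oplus>\<^bsub>W (Suc q)\<^esub> w')) = w \<oplus>\<^bsub>W (Suc q)\<^esub> w'"
        by (rule wedge_rep(2)[OF W.a_closed[OF w w']])
      also have "\<dots> = rel_coset ?R (wedge_rep (Suc q) w + wedge_rep (Suc q) w')"
        by (simp only: W.add_eq[symmetric] wedge_rep(2)[OF w] wedge_rep(2)[OF w'])
      finally have "rel_coset ?R (wedge_rep (Suc q) (w \<oplus>\<^bsub>W (Suc q)\<^esub> w')) =
          rel_coset ?R (wedge_rep (Suc q) w + wedge_rep (Suc q) w')" .
      from kos_contract_cong[OF this u]
      show "?H (pt (u, w \<oplus>\<^bsub>W (Suc q)\<^esub> w')) = ?H (pt (u, w)) + ?H (pt (u, w'))"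
        by (simp only: H_pt flin_add[OF flin_lext] flin_add[OF flin_nf])
    }
  qed
  have "?H (f - f') = 0"
    using assms by (intro flin_span_0[OF H kill]) (simp_all add: rel_coset_eq_iff)
  then show ?thesis
    by (simp add: flin_diff[OF H] nf_eq_iff[symmetric])
qed

lemma keys_kos_contract:
  assumes "u \<in> carrier E" "length ws = Suc q"
  shows "supp (kos_contract u ws) \<subseteq> kos_gens q"
proof -
  have "(u \<otimes>\<^bsub>E\<^esub> env_elt (vec_diff (ws ! i)), wdg (del i ws)) \<in> kos_gens q"
    if "i < length ws" for i
    using that assms by (auto intro!: Env_mult_closed env_elt_in_Env wdg_in_W simp: length_del)
  then show ?thesis
    unfolding kos_contract_def by (intro keys_sum_subset order_trans[OF keys_fscale]) simp
qed

lemma keys_kos_lift: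
  assumes "supp f \<subseteq> kos_gens (Suc q)"
  shows "supp (kos_lift q f) \<subseteq> kos_gens q"
  unfolding kos_lift_def
proof (rule keys_lext)
  fix x assume "x \<in> supp f"
  then obtain u w where x: "x = (u, w)" "u \<in> carrier E" "w \<in> carrier (W (Suc q))"
    using assms by auto
  then have "supp (lext (kos_contract u) (wedge_rep (Suc q) w)) \<subseteq> kos_gens q"
    using wedge_rep(1)[of w] by (intro keys_lext keys_kos_contract) auto
  then show "supp (case x of (u, w) \<Rightarrow> lext (kos_contract u) (wedge_rep (Suc q) w)) \<subseteq>
      kos_gens q"
    by (simp add: x)
qed

lemma kos_contract_env_mult_left:
  assumes "u \<in> carrier E" "u' \<in> carrier E"
  shows "kos_contract (u \<otimes>\<^bsub>E\<^esub> u') ws = env_mult_left u (kos_contract u' ws)"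
  by (simp add: kos_contract_def flin_sum[OF flin_env_mult_left] flin_scale[OF flin_env_mult_left] Env_mult_assoc assms
      env_elt_in_Env del: fscale_single) (simp add: env_mult_left_def)

lemma env_mult_left_pt: "env_mult_left u (pt (u', w)) = pt (u \<otimes>\<^bsub>E\<^esub> u', w)"
  by (simp add: env_mult_left_def)

lemma kos_lift_env_mult_left:
  assumes "supp f \<subseteq> kos_gens (Suc q)" "u \<in> carrier E"
  shows "kos_lift q (env_mult_left u f) = env_mult_left u (kos_lift q f)"
proof (rule flin_eqI[where f = f, OF flin_comp[OF flin_kos_lift flin_env_mult_left] flin_comp[OF flin_env_mult_left flin_kos_lift]])
  fix x assume "x \<in> supp f"
  then obtain u' w where x: "x = (u', w)" and u': "u' \<in> carrier E"
    using assms by auto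
  have "lext (kos_contract (u \<otimes>\<^bsub>E\<^esub> u')) g = lext (\<lambda>ws. env_mult_left u (kos_contract u' ws)) g" for g
    by (intro arg_cong[where f = "\<lambda>h. lext h g"] ext kos_contract_env_mult_left assms(2) u')
  then have "kos_lift q (env_mult_left u (pt x)) = lext (\<lambda>ws. env_mult_left u (kos_contract u' ws)) (wedge_rep (Suc q) w)"
    by (simp add: x kos_lift_def env_mult_left_pt)
  also have "\<dots> = env_mult_left u (kos_lift q (pt x))"
    by (simp add: x kos_lift_def flin_lext_commute[OF flin_env_mult_left])
  finally show "kos_lift q (env_mult_left u (pt x)) = env_mult_left u (kos_lift q (pt x))" .
qed

lemma keys_env_mult_left:
  assumes "supp f \<subseteq> kos_gens p" "u \<in> carrier E"
  shows "supp (env_mult_left u f) \<subseteq> kos_gens p"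
  unfolding env_mult_left_def using assms by (intro keys_lin_ext) (auto simp: Env_mult_closed)

lemma kos_diff_map_exists:
  obtains f where "f \<in> lin_maps E (Kos scale (Suc q)) (Kos scale q)"
    and "\<And>u ws. u \<in> carrier E \<Longrightarrow> length ws = Suc q \<Longrightarrow>
      f (kos_tens scale u ws) = rel_coset (K_rels q) (kos_contract u ws)"
    and "\<And>h. supp h \<subseteq> kos_gens (Suc q) \<Longrightarrow>
      f (rel_coset (K_rels (Suc q)) h) = rel_coset (K_rels q) (kos_lift q h)"
proof
  let ?f = "\<lambda>A\<in>carrier (Kos scale (Suc q)). rel_coset (K_rels q) (kos_lift q (SOME h. h \<in> A))"
  interpret K: presented_group "Kos scale (Suc q)" "kos_gens (Suc q)" "K_rels (Suc q)"
    by (rule presented_Kos)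
  interpret K': presented_group "Kos scale q" "kos_gens q" "K_rels q"
    by (rule presented_Kos)
  show f: "?f (rel_coset (K_rels (Suc q)) h) = rel_coset (K_rels q) (kos_lift q h)"
    if "supp h \<subseteq> kos_gens (Suc q)" for h
  proof -
    have "(SOME h'. h' \<in> rel_coset (K_rels (Suc q)) h) \<in> rel_coset (K_rels (Suc q)) h"
      by (rule someI[of _ h]) simp
    then have "rel_coset (K_rels q) (kos_lift q (SOME h'. h' \<in> rel_coset (K_rels (Suc q)) h)) =
        rel_coset (K_rels q) (kos_lift q h)"
      by (intro kos_lift_cong) (simp only: mem_rel_coset_iff)
    then show ?thesis
      by (simp only: restrict_apply'[OF K.in_carrier[OF that]])
  qed
  show "?f (kos_tens scale u ws) = rel_coset (K_rels q) (kos_contract u ws)"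
    if u: "u \<in> carrier E" and ws: "length ws = Suc q" for u ws
  proof -
    have "rel_coset (alt_rels (Vmod scale) (Suc q)) (wedge_rep (Suc q) (wdg ws)) =
        rel_coset (alt_rels (Vmod scale) (Suc q)) (pt ws)"
      using wedge_rep(2)[OF wdg_in_W[OF ws]] ws by (simp add: wedge_def)
    from kos_contract_cong[OF this u]
    have eq: "rel_coset (K_rels q) (kos_lift q (pt (u, wdg ws))) = rel_coset (K_rels q) (kos_contract u ws)"
      by (simp add: nf_eq_iff kos_lift_def)
    have keys: "supp (pt (u, wdg ws)) \<subseteq> kos_gens (Suc q)"
      using u wdg_in_W[OF ws] by simp
    show ?thesis
      unfolding kos_tens_eq[OF ws] f[OF keys] by (rule eq)
  qed
  have in_K': "?f A \<in> carrier (Kos scale q)" if "A \<in> carrier (Kos scale (Suc q))" for A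
    using that by (elim K.carrierE) (simp only: f K'.in_carrier keys_kos_lift)
  have additive: "?f (A \<oplus>\<^bsub>Kos scale (Suc q)\<^esub> B) = ?f A \<oplus>\<^bsub>Kos scale q\<^esub> ?f B"
    if "A \<in> carrier (Kos scale (Suc q))" "B \<in> carrier (Kos scale (Suc q))" for A B
    using that
    by (elim K.carrierE) (simp only: K.add_eq f K.keys_plus_subset K'.add_eq flin_add[OF flin_kos_lift])
  have homog: "?f (u \<odot>\<^bsub>Kos scale (Suc q)\<^esub> A) = u \<odot>\<^bsub>Kos scale q\<^esub> ?f A"
    if "u \<in> carrier E" "A \<in> carrier (Kos scale (Suc q))" for u A
    using that by (elim K.carrierE) (simp only: Kos_smult f keys_env_mult_left kos_lift_env_mult_left)
  show "?f \<in> lin_maps E (Kos scale (Suc q)) (Kos scale q)"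
    unfolding lin_maps_def
    by (intro CollectI conjI ballI PiE_I; (rule in_K' additive homog; assumption | simp))
qed

lemma Env_one_in_Env: "\<one>\<^bsub>E\<^esub> \<in> carrier E"
  by (simp add: env_elt_in_Env flip: env_elt_1)

lemma Env_smult_closed: "u \<in> carrier E \<Longrightarrow> c \<odot>\<^bsub>E\<^esub> u \<in> carrier E"
  by (auto elim!: Env_carrierE simp: env_elt_smult env_elt_in_Env)

lemma Env_mult_one: "u \<in> carrier E \<Longrightarrow> u \<otimes>\<^bsub>E\<^esub> \<one>\<^bsub>E\<^esub> = u"
  by (auto elim!: Env_carrierE simp: env_elt_mult simp flip: env_elt_1)

text \<open>By bilinearity the module is generated, as a group, by tensors of arbitrary elements \<open>u\<close>
  with wedges of vectors, and these are the multiples by \<open>u\<close> of the tensors with first factor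
  \<open>1\<close>.\<close>

lemma kos_map_eqI:
  assumes f: "f \<in> lin_maps E (Kos scale p) N" and g: "g \<in> lin_maps E (Kos scale p) N"
    and eq: "\<And>ws. length ws = p \<Longrightarrow> f (kos_tens scale \<one>\<^bsub>E\<^esub> ws) = g (kos_tens scale \<one>\<^bsub>E\<^esub> ws)"
  shows "f = g"
proof -
  interpret K: presented_group "Kos scale p" "kos_gens p" "K_rels p"
    by (rule presented_Kos)
  interpret W: presented_group "W p" "words p" "alt_rels (Vmod scale) p"
    by (rule presented_W)
  let ?K = "rel_coset (K_rels p)" and ?W = "rel_coset (alt_rels (Vmod scale) p)"
  have eq_add: "f (?K (h + h')) = g (?K (h + h'))"
    if "supp h \<subseteq> kos_gens p" "supp h' \<subseteq> kos_gens p"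
      "f (?K h) = g (?K h)" "f (?K h') = g (?K h')" for h h'
  proof -
    have push: "F (?K (h + h')) = F (?K h) \<oplus>\<^bsub>N\<^esub> F (?K h')" if "F \<in> lin_maps E (Kos scale p) N" for F
      using that K.in_carrier[OF \<open>supp h \<subseteq> _\<close>] K.in_carrier[OF \<open>supp h' \<subseteq> _\<close>]
      unfolding K.add_eq[symmetric] lin_maps_def by blast
    show ?thesis
      unfolding push[OF f] push[OF g] that(3,4) ..
  qed
  have eq_gen: "f (?K (pt (u, wdg ws))) = g (?K (pt (u, wdg ws)))"
    if u: "u \<in> carrier E" and ws: "length ws = p" for u ws
  proof -
    have "kos_tens scale \<one>\<^bsub>E\<^esub> ws \<in> carrier (Kos scale p)"
      unfolding kos_tens_eq[OF ws] using Env_one_in_Env wdg_in_W[OF ws] by (intro K.in_carrier) simp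
    then have push: "F (u \<odot>\<^bsub>Kos scale p\<^esub> kos_tens scale \<one>\<^bsub>E\<^esub> ws) = u \<odot>\<^bsub>N\<^esub> F (kos_tens scale \<one>\<^bsub>E\<^esub> ws)"
      if "F \<in> lin_maps E (Kos scale p) N" for F
      using that u unfolding lin_maps_def by blast
    have "?K (pt (u, wdg ws)) = u \<odot>\<^bsub>Kos scale p\<^esub> kos_tens scale \<one>\<^bsub>E\<^esub> ws"
      by (simp only: kos_tens_eq[OF ws] Kos_smult_pt[OF u] Env_mult_one[OF u])
    then show ?thesis
      by (simp only: push[OF f] push[OF g] eq[OF ws])
  qed
  have eq_0: "f (?K 0) = g (?K 0)"
  proof -
    \<comment> \<open>Zero is the tensor of the zero of the enveloping algebra with an arbitrary wedge.\<close>
    have len: "length (replicate p (0::'v)) = p" by simp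
    have "nf (K_rels p) (pt (env_elt 0, wdg (replicate p 0))) = nf (K_rels p) 0"
      using flin_0[OF flin_kos_nf[OF len]] by (simp add: kos_nf_def flin_0[OF flin_nf])
    then have "?K 0 = ?K (pt (env_elt 0, wdg (replicate p 0)))"
      by (simp only: nf_eq_iff)
    then show ?thesis
      by (simp only: eq_gen[OF env_elt_in_Env len])
  qed
  have eq_wedges: "f (?K (pt (u, ?W (\<Sum>ws\<in>L. fscale (c ws) (pt ws))))) =
      g (?K (pt (u, ?W (\<Sum>ws\<in>L. fscale (c ws) (pt ws)))))"
    if "finite L" "L \<subseteq> words p" and u: "u \<in> carrier E" for L c u
    using that(1,2)
  proof (induction L rule: finite_induct)
    case empty
    have "?K (pt (u, ?W 0)) = ?K 0"
      using nf_zero_right[OF u, of p]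
      by (simp only: nf_eq_iff[symmetric] flin_0[OF flin_nf] W.zero_eq)
    then show ?case by (simp add: eq_0)
  next
    case (insert ws L)
    then have ws: "length ws = p" by simp
    let ?w = "?W (\<Sum>ws\<in>L. fscale (c ws) (pt ws))"
    have w: "?w \<in> carrier (W p)" and w1: "?W (fscale (c ws) (pt ws)) \<in> carrier (W p)"
      using insert.prems by (intro W.in_carrier keys_sum_subset order_trans[OF keys_fscale]; force)+
    have "?W (fscale (c ws) (pt ws)) = c ws \<odot>\<^bsub>W p\<^esub> wdg ws"
      using ws by (simp only: wedge_def W_smult)
    then have "?K (pt (u, ?W (fscale (c ws) (pt ws)))) = ?K (pt (c ws \<odot>\<^bsub>E\<^esub> u, wdg ws))"
      using u wdg_in_W[OF ws]
      by (simp only: nf_eq_iff[symmetric] nf_bilin_scale_left nf_bilin_scale_right)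
    then have eq_ws: "f (?K (pt (u, ?W (fscale (c ws) (pt ws))))) = g (?K (pt (u, ?W (fscale (c ws) (pt ws)))))"
      by (simp only: eq_gen[OF Env_smult_closed[OF u] ws])
    have "?K (pt (u, ?W (fscale (c ws) (pt ws)) \<oplus>\<^bsub>W p\<^esub> ?w)) =
        ?K (pt (u, ?W (fscale (c ws) (pt ws))) + pt (u, ?w))"
      using u w w1 by (simp only: nf_eq_iff[symmetric] nf_bilin_add_right flin_add[OF flin_nf])
    moreover have "f (?K (pt (u, ?W (fscale (c ws) (pt ws))) + pt (u, ?w))) =
        g (?K (pt (u, ?W (fscale (c ws) (pt ws))) + pt (u, ?w)))"
      using u w w1 insert by (intro eq_add eq_ws) simp_all
    ultimately show ?case
      by (simp only: sum.insert[OF insert.hyps] W.add_eq)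
  qed
  have eq_pt: "f (?K (pt (u, w))) = g (?K (pt (u, w)))" if "u \<in> carrier E" "w \<in> carrier (W p)" for u w
    using eq_wedges[OF finite_keys wedge_rep(1)[OF that(2)] that(1), of "Poly_Mapping.lookup (wedge_rep p w)"]
    unfolding poly_mapping_expand[of "wedge_rep p w", symmetric] wedge_rep(2)[OF that(2)] .
  have eq_sum: "f (?K (\<Sum>x\<in>L. fscale (c x) (pt x))) = g (?K (\<Sum>x\<in>L. fscale (c x) (pt x)))"
    if "finite L" "L \<subseteq> kos_gens p" for L c
    using that
  proof (induction L rule: finite_induct)
    case empty
    show ?case by (simp add: eq_0)
  next
    case (insert x L)
    then obtain u w where x: "x = (u, w)" and u: "u \<in> carrier E" and w: "w \<in> carrier (W p)"
      by auto
    have "?K (fscale (c x) (pt x)) = ?K (pt (c x \<odot>\<^bsub>E\<^esub> u, w))"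
      using u w by (simp only: x nf_eq_iff[symmetric] nf_bilin_scale_left flin_scale[OF flin_nf])
    then have eq_x: "f (?K (fscale (c x) (pt x))) = g (?K (fscale (c x) (pt x)))"
      by (simp only: eq_pt[OF Env_smult_closed[OF u] w])
    show ?case
      unfolding sum.insert[OF insert.hyps]
    proof (rule eq_add[OF _ _ eq_x])
      show "supp (fscale (c x) (pt x)) \<subseteq> kos_gens p"
        "supp (\<Sum>x\<in>L. fscale (c x) (pt x)) \<subseteq> kos_gens p"
        using insert.prems by (intro keys_sum_subset order_trans[OF keys_fscale]; force)+
    qed (use insert in blast)
  qed
  have "f A = g A" if A: "A \<in> carrier (Kos scale p)" for A
  proof -
    obtain h where h: "A = ?K h" "supp h \<subseteq> kos_gens p"
      using A by (rule K.carrierE)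
    show ?thesis
      using eq_sum[OF finite_keys h(2), of "Poly_Mapping.lookup h"]
      unfolding h(1) poly_mapping_expand[of h, symmetric] .
  qed
  with f g show ?thesis
    by (rule lin_maps_eqI)
qed

lemma single_0_times: "Poly_Mapping.single 0 c * f = fscale c f"
  for f :: "'x::comm_monoid_add \<Rightarrow>\<^sub>0 'k"
  by (simp add: fscale_def mult_map_scale_conv_mult)

text \<open>The map obtained by descent satisfies the prescription of the differential, whose
  indices start at \<open>1\<close>; since \<open>kos_map_eqI\<close> leaves no other map, it is the differential.\<close>

lemma
  shows kos_d_kos_tens: "u \<in> carrier E \<Longrightarrow> length ws = Suc q \<Longrightarrow>
      kos_d scale (Suc q) (kos_tens scale u ws) = rel_coset (K_rels q) (kos_contract u ws)"
    and kos_d_rel_coset: "supp h \<subseteq> kos_gens (Suc q) \<Longrightarrow>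
      kos_d scale (Suc q) (rel_coset (K_rels (Suc q)) h) = rel_coset (K_rels q) (kos_lift q h)"
proof -
  interpret K': presented_group "Kos scale q" "kos_gens q" "K_rels q"
    by (rule presented_Kos)
  let ?term = "\<lambda>ws i. ((\<ominus>\<^bsub>E\<^esub> \<one>\<^bsub>E\<^esub>) [^]\<^bsub>E\<^esub> (i + 1)) \<odot>\<^bsub>Kos scale q\<^esub>
    kos_tens scale (tens S [sym_inc scale (ws ! (i - 1)), \<one>\<^bsub>S\<^esub>] \<ominus>\<^bsub>E\<^esub>
      tens S [\<one>\<^bsub>S\<^esub>, sym_inc scale (ws ! (i - 1))]) (take (i - 1) ws @ drop i ws)"
  obtain f where f: "f \<in> lin_maps E (Kos scale (Suc q)) (Kos scale q)"
    and f_tens: "\<And>u ws. u \<in> carrier E \<Longrightarrow> length ws = Suc q \<Longrightarrow>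
      f (kos_tens scale u ws) = rel_coset (K_rels q) (kos_contract u ws)"
    and f_coset: "\<And>h. supp h \<subseteq> kos_gens (Suc q) \<Longrightarrow>
      f (rel_coset (K_rels (Suc q)) h) = rel_coset (K_rels q) (kos_lift q h)"
    by (rule kos_diff_map_exists) blast
  have f_one: "f (kos_tens scale \<one>\<^bsub>E\<^esub> ws) = (\<Oplus>\<^bsub>Kos scale q\<^esub>i\<in>{1..Suc q}. ?term ws i)"
    if ws: "length ws = Suc q" for ws
  proof -
    let ?g = "\<lambda>i. pt (env_elt ((- 1) ^ (i + 1) * vec_diff (ws ! (i - 1))), wdg (del (i - 1) ws))"
    have len: "length (del (i - 1) ws) = q" if "i \<in> {1..Suc q}" for i
      using that ws by (cases i) (auto simp: length_del)
    have keys: "supp (?g i) \<subseteq> kos_gens q" if "i \<in> {1..Suc q}" for i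
      using len[OF that] by (simp add: env_elt_in_Env wdg_in_W)
    have "?term ws i = rel_coset (K_rels q) (?g i)" if i: "i \<in> {1..Suc q}" for i
    proof -
      have "take (i - 1) ws @ drop i ws = del (i - 1) ws"
        using i by (simp add: del_def)
      then show ?thesis
        by (simp only: Env_minus_one_power env_elt_vec_diff kos_tens_eq[OF len[OF i]]
            Kos_smult_pt[OF env_elt_in_Env] env_elt_mult)
    qed
    then have "(\<Oplus>\<^bsub>Kos scale q\<^esub>i\<in>{1..Suc q}. ?term ws i) =
        (\<Oplus>\<^bsub>Kos scale q\<^esub>i\<in>{1..Suc q}. rel_coset (K_rels q) (?g i))"
      by (intro K'.finsum_cong') (auto intro!: K'.in_carrier keys)
    also have "\<dots> = rel_coset (K_rels q) (\<Sum>i\<in>{1..Suc q}. ?g i)"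
      by (rule K'.finsum_eq[OF _ keys]) simp
    also have "(\<Sum>i\<in>{1..Suc q}. ?g i) = (\<Sum>i<Suc q. ?g (Suc i))"
      unfolding One_nat_def by (rule sum.atLeast1_atMost_eq)
    also have "nf (K_rels q) (\<Sum>i<Suc q. ?g (Suc i)) = nf (K_rels q) (kos_contract (env_elt 1) ws)"
    proof -
      have "nf (K_rels q) (?g (Suc i)) = fscale ((- 1) ^ i) (kos_nf q (1 * vec_diff (ws ! i)) (del i ws))"
        if "i < Suc q" for i
      proof -
        have "nf (K_rels q) (?g (Suc i)) = kos_nf q (fscale ((- 1) ^ i) (vec_diff (ws ! i))) (del i ws)"
          by (simp add: kos_nf_def minus_one_power single_0_times One_nat_def)
        then show ?thesis
          using that ws by (simp add: flin_scale[OF flin_kos_nf] length_del)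
      qed
      then show ?thesis
        by (simp add: nf_kos_contract contraction_def flin_sum[OF flin_nf] ws del: sum.lessThan_Suc)
    qed
    then have "rel_coset (K_rels q) (\<Sum>i<Suc q. ?g (Suc i)) = rel_coset (K_rels q) (kos_contract (env_elt 1) ws)"
      by (simp only: nf_eq_iff)
    also have "\<dots> = f (kos_tens scale \<one>\<^bsub>E\<^esub> ws)"
      by (simp only: env_elt_1 f_tens[OF Env_one_in_Env ws])
    finally show ?thesis ..
  qed
  have "kos_d scale (Suc q) = f"
    unfolding kos_d_def Let_def diff_Suc_1
  proof (rule the_equality)
    show "f \<in> lin_maps E (Kos scale (Suc q)) (Kos scale q) \<and> (\<forall>ws. length ws = Suc q \<longrightarrow>
        f (kos_tens scale \<one>\<^bsub>E\<^esub> ws) = (\<Oplus>\<^bsub>Kos scale q\<^esub>i\<in>{1..Suc q}. ?term ws i))"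
      using f f_one by blast
    fix g assume g: "g \<in> lin_maps E (Kos scale (Suc q)) (Kos scale q) \<and> (\<forall>ws. length ws = Suc q \<longrightarrow>
        g (kos_tens scale \<one>\<^bsub>E\<^esub> ws) = (\<Oplus>\<^bsub>Kos scale q\<^esub>i\<in>{1..Suc q}. ?term ws i))"
    show "g = f"
      by (rule kos_map_eqI[OF _ f]) (use g f_one in auto)
  qed
  then show "u \<in> carrier E \<Longrightarrow> length ws = Suc q \<Longrightarrow>
      kos_d scale (Suc q) (kos_tens scale u ws) = rel_coset (K_rels q) (kos_contract u ws)"
    "supp h \<subseteq> kos_gens (Suc q) \<Longrightarrow>
      kos_d scale (Suc q) (rel_coset (K_rels (Suc q)) h) = rel_coset (K_rels q) (kos_lift q h)"
    using f_tens f_coset by simp_all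
qed

definition kos_rep where
  "kos_rep = lin_ext (\<lambda>(x, is). (env_elt (pt x), wdg (map v is)))"

text \<open>The element of the Koszul module with given coordinates: polynomials in \<open>x\<close> and \<open>y\<close> with a
  list of basis indices in place of a wedge product.\<close>

definition kos_elt :: "nat \<Rightarrow> 'k kpoly \<Rightarrow> ('k, 'v) kos" where
  "kos_elt p w = rel_coset (K_rels p) (kos_rep w)"

lemma flin_kos_rep: "flin kos_rep"
  by (simp add: kos_rep_def flin_lin_ext)

lemma keys_kos_rep:
  assumes "supp w \<subseteq> kpoly_degree p"
  shows "supp (kos_rep w) \<subseteq> kos_gens p"
  unfolding kos_rep_def using assms by (intro keys_lin_ext) (auto simp: env_elt_in_Env wdg_in_W)

lemma kos_elt_in_Kos: "supp w \<subseteq> kpoly_degree p \<Longrightarrow> kos_elt p w \<in> carrier (Kos scale p)"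
  unfolding kos_elt_def by (intro presented_group.in_carrier[OF presented_Kos] keys_kos_rep)

lemma kos_elt_add: "kos_elt p w \<oplus>\<^bsub>Kos scale p\<^esub> kos_elt p w' = kos_elt p (w + w')"
  by (simp only: kos_elt_def presented_group.add_eq[OF presented_Kos] flin_add[OF flin_kos_rep])

lemma kos_elt_finsum:
  assumes "finite A" "\<And>i. i \<in> A \<Longrightarrow> supp (F i) \<subseteq> kpoly_degree p"
  shows "(\<Oplus>\<^bsub>Kos scale p\<^esub>i\<in>A. kos_elt p (F i)) = kos_elt p (\<Sum>i\<in>A. F i)"
  unfolding kos_elt_def flin_sum[OF flin_kos_rep]
  by (rule presented_group.finsum_eq[OF presented_Kos assms(1)]) (use assms keys_kos_rep in blast)

lemma nf_kos_rep_kos_act: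
  assumes "length is = p"
  shows "nf (K_rels p) (kos_rep (kos_act P (pt (x, is)))) = kos_nf p (P * pt x) (map v is)"
proof (rule flin_eqI[where f = P and G = "\<lambda>P. nf (K_rels p) (kos_rep (kos_act P (pt (x, is))))"])
  show "flin (\<lambda>P. nf (K_rels p) (kos_rep (kos_act P (pt (x, is)))))"
    by (rule flin_comp[OF flin_nf flin_comp[OF flin_kos_rep flin_kos_act_left[OF flin_id]]])
  show "flin (\<lambda>P. kos_nf p (P * pt x) (map v is))"
    using assms by (intro flin_comp[OF flin_kos_nf flin_times_left]) simp
qed (simp add: kos_act_pt kos_rep_def kos_nf_def mult_single)

lemma kos_elt_smult:
  assumes "supp w \<subseteq> kpoly_degree p"
  shows "env_elt P \<odot>\<^bsub>Kos scale p\<^esub> kos_elt p w = kos_elt p (kos_act P w)"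
proof -
  have "nf (K_rels p) (env_mult_left (env_elt P) (kos_rep w)) = nf (K_rels p) (kos_rep (kos_act P w))"
  proof (rule flin_eqI[where f = w])
    show "flin (\<lambda>w. nf (K_rels p) (env_mult_left (env_elt P) (kos_rep w)))"
      by (intro flin_nf_comp flin_comp[OF flin_env_mult_left flin_kos_rep])
    show "flin (\<lambda>w. nf (K_rels p) (kos_rep (kos_act P w)))"
      by (rule flin_nf_comp[OF flin_comp[OF flin_kos_rep flin_kos_act_right[OF flin_id]]])
    fix y assume "y \<in> supp w"
    then obtain x "is" where y: "y = (x, is)" "length is = p" using assms by auto
    then show "nf (K_rels p) (env_mult_left (env_elt P) (kos_rep (pt y))) = nf (K_rels p) (kos_rep (kos_act P (pt y)))"
      by (simp add: nf_kos_rep_kos_act) (simp add: kos_rep_def env_mult_left_def env_elt_mult kos_nf_def)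
  qed
  then show ?thesis
    by (simp add: kos_elt_def Kos_smult[OF env_elt_in_Env] nf_eq_iff)
qed

lemma kos_elt_kos_act:
  assumes "length is = p"
  shows "kos_tens scale (env_elt P) (map v is) = kos_elt p (kos_act P (pt (0, is)))"
proof -
  have "nf (K_rels p) (pt (env_elt P, wdg (map v is))) = nf (K_rels p) (kos_rep (kos_act P (pt (0, is))))"
    using assms by (simp add: nf_kos_rep_kos_act) (simp add: kos_nf_def)
  then show ?thesis
    using assms by (simp add: kos_tens_eq[of _ p] kos_elt_def nf_eq_iff)
qed

lemma vec_diff_basis: "m \<in> {1..n} \<Longrightarrow> vec_diff (v m) = var_diff m"
  by (simp add: vec_diff_def var_diff_def vec_poly_basis)

text \<open>On basis vectors the linear form \<open>vec_diff\<close> is the difference of two variables, so the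
  contraction is the formula that defines \<open>kos_diff\<close>.\<close>

lemma kos_d_kos_elt:
  assumes w: "supp w \<subseteq> {(x, is). length is = Suc q \<and> set is \<subseteq> {1..n}}"
  shows "kos_d scale (Suc q) (kos_elt (Suc q) w) = kos_elt q (kos_diff w)"
proof -
  have "nf (K_rels q) (kos_lift q (kos_rep w)) = nf (K_rels q) (kos_rep (kos_diff w))"
  proof (rule flin_eqI[where f = w])
    show "flin (\<lambda>w. nf (K_rels q) (kos_lift q (kos_rep w)))"
      "flin (\<lambda>w. nf (K_rels q) (kos_rep (kos_diff w)))"
      by (intro flin_nf_comp flin_comp[OF flin_kos_lift flin_kos_rep] flin_comp[OF flin_kos_rep flin_kos_diff])+
    fix y assume "y \<in> supp w"
    then obtain x "is" where y: "y = (x, is)" and len: "length is = Suc q" and sub: "set is \<subseteq> {1..n}"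
      using w by auto
    have len': "length (map v is) = Suc q" using len by simp
    have keys: "supp (pt (env_elt (pt x), wdg (map v is))) \<subseteq> kos_gens (Suc q)"
      by (simp add: env_elt_in_Env wdg_in_W[OF len'])
    have "rel_coset (K_rels q) (kos_lift q (pt (env_elt (pt x), wdg (map v is)))) =
        rel_coset (K_rels q) (kos_contract (env_elt (pt x)) (map v is))"
      by (simp only: kos_d_rel_coset[OF keys, symmetric] kos_tens_eq[OF len', symmetric]
          kos_d_kos_tens[OF env_elt_in_Env len'])
    then have "nf (K_rels q) (kos_lift q (kos_rep (pt y))) =
        contraction (\<lambda>x' ws. kos_nf q (pt x * vec_diff x') ws) (map v is)"
      by (simp add: y kos_rep_def nf_eq_iff[symmetric] nf_kos_contract)
    also have "\<dots> = (\<Sum>r<length is. fscale ((- 1) ^ r)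
        (nf (K_rels q) (kos_rep (kos_act (var_diff (is ! r)) (pt (x, del r is))))))"
      unfolding contraction_def length_map
    proof (intro sum.cong refl arg_cong[where f = "fscale _"])
      fix r assume "r \<in> {..<length is}"
      then have r: "r < length is" by simp
      then have "is ! r \<in> {1..n}" using sub nth_mem by blast
      then show "kos_nf q (pt x * vec_diff (map v is ! r)) (del r (map v is)) =
          nf (K_rels q) (kos_rep (kos_act (var_diff (is ! r)) (pt (x, del r is))))"
        using r len by (simp add: nf_kos_rep_kos_act length_del vec_diff_basis map_del mult.commute)
    qed
    also have "\<dots> = nf (K_rels q) (kos_rep (kos_diff (pt y)))"
      by (simp add: y kos_diff_def flin_sum[OF flin_kos_rep] flin_scale[OF flin_kos_rep] flin_sum[OF flin_nf]
          flin_scale[OF flin_nf])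
    finally show "nf (K_rels q) (kos_lift q (kos_rep (pt y))) = nf (K_rels q) (kos_rep (kos_diff (pt y)))" .
  qed
  moreover have "supp (kos_rep w) \<subseteq> kos_gens (Suc q)"
    using w by (intro keys_kos_rep) auto
  ultimately show ?thesis
    by (simp add: kos_elt_def kos_d_rel_coset nf_eq_iff)
qed

end

section \<open>A chain map on the coordinates\<close>

definition exp_at :: "nat \<Rightarrow> nat \<Rightarrow> nat \<Rightarrow> nat" where
  "exp_at m k = (\<lambda>i. if i = m then k else 0)"

lemma exp_at_add: "exp_at m (a + b) = exp_at m a + exp_at m b"
  by (auto simp: exp_at_def)

lemma unit_exp_eq: "unit_exp m = exp_at m 1"
  by (simp add: unit_exp_def exp_at_def)

lemma exp_at_0: "exp_at m 0 = 0"
  by (auto simp: exp_at_def)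

lemma kos_act_mult: "kos_act (P * P') w = kos_act P (kos_act P' w)"
proof -
  have on_pt: "kos_act (P * P') (pt y) = kos_act P (kos_act P' (pt y))" for y
    by (cases y; rule bilin_eqI[where G = "\<lambda>P P'. kos_act (P * P') (pt y)"];
        (intro flin_kos_act_left flin_kos_act_right flin_intros | simp add: kos_act_pt mult_single add.assoc))
  show ?thesis
    by (rule flin_eqI[where G = "kos_act (P * P')" and H = "\<lambda>w. kos_act P (kos_act P' w)"];
        (intro flin_kos_act_right flin_id | rule on_pt))
qed

lemma kos_act_1: "kos_act 1 w = w"
proof (rule flin_eqI[OF flin_kos_act_right[OF flin_id] flin_id])
  show "kos_act 1 (pt y) = pt y" for y
    using kos_act_pt[of 0] by (cases y) simp
qed

lemma kos_act_add_left: "kos_act (P + P') w = kos_act P w + kos_act P' w"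
  and kos_act_diff_left: "kos_act (P - P') w = kos_act P w - kos_act P' w"
  by (rule flin_add[OF flin_kos_act_left[OF flin_id]] flin_diff[OF flin_kos_act_left[OF flin_id]])+

lemma kos_act_add_right: "kos_act P (w + w') = kos_act P w + kos_act P w'"
  and kos_act_diff_right: "kos_act P (w - w') = kos_act P w - kos_act P w'"
  and kos_act_0_right: "kos_act P 0 = 0"
  and kos_act_scale_right: "kos_act P (fscale c w) = fscale c (kos_act P w)"
  and kos_act_sum_right: "kos_act P (sum F A) = (\<Sum>i\<in>A. kos_act P (F i))"
  by (rule flin_add[OF flin_kos_act_right[OF flin_id]] flin_diff[OF flin_kos_act_right[OF flin_id]]
      flin_0[OF flin_kos_act_right[OF flin_id]] flin_scale[OF flin_kos_act_right[OF flin_id]]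
      flin_sum[OF flin_kos_act_right[OF flin_id]])+

definition lwedge :: "nat \<Rightarrow> 'k::field kpoly \<Rightarrow> 'k kpoly" where
  "lwedge m = lin_ext (\<lambda>(p, is). (p, m # is))"

lemma flin_lwedge: "flin (lwedge m)"
  by (simp add: lwedge_def flin_lin_ext)

lemma lwedge_pt: "lwedge m (pt (p, is)) = pt (p, m # is)"
  by (simp add: lwedge_def)

lemma lwedge_kos_act: "lwedge m (kos_act P w) = kos_act P (lwedge m w)"
proof (rule bilin_eqI[where G = "\<lambda>P w. lwedge m (kos_act P w)"])
  show "flin (\<lambda>P. lwedge m (kos_act P w))" "flin (\<lambda>P. kos_act P (lwedge m w))"
    "flin (\<lambda>w. lwedge m (kos_act (pt x) w))" "flin (\<lambda>w. kos_act (pt x) (lwedge m w))" for x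
    by (intro flin_comp[OF flin_lwedge] flin_kos_act_left flin_kos_act_right flin_id flin_lwedge)+
  show "lwedge m (kos_act (pt x) (pt y)) = kos_act (pt x) (lwedge m (pt y))" for x y
    by (cases y) (simp add: kos_act_pt lwedge_pt)
qed

lemma kos_diff_pt: "kos_diff (pt (p, is)) =
    (\<Sum>r<length is. fscale ((- 1) ^ r) (kos_act (var_diff (is ! r)) (pt (p, del r is))))"
  by (simp add: kos_diff_def)

lemma kos_diff_kos_act:
  fixes P :: "'k::field epoly"
  shows "kos_diff (kos_act P w) = kos_act P (kos_diff w)"
proof (rule bilin_eqI[where G = "\<lambda>P w. kos_diff (kos_act P w)"])
  show "flin (\<lambda>P. kos_diff (kos_act P w))" "flin (\<lambda>P. kos_act P (kos_diff w))"
    "flin (\<lambda>w. kos_diff (kos_act (pt x) w))" "flin (\<lambda>w. kos_act (pt x) (kos_diff w))" for x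
    by (intro flin_comp[OF flin_kos_diff] flin_kos_act_left flin_kos_act_right flin_id flin_kos_diff)+
  fix x and y :: "((nat \<Rightarrow> nat) \<times> (nat \<Rightarrow> nat)) \<times> nat list"
  obtain p "is" where y: "y = (p, is)" by (cases y)
  have comm: "kos_act (pt x) (kos_act z (pt (p, js))) = kos_act z (pt (x + p, js))" for z :: "'k epoly" and js
  proof -
    have comm: "kos_act (pt x) (kos_act z (pt (p, js))) = kos_act z (kos_act (pt x) (pt (p, js)))"
      by (simp only: kos_act_mult[symmetric] mult.commute)
    then show ?thesis by (simp add: kos_act_pt)
  qed
  show "kos_diff (kos_act (pt x) (pt y)) = kos_act (pt x :: 'k epoly) (kos_diff (pt y))"
    unfolding y kos_act_pt kos_diff_pt kos_act_sum_right kos_act_scale_right comm ..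
qed

lemma kos_diff_lwedge: "kos_diff (lwedge m w) = kos_act (var_diff m) w - lwedge m (kos_diff w)"
proof (rule flin_eqI[OF flin_comp[OF flin_kos_diff flin_lwedge]])
  show "flin (\<lambda>w. kos_act (var_diff m) w - lwedge m (kos_diff w))"
    by (intro flin_minus2 flin_kos_act_right flin_id flin_comp[OF flin_lwedge flin_kos_diff])
  fix y :: "((nat \<Rightarrow> nat) \<times> (nat \<Rightarrow> nat)) \<times> nat list"
  obtain p "is" where y: "y = (p, is)" by (cases y)
  show "kos_diff (lwedge m (pt y)) = kos_act (var_diff m) (pt y) - lwedge m (kos_diff (pt y))"
    by (simp add: y lwedge_pt kos_diff_pt sum.lessThan_Suc_shift del_0_Cons del_Suc_Cons
        flin_sum[OF flin_lwedge] flin_scale[OF flin_lwedge] lwedge_kos_act sum_negf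
        del: sum.lessThan_Suc)
qed

text \<open>The factor \<open>M\<^sub>m(L)\<close> of a variable that is not selected for the wedge product.\<close>

definition mono_fac :: "(nat \<Rightarrow> nat) \<Rightarrow> nat \<Rightarrow> (nat \<Rightarrow> nat) \<Rightarrow> 'k::field epoly" where
  "mono_fac T m L = pt (exp_at m (L m), exp_at m (T m - L m))"

text \<open>The factor \<open>D\<^sub>m(L, L')\<close> of a selected variable, a discrete analogue of the quotient of
  \<open>M\<^sub>m(L') - M\<^sub>m(L)\<close> by \<open>x\<^sub>m - y\<^sub>m\<close>.\<close>

definition diff_fac :: "(nat \<Rightarrow> nat) \<Rightarrow> nat \<Rightarrow> (nat \<Rightarrow> nat) \<Rightarrow> (nat \<Rightarrow> nat) \<Rightarrow> 'k::field epoly" where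
  "diff_fac T m L L' = (\<Sum>x\<in>{L m..<L' m}. pt (exp_at m x, exp_at m (T m - (x + 1))))"

lemma var_diff_mult_diff_fac:
  assumes "L m \<le> L' m" "L' m \<le> T m"
  shows "var_diff m * diff_fac T m L L' = mono_fac T m L' - mono_fac T m L"
proof -
  let ?h = "\<lambda>x. pt (exp_at m x, exp_at m (T m - x)) :: 'a epoly"
  have "var_diff m * pt (exp_at m x, exp_at m (T m - (x + 1))) = ?h (Suc x) - ?h x"
    if "x < T m" for x
  proof -
    have "T m - x = 1 + (T m - (x + 1))" using that by simp
    then have "exp_at m (T m - x) = exp_at m 1 + exp_at m (T m - (x + 1))"
      by (simp only: exp_at_add)
    moreover have "exp_at m (Suc x) = exp_at m 1 + exp_at m x"
      by (simp add: One_nat_def flip: exp_at_add)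
    ultimately show ?thesis
      by (simp add: var_diff_def unit_exp_eq left_diff_distrib mult_single One_nat_def)
  qed
  then have "var_diff m * diff_fac T m L L' = (\<Sum>x\<in>{L m..<L' m}. ?h (Suc x) - ?h x)"
    unfolding diff_fac_def sum_distrib_left using assms by (intro sum.cong) auto
  also have "\<dots> = ?h (L' m) - ?h (L m)"
    using assms(1) by (rule sum_Suc_diff')
  finally show ?thesis by (simp add: mono_fac_def)
qed

lemma diff_fac_concat:
  assumes "L m \<le> L' m" "L' m \<le> L'' m"
  shows "diff_fac T m L L'' = diff_fac T m L L' + diff_fac T m L' L''"
  unfolding diff_fac_def using assms by (simp add: sum.atLeastLessThan_concat)

text \<open>The value of the comparison map on the chain \<open>c\<close>, where only the variables in the list
  are processed. The first variable is either left out of the wedge product, and the chain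
  stays as it is, or selected, and the chain moves on by one member.\<close>

primrec kos_chain :: "(nat \<Rightarrow> nat) \<Rightarrow> nat list \<Rightarrow> (nat \<Rightarrow> nat) list \<Rightarrow> 'k::field kpoly" where
  "kos_chain T [] c = (if length c = 1 then pt (0, []) else 0)"
| "kos_chain T (m # ms) c = kos_act (mono_fac T m (hd c)) (kos_chain T ms c) +
    (if tl c = [] then 0
     else kos_act (diff_fac T m (hd c) (hd (tl c))) (lwedge m (kos_chain T ms (tl c))))"

lemma kos_chain_Nil: "kos_chain T ms [] = 0"
  by (induction ms) (simp_all add: kos_act_0_right One_nat_def)

lemma keys_kos_chain:
  "supp (kos_chain T ms c :: 'k::field kpoly) \<subseteq>
    {(x, is). length is + 1 = length c \<and> set is \<subseteq> set ms}"
proof (induction ms arbitrary: c)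
  case (Cons m ms)
  have kos_act: "supp (kos_act P w) \<subseteq> {(x, is). Q is}"
    if "supp w \<subseteq> {(x, is). Q is}" for Q and P :: "'k epoly" and w
    unfolding kos_act_def using that by (intro keys_bilin_ext) auto
  let ?A = "{(x, is). length is + 1 = length c \<and> set is \<subseteq> set (m # ms)}
    :: (((nat \<Rightarrow> nat) \<times> (nat \<Rightarrow> nat)) \<times> nat list) set"
  have "supp (kos_chain T ms c :: 'k kpoly) \<subseteq> ?A"
    using Cons[of c] by auto
  then have 1: "supp (kos_act (mono_fac T m (hd c)) (kos_chain T ms c) :: 'k kpoly) \<subseteq> ?A"
    by (rule kos_act)
  have 2: "supp (kos_act P (lwedge m (kos_chain T ms (tl c))) :: 'k kpoly) \<subseteq> ?A"
    if "tl c \<noteq> []" for P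
  proof (rule kos_act)
    show "supp (lwedge m (kos_chain T ms (tl c)) :: 'k kpoly) \<subseteq> ?A"
      unfolding lwedge_def using that Cons[of "tl c"]
      by (intro keys_lin_ext) (cases c; fastforce)
  qed
  show ?case
    using 1 2 order_trans[OF keys_add Un_least[OF 1 2]] by simp
qed auto

lemma sum_del_Cons:
  fixes F :: "'a list \<Rightarrow> ('y \<Rightarrow>\<^sub>0 'k::field)"
  shows "(\<Sum>j<length (L # c). fscale ((- 1) ^ j) (F (del j (L # c)))) =
    F c - (\<Sum>j<length c. fscale ((- 1) ^ j) (F (L # del j c)))"
  by (simp add: sum.lessThan_Suc_shift del_0_Cons del_Suc_Cons sum_negf del: sum.lessThan_Suc)

text \<open>Induction on the variables. In the step, let \<open>m\<close> be the new variable and compare the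
  terms of the result with and without \<open>m\<close>. Removing \<open>m\<close> from the wedge product contributes
  \<open>M\<^sub>m(L\<^sub>1) - M\<^sub>m(L\<^sub>0)\<close>. Added to the terms that never contained \<open>m\<close>, it turns the coefficient
  \<open>M\<^sub>m(L\<^sub>0)\<close> of the chain without \<open>L\<^sub>0\<close> into \<open>M\<^sub>m(L\<^sub>1)\<close>, as required. In the terms that contain \<open>m\<close>,
  deleting \<open>L\<^sub>0\<close> or \<open>L\<^sub>1\<close> gives the coefficients \<open>D\<^sub>m(L\<^sub>1, L\<^sub>2)\<close> and \<open>D\<^sub>m(L\<^sub>0, L\<^sub>2)\<close> with
  opposite signs; their difference is \<open>D\<^sub>m(L\<^sub>0, L\<^sub>1)\<close>, the coefficient in front of the chain
  without both members.\<close>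

lemma kos_diff_kos_chain:
  assumes "sorted_wrt (\<lambda>L L'. \<forall>m. L m \<le> L' m) c" and "\<And>L m. L \<in> set c \<Longrightarrow> L m \<le> T m"
  shows "kos_diff (kos_chain T ms c) =
    (\<Sum>j<length c. fscale ((- 1) ^ j) (kos_chain T ms (del j c) :: 'k::field kpoly))"
  using assms
proof (induction ms arbitrary: c)
  case Nil
  consider "c = []" | L where "c = [L]" | L L' where "c = [L, L']" | "length c > 2"
    by (cases c; cases "tl c"; cases "tl (tl c)") auto
  then show ?case
  proof cases
    case 4
    then show ?thesis
      by (simp add: flin_0[OF flin_kos_diff] length_del)
  qed (simp_all add: kos_diff_pt flin_0[OF flin_kos_diff] One_nat_def del_def
        single_add[symmetric])
next
  case (Cons m ms)
  let ?G = "kos_chain T ms :: _ \<Rightarrow> 'k kpoly"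
  consider "c = []" | L where "c = [L]" | L0 L1 r where "c = L0 # L1 # r"
    by (cases c; cases "tl c") auto
  then show ?case
  proof cases
    case 1
    then show ?thesis
      by (simp add: kos_chain_Nil kos_act_0_right flin_0[OF flin_kos_diff])
  next
    case 2
    then show ?thesis
      using Cons.IH[of c] Cons.prems
      by (simp add: kos_diff_kos_act kos_act_0_right del_def kos_chain_Nil)
  next
    case 3
    let ?M0 = "mono_fac T m L0 :: 'k epoly" and ?M1 = "mono_fac T m L1 :: 'k epoly"
      and ?D = "diff_fac T m L0 L1 :: 'k epoly"
    let ?S = "\<Sum>j<length r. fscale ((- 1) ^ j) (?G (L0 # L1 # del j r))"
    let ?U = "\<Sum>j<length r. fscale ((- 1) ^ j) (?G (L1 # del j r))"
    \<comment> \<open>The term with \<open>m\<close> for the chain that consists of \<open>L\<close> and the list \<open>r\<close>. For empty \<open>r\<close> no selection is possible.\<close>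
    define X where "X L = (if r = [] then 0 else kos_act (diff_fac T m L (hd r)) (lwedge m (?G r)))" for L
    have le: "L0 m \<le> L1 m" "L1 m \<le> T m" "\<And>L. L \<in> set r \<Longrightarrow> L1 m \<le> L m"
      using Cons.prems by (auto simp: 3)
    \<comment> \<open>For empty \<open>r\<close> both sides vanish, as an empty chain has value zero.\<close>
    have X: "X L0 - X L1 = kos_act ?D (lwedge m (?G r))"
    proof (cases "r = []")
      case True
      then show ?thesis
        by (simp add: X_def kos_chain_Nil flin_0[OF flin_lwedge] kos_act_0_right)
    next
      case False
      then have "diff_fac T m L0 (hd r) = ?D + diff_fac T m L1 (hd r)"
        using le by (intro diff_fac_concat) simp_all
      then show ?thesis
        using False by (simp add: X_def kos_act_add_left)
    qed
    have dG: "kos_diff (?G (L0 # L1 # r)) = ?G (L1 # r) - ?G (L0 # r) + ?S"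
      using Cons.IH[of c] Cons.prems sum_del_Cons[of ?G L0 "L1 # r"]
        sum_del_Cons[of "\<lambda>c. ?G (L0 # c)" L1 r]
      by (simp add: 3 del: sum.lessThan_Suc)
    have dG': "kos_diff (?G (L1 # r)) = ?G r - ?U"
      using Cons.IH[of "tl c"] Cons.prems sum_del_Cons[of ?G L1 r]
      by (simp add: 3 del: sum.lessThan_Suc)
    have "kos_diff (kos_chain T (m # ms) c) =
        kos_act ?M0 (kos_diff (?G (L0 # L1 # r))) + kos_act (var_diff m * ?D) (?G (L1 # r)) -
        kos_act ?D (lwedge m (kos_diff (?G (L1 # r))))"
      by (simp add: 3 flin_add[OF flin_kos_diff] kos_diff_kos_act kos_diff_lwedge kos_act_diff_right
          mult.commute[of "var_diff m"] kos_act_mult)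
    also have "\<dots> = kos_act ?M0 (?G (L1 # r) - ?G (L0 # r) + ?S) + kos_act (?M1 - ?M0) (?G (L1 # r)) -
        kos_act ?D (lwedge m (?G r - ?U))"
      by (simp only: dG dG' var_diff_mult_diff_fac[of L0 m L1 T, OF le(1,2)])
    also have "\<dots> = kos_act ?M1 (?G (L1 # r)) - kos_act ?M0 (?G (L0 # r)) - kos_act ?D (lwedge m (?G r)) +
        (kos_act ?M0 ?S + kos_act ?D (lwedge m ?U))"
      by (simp add: kos_act_add_right kos_act_diff_right kos_act_diff_left flin_diff[OF flin_lwedge])
    also have "\<dots> = (kos_act ?M1 (?G (L1 # r)) + X L1) - (kos_act ?M0 (?G (L0 # r)) + X L0) +
        (kos_act ?M0 ?S + kos_act ?D (lwedge m ?U))"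
      by (simp add: X[symmetric])
    also have "kos_act ?M1 (?G (L1 # r)) + X L1 = kos_chain T (m # ms) (L1 # r)"
      by (simp add: X_def)
    also have "kos_act ?M0 (?G (L0 # r)) + X L0 = kos_chain T (m # ms) (L0 # r)"
      by (simp add: X_def)
    also have "kos_act ?M0 ?S + kos_act ?D (lwedge m ?U) =
        (\<Sum>j<length r. fscale ((- 1) ^ j) (kos_chain T (m # ms) (L0 # L1 # del j r)))"
      by (simp add: kos_act_sum_right kos_act_scale_right flin_sum[OF flin_lwedge] flin_scale[OF flin_lwedge]
          sum.distrib free.scale_right_distrib)
    also have "kos_chain T (m # ms) (L1 # r) - kos_chain T (m # ms) (L0 # r) + \<dots> =
        (\<Sum>j<length c. fscale ((- 1) ^ j) (kos_chain T (m # ms) (del j c)))"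
      unfolding 3 sum_del_Cons[of "kos_chain T (m # ms)" L0 "L1 # r"]
        sum_del_Cons[of "\<lambda>c. kos_chain T (m # ms) (L0 # c)" L1 r]
      by simp
    finally show ?thesis .
  qed
qed

text \<open>All exponents of \<open>x\<close> grow by \<open>q\<close> and all exponents of \<open>y\<close> by \<open>r\<close>. This is the linearity of the
  comparison map over the enveloping algebra.\<close>

lemma kos_chain_shift:
  assumes "\<And>L m. L \<in> set c \<Longrightarrow> L m \<le> T m"
  shows "kos_chain (q + T + r) ms (map ((+) q) c) =
    kos_act (\<Prod>m\<leftarrow>ms. pt (exp_at m (q m), exp_at m (r m))) (kos_chain T ms c :: 'k::field kpoly)"
  using assms
proof (induction ms arbitrary: c)
  case Nil
  show ?case by (simp add: kos_act_1 kos_act_0_right)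
next
  case (Cons m ms)
  let ?f = "\<lambda>m. pt (exp_at m (q m), exp_at m (r m)) :: 'k epoly"
  let ?P = "\<Prod>m\<leftarrow>ms. ?f m"
  show ?case
  proof (cases c)
    case Nil
    then show ?thesis by (simp add: kos_chain_Nil kos_act_0_right)
  next
    case (Cons L c')
    have mono: "mono_fac (q + T + r) m (q + L) = ?f m * mono_fac T m L"
    proof -
      have "L m \<le> T m" using Cons.prems Cons by simp
      then show ?thesis
        by (simp add: mono_fac_def mult_single add_ac flip: exp_at_add)
    qed
    have diff: "diff_fac (q + T + r) m (q + L) (q + L') = ?f m * diff_fac T m L L'"
      if "L' \<in> set c" for L'
    proof -
      have "L' m \<le> T m" using Cons.prems that by simp
      have "diff_fac (q + T + r) m (q + L) (q + L') =
          (\<Sum>x\<in>{L m + q m..<L' m + q m}. pt (exp_at m x, exp_at m (q m + T m + r m - (x + 1))))"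
        by (simp add: diff_fac_def add.commute[of "q m"])
      also have "\<dots> =
          (\<Sum>x\<in>{L m..<L' m}. pt (exp_at m (x + q m), exp_at m (q m + T m + r m - (x + q m + 1))))"
        by (rule sum.shift_bounds_nat_ivl)
      also have "\<dots> = ?f m * diff_fac T m L L'"
        unfolding diff_fac_def sum_distrib_left
        using \<open>L' m \<le> T m\<close> by (intro sum.cong refl) (auto simp: mult_single add_ac simp flip: exp_at_add)
      finally show ?thesis .
    qed
    have shift: "kos_act (?f m * F) (kos_act ?P w) = kos_act (?f m * ?P) (kos_act F w)" for F w
      by (simp add: mult_ac flip: kos_act_mult)
    have IH: "kos_chain (q + T + r) ms (map ((+) q) c) = kos_act ?P (kos_chain T ms c :: 'k kpoly)"
      "kos_chain (q + T + r) ms (map ((+) q) c') = kos_act ?P (kos_chain T ms c' :: 'k kpoly)"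
      by (rule Cons.IH; use Cons.prems Cons in simp)+
    have hd_eq: "mono_fac (q + T + r) m (hd (map ((+) q) c)) = ?f m * mono_fac T m (hd c)"
      unfolding Cons list.map list.sel by (rule mono)
    have tl_eq: "kos_chain (q + T + r) ms (tl (map ((+) q) c)) = kos_act ?P (kos_chain T ms (tl c))"
      unfolding Cons list.map list.sel by (rule IH(2))
    have diff_eq: "diff_fac (q + T + r) m (hd (map ((+) q) c)) (hd (tl (map ((+) q) c))) =
        ?f m * diff_fac T m (hd c) (hd (tl c))" if "tl c \<noteq> []"
    proof -
      obtain L' c'' where c': "c' = L' # c''" using \<open>tl c \<noteq> []\<close> Cons by (cases c') auto
      show ?thesis
        unfolding Cons c' list.map list.sel by (rule diff) (simp add: Cons c')
    qed
    have Nil_iff: "tl (map ((+) q) c) = [] \<longleftrightarrow> tl c = []"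
      by (simp add: Cons)
    show ?thesis
    proof (cases "tl c = []")
      case True
      then show ?thesis
        by (simp only: kos_chain.simps Nil_iff hd_eq IH(1) shift if_True simp_thms add_0_right list.map prod_list.Cons)
    next
      case False
      then show ?thesis
        by (simp only: kos_chain.simps Nil_iff hd_eq tl_eq diff_eq[OF False] IH(1) shift if_False list.map
            prod_list.Cons lwedge_kos_act kos_act_add_right)
    qed
  qed
qed

lemma kos_chain_cong:
  assumes "\<And>m. m \<in> set ms \<Longrightarrow> T m = T' m"
    and "length c = length c'" and "\<And>j m. j < length c \<Longrightarrow> m \<in> set ms \<Longrightarrow> (c ! j) m = (c' ! j) m"
  shows "kos_chain T ms c = (kos_chain T' ms c' :: 'k::field kpoly)"
  using assms
proof (induction ms arbitrary: c c')
  case (Cons m ms)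
  have IH: "kos_chain T ms c = (kos_chain T' ms c' :: 'k kpoly)"
    by (rule Cons.IH) (use Cons.prems in auto)
  have IH': "kos_chain T ms (tl c) = (kos_chain T' ms (tl c') :: 'k kpoly)"
  proof (rule Cons.IH)
    show "(tl c ! j) m' = (tl c' ! j) m'" if "j < length (tl c)" "m' \<in> set ms" for j m'
      using that Cons.prems(2) Cons.prems(3)[of "Suc j" m'] by (simp add: nth_tl)
  qed (use Cons.prems in auto)
  show ?case
  proof (cases "c = []")
    case True
    then show ?thesis using Cons.prems(2) by (simp add: kos_chain_Nil)
  next
    case False
    then have "hd c m = hd c' m"
      using Cons.prems(2) Cons.prems(3)[of 0 m] by (cases c; cases c') auto
    moreover have "hd (tl c) m = hd (tl c') m" if "tl c \<noteq> []"
      using that Cons.prems(2) Cons.prems(3)[of "Suc 0" m]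
      by (cases c; cases c'; cases "tl c"; cases "tl c'") auto
    moreover have "tl c = [] \<longleftrightarrow> tl c' = []"
      using Cons.prems(2) by (cases c; cases c') auto
    ultimately show ?thesis
      using Cons.prems(1) IH IH' by (simp add: mono_fac_def diff_fac_def)
  qed
qed simp

section \<open>The exponents of the comparison map\<close>

text \<open>In the recursion the chain moves on by one member at each selected variable. When the
  variable \<open>m\<close> is processed, its head is therefore the member whose position is the number of
  selected variables below \<open>m\<close>.\<close>

definition rank_in :: "nat set \<Rightarrow> nat \<Rightarrow> nat" where
  "rank_in I m = card {i \<in> I. i < m}"

definition chain_fac :: "(nat \<Rightarrow> nat) \<Rightarrow> nat set \<Rightarrow> (nat \<Rightarrow> nat) list \<Rightarrow> nat \<Rightarrow> 'k::field epoly" where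
  "chain_fac T I c m = (if m \<in> I then diff_fac T m (c ! rank_in I m) (c ! Suc (rank_in I m))
    else mono_fac T m (c ! rank_in I m))"

text \<open>Unfolding the recursion amounts to choosing the set \<open>I\<close> of selected variables. In the
  step these sets are split according to whether they contain the first variable; if they
  do, all ranks above it increase by one, which matches the passage to the tail of the
  chain.\<close>

lemma kos_chain_closed_form:
  assumes "sorted_wrt (<) ms" and "length c = Suc p"
  shows "kos_chain T ms c = (\<Sum>I | I \<subseteq> set ms \<and> card I = p.
    kos_act (\<Prod>m\<in>set ms. chain_fac T I c m) (pt (0, sorted_list_of_set I)) :: 'k::field kpoly)"
  using assms
proof (induction ms arbitrary: c p)
  case Nil
  have subsets: "{I. I \<subseteq> set [] \<and> card I = p} = (if p = 0 then {{}} else {})"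
    by auto
  show ?case
    unfolding subsets using Nil by (simp add: kos_act_1 One_nat_def)
next
  case (Cons m ms)
  let ?B = "\<lambda>p. {I. I \<subseteq> set ms \<and> card I = p}"
  let ?t = "\<lambda>A I c. kos_act (\<Prod>m\<in>A. chain_fac T I c m) (pt (0, sorted_list_of_set I)) :: 'k kpoly"
  have m: "m < m'" if "m' \<in> set ms" for m'
    using Cons.prems that by simp
  then have m_notin: "m \<notin> set ms" by blast
  have fin: "finite (?B p)" for p by simp
  have fin_sub: "finite I" if "I \<subseteq> set ms" for I
    using that finite_subset by blast
  have split: "{I. I \<subseteq> set (m # ms) \<and> card I = p} =
      ?B p \<union> (if p = 0 then {} else insert m ` ?B (p - 1))"
  proof (intro equalityI subsetI)
    fix I assume I: "I \<in> {I. I \<subseteq> set (m # ms) \<and> card I = p}"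
    show "I \<in> ?B p \<union> (if p = 0 then {} else insert m ` ?B (p - 1))"
    proof (cases "m \<in> I")
      case True
      have "finite I" using I by (auto intro: finite_subset)
      then have "card (I - {m}) = p - 1" "p \<noteq> 0"
        using I True by (auto simp: card_gt_0_iff)
      moreover have "I \<in> insert m ` ?B (p - 1)"
        by (rule image_eqI[where x = "I - {m}"]) (use True I calculation in auto)
      ultimately show ?thesis by simp
    qed (use I in auto)
  next
    fix I assume I: "I \<in> ?B p \<union> (if p = 0 then {} else insert m ` ?B (p - 1))"
    have "card (insert m I') = Suc (card I')" if "I' \<subseteq> set ms" for I'
      using that fin_sub m_notin by (intro card_insert_disjoint) auto
    then show "I \<in> {I. I \<subseteq> set (m # ms) \<and> card I = p}"
      using I by (auto split: if_splits)
  qed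
  have without_m: "?t (set (m # ms)) I c = kos_act (mono_fac T m (hd c)) (?t (set ms) I c)"
    if "I \<subseteq> set ms" for I
  proof -
    have "{i \<in> I. i < m} = {}"
      using that m less_asym by blast
    then have "rank_in I m = 0" by (simp add: rank_in_def)
    then have "chain_fac T I c m = (mono_fac T m (hd c) :: 'k epoly)"
      using that m_notin Cons.prems(2) by (cases c) (auto simp: chain_fac_def)
    then show ?thesis
      using m_notin by (simp add: kos_act_mult)
  qed
  have with_m: "?t (set (m # ms)) (insert m I) c =
      kos_act (diff_fac T m (hd c) (hd (tl c))) (lwedge m (?t (set ms) I (tl c)))"
    if I: "I \<subseteq> set ms" and tl: "tl c \<noteq> []" for I
  proof -
    obtain L0 L1 r where c: "c = L0 # L1 # r"
      using tl by (cases c; cases "tl c") auto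
    have finI: "finite I" using fin_sub I by blast
    have mI: "m \<notin> I" using I m_notin by auto
    have "{i \<in> insert m I. i < m} = {}"
      using I m less_asym by blast
    then have rank_m: "rank_in (insert m I) m = 0" by (simp add: rank_in_def)
    have "chain_fac T (insert m I) c m = (diff_fac T m (hd c) (hd (tl c)) :: 'k epoly)"
      by (simp add: chain_fac_def rank_m c)
    moreover have "chain_fac T (insert m I) c m' = (chain_fac T I (tl c) m' :: 'k epoly)"
      if "m' \<in> set ms" for m'
    proof -
      have "{i \<in> insert m I. i < m'} = insert m {i \<in> I. i < m'}" using m[OF that] by auto
      then have "rank_in (insert m I) m' = Suc (rank_in I m')"
        using finI mI by (simp add: rank_in_def)
      then show ?thesis
        using m[OF that] by (simp add: chain_fac_def c)
    qed
    ultimately have prod: "(\<Prod>m'\<in>set (m # ms). chain_fac T (insert m I) c m') =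
        diff_fac T m (hd c) (hd (tl c)) * (\<Prod>m\<in>set ms. chain_fac T I (tl c) m :: 'k epoly)"
      using m_notin by (simp cong: prod.cong_simp)
    have "insort m (sorted_list_of_set I) = m # sorted_list_of_set I"
      using m I finI by (intro insort_is_Cons) (auto intro: less_imp_le)
    then have "sorted_list_of_set (insert m I) = m # sorted_list_of_set I"
      using finI mI by (simp add: sorted_list_of_set_insert)
    then show ?thesis
      unfolding prod by (simp add: kos_act_mult lwedge_kos_act lwedge_pt)
  qed
  have inj: "inj_on (insert m) (?B (p - 1))"
  proof (rule inj_onI)
    fix I J assume "I \<in> ?B (p - 1)" "J \<in> ?B (p - 1)" "insert m I = insert m J"
    moreover from this have "m \<notin> I" "m \<notin> J" using m_notin by auto
    ultimately show "I = J" by (simp add: insert_ident)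
  qed
  have disj: "?B p \<inter> insert m ` ?B (p - 1) = {}"
    using m_notin by auto
  have IH: "kos_chain T ms c = (\<Sum>I\<in>?B p. ?t (set ms) I c)"
    using Cons.IH[of c p] Cons.prems by simp
  show ?case
  proof (cases "p = 0")
    case True
    then have "tl c = []" using Cons.prems(2) by (cases c) auto
    moreover have "(\<Sum>I\<in>?B p. ?t (set (m # ms)) I c) =
        (\<Sum>I\<in>?B p. kos_act (mono_fac T m (hd c)) (?t (set ms) I c))"
      by (rule sum.cong[OF refl], rule without_m) simp
    ultimately show ?thesis
      unfolding split using True by (simp add: IH kos_act_sum_right)
  next
    case False
    then have tl: "tl c \<noteq> []" "length (tl c) = Suc (p - 1)"
      using Cons.prems(2) by (cases c; auto)+
    have IH': "kos_chain T ms (tl c) = (\<Sum>I\<in>?B (p - 1). ?t (set ms) I (tl c))"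
      using Cons.IH[of "tl c" "p - 1"] Cons.prems tl by simp
    have "(\<Sum>I\<in>?B p \<union> insert m ` ?B (p - 1). ?t (set (m # ms)) I c) =
        (\<Sum>I\<in>?B p. ?t (set (m # ms)) I c) + (\<Sum>I\<in>?B (p - 1). ?t (set (m # ms)) (insert m I) c)"
      using fin disj by (simp only: sum.union_disjoint finite_imageI sum.reindex[OF inj] comp_def)
    also have "(\<Sum>I\<in>?B p. ?t (set (m # ms)) I c) =
        (\<Sum>I\<in>?B p. kos_act (mono_fac T m (hd c)) (?t (set ms) I c))"
      by (rule sum.cong[OF refl], rule without_m) simp
    also have "(\<Sum>I\<in>?B (p - 1). ?t (set (m # ms)) (insert m I) c) =
        (\<Sum>I\<in>?B (p - 1). kos_act (diff_fac T m (hd c) (hd (tl c))) (lwedge m (?t (set ms) I (tl c))))"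
      by (rule sum.cong[OF refl], rule with_m) (use tl in auto)
    finally show ?thesis
      unfolding split using False tl
      by (simp add: IH IH' kos_act_sum_right flin_sum[OF flin_lwedge])
  qed
qed

lemma
  assumes "i \<in> index_seqs n p"
  shows index_seqs_less: "j \<in> {1..p} \<Longrightarrow> k \<in> {1..p} \<Longrightarrow> j < k \<Longrightarrow> i j < i k"
    and index_seqs_less_iff: "j \<in> {1..p} \<Longrightarrow> k \<in> {1..p} \<Longrightarrow> i j < i k \<longleftrightarrow> j < k"
    and index_seqs_inj: "inj_on i {1..p}"
    and index_seqs_range: "i ` {1..p} \<subseteq> {1..n}"
  using assms strict_mono_on_imp_inj_on[of "{1..p}" i]
  by (auto simp: index_seqs_def strict_mono_on_def strict_mono_on_less[of "{1..p}" i])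

lemma rank_in_selected:
  assumes "i \<in> index_seqs n p" "j \<in> {1..p}"
  shows "rank_in (i ` {1..p}) (i j) = j - 1"
proof -
  have "{x \<in> i ` {1..p}. x < i j} = i ` {1..<j}"
    using assms(2) index_seqs_less_iff[OF assms(1) _ assms(2)] by force
  moreover have "inj_on i {1..<j}"
    by (rule inj_on_subset[OF index_seqs_inj[OF assms(1)]]) (use assms(2) in auto)
  ultimately show ?thesis
    by (simp add: rank_in_def card_image)
qed

lemma initial_segment_eq:
  assumes "A \<subseteq> {1..p}" "\<And>j k. j \<in> A \<Longrightarrow> k \<in> {1..j} \<Longrightarrow> k \<in> A"
  shows "A = {1..card A}"
proof (cases "A = {}")
  case False
  have "finite A" using assms(1) finite_subset by blast
  then have "Max A \<in> A" "\<And>j. j \<in> A \<Longrightarrow> j \<le> Max A" using False by auto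
  then have "A \<subseteq> {1..Max A}" "{1..Max A} \<subseteq> A"
    using assms(1) assms(2)[of "Max A"] by auto
  then have "A = {1..Max A}" by (rule equalityI)
  then have "card A = Max A" by (metis card_atLeastAtMost diff_Suc_1 One_nat_def)
  with \<open>A = {1..Max A}\<close> show ?thesis by simp
qed simp

text \<open>If \<open>m\<close> lies strictly between the \<open>j\<close>-th and the next selected index, then exactly the
  first \<open>j\<close> selected indices are below \<open>m\<close>.\<close>

lemma pad_unique:
  assumes i: "i \<in> index_seqs n p" and j: "j \<le> p" "pad n p i j < m" "m < pad n p i (j + 1)"
  shows "rank_in (i ` {1..p}) m = j"
proof -
  have "i x < m \<longleftrightarrow> x \<le> j" if x: "x \<in> {1..p}" for x
  proof
    assume "x \<le> j"
    then have "j \<in> {1..p}" "pad n p i j = i j" using x j by (auto simp: pad_def)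
    then show "i x < m"
      using \<open>x \<le> j\<close> index_seqs_less[OF i x, of j] j(2) by (cases "x = j") auto
  next
    assume less: "i x < m"
    show "x \<le> j"
    proof (rule ccontr)
      assume "\<not> x \<le> j"
      then have "j + 1 \<in> {1..p}" "pad n p i (j + 1) = i (j + 1)" using x j by (auto simp: pad_def)
      then have "m < i x"
        using \<open>\<not> x \<le> j\<close> index_seqs_less[OF i _ x, of "j + 1"] j(3) by (cases "x = j + 1") auto
      with less show False by simp
    qed
  qed
  then have "{x \<in> i ` {1..p}. x < m} = i ` {1..j}"
    using j(1) by (auto simp: image_iff)
  moreover have "inj_on i {1..j}"
    by (rule inj_on_subset[OF index_seqs_inj[OF i]]) (use j(1) in auto)
  ultimately show ?thesis
    by (simp add: rank_in_def card_image)
qed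

lemma pad_rank_in:
  assumes i: "i \<in> index_seqs n p" and m: "m \<in> {1..n}" "m \<notin> i ` {1..p}"
  defines "J \<equiv> rank_in (i ` {1..p}) m"
  shows "J \<le> p \<and> pad n p i J < m \<and> m < pad n p i (J + 1)"
proof -
  define A where "A = {j \<in> {1..p}. i j < m}"
  have "{x \<in> i ` {1..p}. x < m} = i ` A"
    by (auto simp: A_def)
  moreover have "inj_on i A"
    by (rule inj_on_subset[OF index_seqs_inj[OF i]]) (auto simp: A_def)
  ultimately have J: "J = card A"
    by (simp add: J_def rank_in_def card_image)
  have "A = {1..J}"
    unfolding J
  proof (rule initial_segment_eq)
    show "A \<subseteq> {1..p}" by (auto simp: A_def)
    fix j k assume "j \<in> A" "k \<in> {1..j}"
    then show "k \<in> A"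
      using index_seqs_less[OF i, of k j] by (cases "k = j") (auto simp: A_def)
  qed
  then have A: "i j < m \<longleftrightarrow> j \<le> J" if "j \<in> {1..p}" for j
  proof -
    have "j \<in> A \<longleftrightarrow> j \<in> {1..J}"
      by (rule arg_cong[OF \<open>A = {1..J}\<close>])
    then show ?thesis using that by (simp add: A_def)
  qed
  have "J \<le> p"
    unfolding J using card_mono[of "{1..p}" A] by (simp add: A_def subset_iff)
  moreover have "pad n p i J < m"
    using A[of J] \<open>J \<le> p\<close> m(1) by (auto simp: pad_def)
  moreover have "m < pad n p i (J + 1)"
  proof (cases "J = p")
    case False
    then have "J + 1 \<in> {1..p}" using \<open>J \<le> p\<close> by simp
    then have "\<not> i (J + 1) < m" "i (J + 1) \<noteq> m" using A[of "J + 1"] m(2) by auto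
    then show ?thesis using False \<open>J \<le> p\<close> by (simp add: pad_def)
  qed (use m in \<open>simp add: pad_def\<close>)
  ultimately show ?thesis by simp
qed

lemma Q_selected:
  assumes i: "i \<in> index_seqs n p" and j: "j \<in> {1..p}"
  shows "Q n p l i a (i j) = a j + (\<Sum>h\<in>{1..<j}. l h (i j))"
proof -
  have "(THE j'. j' \<in> {1..p} \<and> i j = i j') = j"
    using j inj_onD[OF index_seqs_inj[OF i]] by (intro the_equality) auto
  then show ?thesis
    using j by (simp add: Q_def Let_def)
qed

lemma Q_unselected:
  assumes i: "i \<in> index_seqs n p" and m: "m \<in> {1..n}" "m \<notin> i ` {1..p}"
  shows "Q n p l i a m = (\<Sum>h\<in>{1..rank_in (i ` {1..p}) m}. l h m)"
proof -
  have "(THE j. j \<le> p \<and> pad n p i j < m \<and> m < pad n p i (j + 1)) = rank_in (i ` {1..p}) m"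
    using pad_rank_in[OF i m] pad_unique[OF i] by (intro the_equality) auto
  then show ?thesis
    using m(2) by (simp only: Q_def Let_def if_False)
qed

lemma map_index_seq:
  assumes i: "i \<in> index_seqs n p"
  shows "sorted_list_of_set (i ` {1..p}) = map i [1..<p + 1]"
proof -
  have "sorted_wrt (<) (map i [1..<p + 1])"
    unfolding sorted_wrt_iff_nth_less using index_seqs_less[OF i] by auto
  moreover have "set (map i [1..<p + 1]) = i ` {1..p}"
    by auto
  moreover have "length (map i [1..<p + 1]) = card (i ` {1..p})"
    by (simp add: card_image[OF index_seqs_inj[OF i]])
  ultimately show ?thesis
    using sorted_list_of_set_unique[of "i ` {1..p}" "map i [1..<p + 1]"] by blast
qed

lemma bij_betw_index_seqs:
  "bij_betw (\<lambda>i. i ` {1..p}) (index_seqs n p) {I. I \<subseteq> {1..n} \<and> card I = p}"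
  unfolding bij_betw_def
proof
  show "inj_on (\<lambda>i. i ` {1..p}) (index_seqs n p)"
  proof (rule inj_onI)
    fix i i' assume i: "i \<in> index_seqs n p" and i': "i' \<in> index_seqs n p"
      and "i ` {1..p} = i' ` {1..p}"
    then have "map i [1..<p + 1] = map i' [1..<p + 1]"
      using map_index_seq by metis
    then have eq: "i j = i' j" if "j \<in> {1..p}" for j
      using that by auto
    have "i \<in> {1..p} \<rightarrow>\<^sub>E {1..n}" "i' \<in> {1..p} \<rightarrow>\<^sub>E {1..n}"
      using i i' by (auto simp: index_seqs_def)
    then show "i = i'"
      by (rule PiE_ext) (rule eq)
  qed
  show "(\<lambda>i. i ` {1..p}) ` index_seqs n p = {I. I \<subseteq> {1..n} \<and> card I = p}"
  proof (intro equalityI subsetI)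
    fix I assume "I \<in> {I. I \<subseteq> {1..n} \<and> card I = p}"
    then have I: "I \<subseteq> {1..n}" "card I = p" "finite I"
      using finite_subset by auto
    let ?xs = "sorted_list_of_set I"
    have xs: "length ?xs = p" "set ?xs = I" "sorted_wrt (<) ?xs"
      using I by simp_all
    define i where "i = (\<lambda>j\<in>{1..p}. ?xs ! (j - 1))"
    have img: "i ` {1..p} = I"
    proof -
      have "i ` {1..p} = (\<lambda>j. ?xs ! j) ` {..<p}"
      proof (intro equalityI subsetI)
        fix x assume "x \<in> (\<lambda>j. ?xs ! j) ` {..<p}"
        then obtain j where "j < p" "x = ?xs ! j" by auto
        then show "x \<in> i ` {1..p}"
          by (intro image_eqI[of _ _ "Suc j"]) (auto simp: i_def)
      qed (auto simp: i_def intro!: imageI)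
      also have "\<dots> = set ?xs"
        using xs(1) by (auto simp: set_conv_nth)
      finally show ?thesis using xs by simp
    qed
    have "strict_mono_on {1..p} i"
      using xs by (auto simp: strict_mono_on_def i_def sorted_wrt_iff_nth_less intro!: diff_less_mono)
    then have "i \<in> index_seqs n p"
      using img I(1) by (auto simp: index_seqs_def i_def)
    with img show "I \<in> (\<lambda>i. i ` {1..p}) ` index_seqs n p" by blast
  next
    fix I assume "I \<in> (\<lambda>i. i ` {1..p}) ` index_seqs n p"
    then obtain i where i: "i \<in> index_seqs n p" and I: "I = i ` {1..p}"
      by blast
    show "I \<in> {I. I \<subseteq> {1..n} \<and> card I = p}"
      unfolding I using index_seqs_range[OF i] card_image[OF index_seqs_inj[OF i]] by simp
  qed
qed

lemma finite_index_seqs: "finite (index_seqs n p)"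
  by (rule finite_subset[of _ "{1..p} \<rightarrow>\<^sub>E {1..n}"]) (auto simp: index_seqs_def intro: finite_PiE)

lemma sum_Pair: "(\<Sum>m\<in>A. (f m, g m)) = (\<Sum>m\<in>A. f m, \<Sum>m\<in>A. g m)"
  by (induction A rule: infinite_finite_induct) (simp_all add: zero_prod_def)

text \<open>The chain of the tensor \<open>1 \<otimes> v\<^bsup>l 1\<^esup> \<otimes> \<dots> \<otimes> v\<^bsup>l p\<^esup> \<otimes> 1\<close>.\<close>

definition partial_sums :: "(nat \<Rightarrow> nat \<Rightarrow> nat) \<Rightarrow> nat \<Rightarrow> (nat \<Rightarrow> nat) list" where
  "partial_sums l p = map (\<lambda>j m. \<Sum>h\<in>{1..j}. l h m) [0..<Suc p]"

lemma length_partial_sums: "length (partial_sums l p) = Suc p"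
  by (simp add: partial_sums_def)

lemma nth_partial_sums: "j \<le> p \<Longrightarrow> (partial_sums l p ! j) m = (\<Sum>h\<in>{1..j}. l h m)"
  unfolding partial_sums_def by (subst nth_map) (simp_all del: upt_Suc)

text \<open>Each factor \<open>D\<close> is a sum over the exponents \<open>s = L + a\<close> above its lower end \<open>L\<close>. Multiplying
  out gives the sum over all families \<open>a\<close>, in which the factor of the variable \<open>m\<close> has exponents
  \<open>Q m\<close> and \<open>Q_hat m\<close>, whether \<open>m\<close> is selected or not.\<close>

lemma prod_chain_fac:
  fixes l :: "nat \<Rightarrow> nat \<Rightarrow> nat"
  assumes i: "i \<in> index_seqs n p"
  defines "T \<equiv> \<lambda>m. \<Sum>h\<in>{1..p}. l h m"
  shows "(\<Prod>m\<in>{1..n}. chain_fac T (i ` {1..p}) (partial_sums l p) m) =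
    (\<Sum>a\<in>(\<Pi>\<^sub>E j\<in>{1..p}. {0..<l j (i j)}).
      pt (\<Sum>m\<in>{1..n}. exp_at m (Q n p l i a m), \<Sum>m\<in>{1..n}. exp_at m (Q_hat n p l i a m)) :: 'k::field epoly)"
proof -
  let ?I = "i ` {1..p}" and ?c = "partial_sums l p"
  let ?f = "chain_fac T ?I ?c :: nat \<Rightarrow> 'k epoly"
  let ?g = "\<lambda>a m. pt (exp_at m (Q n p l i a m), exp_at m (Q_hat n p l i a m)) :: 'k epoly"
  let ?A = "\<Pi>\<^sub>E j\<in>{1..p}. {0..<l j (i j)}"
  have split: "prod f {1..n} = prod f ({1..n} - ?I) * (\<Prod>j\<in>{1..p}. f (i j))" for f :: "nat \<Rightarrow> 'k epoly"
    using prod.subset_diff[OF index_seqs_range[OF i], of f] prod.reindex[OF index_seqs_inj[OF i], of f]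
    by simp
  have unselected: "?f m = ?g a m" if "m \<in> {1..n} - ?I" for a m
  proof -
    have m: "m \<in> {1..n}" "m \<notin> ?I" using that by auto
    have "rank_in ?I m \<le> p" using pad_rank_in[OF i m] by blast
    then show ?thesis
      using m(2) by (simp add: chain_fac_def mono_fac_def nth_partial_sums Q_unselected[OF i m] Q_hat_def T_def)
  qed
  have selected: "?f (i j) = (\<Sum>x\<in>{0..<l j (i j)}.
      pt (exp_at (i j) (x + (\<Sum>h\<in>{1..<j}. l h (i j))),
        exp_at (i j) (T (i j) - (x + (\<Sum>h\<in>{1..<j}. l h (i j)) + 1))))" if j: "j \<in> {1..p}" for j
  proof -
    let ?s = "\<Sum>h\<in>{1..<j}. l h (i j)"
    have j': "Suc (j - 1) = j" "{1..j - 1} = {1..<j}" using j by auto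
    have lower: "(?c ! (j - 1)) (i j) = ?s"
      using j by (subst nth_partial_sums) (auto simp: j')
    have "{1..j} = insert j {1..<j}" using j by auto
    then have upper: "(?c ! j) (i j) = l j (i j) + ?s"
      using j by (subst nth_partial_sums) auto
    have "?f (i j) = (\<Sum>x\<in>{0 + ?s..<l j (i j) + ?s}. pt (exp_at (i j) x, exp_at (i j) (T (i j) - (x + 1))))"
      using j by (simp add: chain_fac_def rank_in_selected[OF i j] diff_fac_def j' lower upper)
    also have "\<dots> = (\<Sum>x\<in>{0..<l j (i j)}. pt (exp_at (i j) (x + ?s), exp_at (i j) (T (i j) - (x + ?s + 1))))"
      by (rule sum.shift_bounds_nat_ivl)
    finally show ?thesis .
  qed
  have "(\<Prod>j\<in>{1..p}. ?f (i j)) = (\<Prod>j\<in>{1..p}. \<Sum>x\<in>{0..<l j (i j)}.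
      pt (exp_at (i j) (x + (\<Sum>h\<in>{1..<j}. l h (i j))),
        exp_at (i j) (T (i j) - (x + (\<Sum>h\<in>{1..<j}. l h (i j)) + 1))))"
    by (intro prod.cong refl selected)
  also have "\<dots> = (\<Sum>a\<in>?A. \<Prod>j\<in>{1..p}.
      pt (exp_at (i j) (a j + (\<Sum>h\<in>{1..<j}. l h (i j))),
        exp_at (i j) (T (i j) - (a j + (\<Sum>h\<in>{1..<j}. l h (i j)) + 1))))"
    by (rule prod_sum_PiE) simp_all
  also have "\<dots> = (\<Sum>a\<in>?A. \<Prod>j\<in>{1..p}. ?g a (i j))"
    by (intro sum.cong prod.cong refl) (simp add: Q_selected[OF i] Q_hat_def T_def)
  finally have "prod ?f {1..n} = (\<Sum>a\<in>?A. prod ?f ({1..n} - ?I) * (\<Prod>j\<in>{1..p}. ?g a (i j)))"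
    by (simp only: split sum_distrib_left)
  also have "\<dots> = (\<Sum>a\<in>?A. prod (?g a) {1..n})"
    unfolding split[of "?g _"]
    by (intro sum.cong refl arg_cong2[where f = "(*)"] prod.cong unselected)
  also have "\<dots> = (\<Sum>a\<in>?A. pt (\<Sum>m\<in>{1..n}. exp_at m (Q n p l i a m), \<Sum>m\<in>{1..n}. exp_at m (Q_hat n p l i a m)))"
    by (simp only: pt_sum[symmetric] finite_atLeastAtMost sum_Pair)
  finally show ?thesis .
qed

lemma kos_chain_eq_sum:
  fixes l :: "nat \<Rightarrow> nat \<Rightarrow> nat"
  shows "kos_chain (\<lambda>m. \<Sum>h\<in>{1..p}. l h m) [1..<n + 1] (partial_sums l p) =
    (\<Sum>i\<in>index_seqs n p. \<Sum>a\<in>(\<Pi>\<^sub>E j\<in>{1..p}. {0..<l j (i j)}).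
      pt ((\<Sum>m\<in>{1..n}. exp_at m (Q n p l i a m), \<Sum>m\<in>{1..n}. exp_at m (Q_hat n p l i a m)),
        map i [1..<p + 1]) :: 'k::field kpoly)"
proof -
  let ?T = "\<lambda>m. \<Sum>h\<in>{1..p}. l h m" and ?c = "partial_sums l p"
  let ?F = "\<lambda>I. kos_act (\<Prod>m\<in>{1..n}. chain_fac ?T I ?c m) (pt (0, sorted_list_of_set I)) :: 'k kpoly"
  have set_eq: "set [1..<n + 1] = {1..n}" by auto
  have "kos_chain ?T [1..<n + 1] ?c = (\<Sum>I | I \<subseteq> {1..n} \<and> card I = p. ?F I)"
    using kos_chain_closed_form[OF sorted_wrt_upt length_partial_sums, of ?T 1 "n + 1" l p]
    unfolding set_eq .
  also have "\<dots> = (\<Sum>i\<in>index_seqs n p. ?F (i ` {1..p}))"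
    by (rule sum.reindex_bij_betw[OF bij_betw_index_seqs, symmetric])
  also have "\<dots> = (\<Sum>i\<in>index_seqs n p. \<Sum>a\<in>(\<Pi>\<^sub>E j\<in>{1..p}. {0..<l j (i j)}).
      pt ((\<Sum>m\<in>{1..n}. exp_at m (Q n p l i a m), \<Sum>m\<in>{1..n}. exp_at m (Q_hat n p l i a m)),
        map i [1..<p + 1]))"
    by (intro sum.cong refl)
      (simp only: prod_chain_fac map_index_seq flin_sum[OF flin_kos_act_left[OF flin_id]] kos_act_pt add_0_right)
  finally show ?thesis .
qed


section \<open>Partial sums along a bar tensor\<close>

text \<open>The total sum is left out, since it is not a member of the chain; \<open>acc\<close> is the sum of
  the entries that have been passed already.\<close>

primrec psums :: "'e::monoid_add \<Rightarrow> 'e list \<Rightarrow> 'e list" where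
  "psums acc [] = []"
| "psums acc (e # es) = (if es = [] then [] else (acc + e) # psums (acc + e) es)"

lemma length_psums: "length (psums acc es) = length es - 1"
  by (induction es arbitrary: acc) (auto simp: Suc_diff_le One_nat_def neq_Nil_conv)

text \<open>Merging the entries \<open>j\<close> and \<open>j + 1\<close> loses exactly the partial sum that ends between them.\<close>

lemma psums_face: "j + 1 < length es \<Longrightarrow> psums acc (face (+) j es) = del j (psums acc es)"
proof (induction j arbitrary: acc es)
  case 0
  then obtain a b es' where "es = a # b # es'" by (cases es; cases "tl es") auto
  then show ?case by (simp add: face_0_Cons del_0_Cons add.assoc)
next
  case (Suc j)
  then obtain a es' where es: "es = a # es'" by (cases es) auto
  have "face (+) j es' \<noteq> []" "es' \<noteq> []"
    using Suc.prems by (auto simp: es face_def)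
  then show ?case
    using Suc.IH[of es' "acc + a"] Suc.prems by (simp add: es face_Suc_Cons del_Suc_Cons)
qed

lemma sum_list_face: "j + 1 < length es \<Longrightarrow> sum_list (face (+) j es) = sum_list es"
proof (induction j arbitrary: es)
  case 0
  then obtain a b es' where "es = a # b # es'" by (cases es; cases "tl es") auto
  then show ?case by (simp add: face_0_Cons add.assoc)
next
  case (Suc j)
  then obtain a es' where es: "es = a # es'" by (cases es) auto
  show ?case
    using Suc by (simp add: es face_Suc_Cons)
qed

lemma set_psums_Cons: "L \<in> set (psums acc (e # es)) \<Longrightarrow> L = acc + e \<or> L \<in> set (psums (acc + e) es)"
  by (simp split: if_splits)

lemma psums_lower: "L \<in> set (psums acc es) \<Longrightarrow> acc m \<le> L m" for acc :: "nat \<Rightarrow> nat"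
proof (induction es arbitrary: acc)
  case (Cons e es)
  from set_psums_Cons[OF Cons.prems] show ?case
  proof
    assume "L \<in> set (psums (acc + e) es)"
    then have "(acc + e) m \<le> L m" by (rule Cons.IH)
    then show ?thesis by simp
  qed simp
qed simp

lemma psums_upper: "L \<in> set (psums acc es) \<Longrightarrow> L m \<le> acc m + sum_list es m" for acc :: "nat \<Rightarrow> nat"
proof (induction es arbitrary: acc)
  case (Cons e es)
  from set_psums_Cons[OF Cons.prems] show ?case
  proof
    assume "L \<in> set (psums (acc + e) es)"
    then have "L m \<le> (acc + e) m + sum_list es m" by (rule Cons.IH)
    then show ?thesis by simp
  qed simp
qed simp

lemma sorted_psums: "sorted_wrt (\<lambda>L L'. \<forall>m. L m \<le> L' m) (psums (acc :: nat \<Rightarrow> nat) es)"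
proof (induction es arbitrary: acc)
  case (Cons e es)
  show ?case
    using Cons[of "acc + e"] psums_lower[of _ "acc + e" es] by (simp del: plus_fun_apply)
qed simp

lemma psums_shift: "psums (q + acc) es = map ((+) q) (psums acc es)"
proof (induction es arbitrary: acc)
  case (Cons e es)
  show ?case
    using Cons[of "acc + e"] by (simp add: add.assoc)
qed simp

lemma psums_snoc: "psums acc (ms @ [y]) = psums acc (ms @ [z])"
  by (induction ms arbitrary: acc) simp_all

lemma psums_outer:
  fixes es :: "'e::comm_monoid_add list"
  assumes "length es \<ge> 2"
  shows "psums 0 (outer (+) [q, r] es) = map ((+) q) (psums 0 es)"
    and "sum_list (outer (+) [q, r] es) = q + sum_list es + r"
proof -
  obtain x ms y where es: "es = x # ms @ [y]"
    using assms by (rule length_ge_2E)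
  show "psums 0 (outer (+) [q, r] es) = map ((+) q) (psums 0 es)"
    using psums_shift[of q x "ms @ [y]"] psums_snoc[of "q + x" ms "y + r" y]
    by (simp add: es outer_Cons_snoc)
  show "sum_list (outer (+) [q, r] es) = q + sum_list es + r"
    by (simp add: es outer_Cons_snoc add_ac)
qed

lemma nth_psums: "j + 1 < length es \<Longrightarrow> psums acc es ! j = acc + sum_list (take (Suc j) es)"
proof (induction es arbitrary: acc j)
  case (Cons e es)
  then show ?case
    by (cases j) (auto simp: add.assoc)
qed simp

lemma psums_generator:
  fixes l :: "nat \<Rightarrow> nat \<Rightarrow> nat"
  shows "psums 0 (0 # map l [1..<p + 1] @ [0]) = partial_sums l p"
    and "sum_list (0 # map l [1..<p + 1] @ [0]) = (\<lambda>m. \<Sum>h\<in>{1..p}. l h m)"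
proof -
  have sum: "sum_list (map l [1..<j + 1]) = (\<lambda>m. \<Sum>h\<in>{1..j}. l h m)" for j
  proof -
    have "sum_list (map l [1..<j + 1]) = (\<Sum>h\<in>{1..j}. l h)"
      by (simp add: sum_list_distinct_conv_sum_set atLeastLessThanSuc_atLeastAtMost One_nat_def del: upt_Suc)
    then show ?thesis by (auto simp: sum_fun_apply)
  qed
  then show "sum_list (0 # map l [1..<p + 1] @ [0]) = (\<lambda>m. \<Sum>h\<in>{1..p}. l h m)"
    by simp
  show "psums 0 (0 # map l [1..<p + 1] @ [0]) = partial_sums l p"
  proof (rule nth_equalityI)
    show "length (psums 0 (0 # map l [1..<p + 1] @ [0])) = length (partial_sums l p)"
      by (simp add: length_psums length_partial_sums One_nat_def del: upt_Suc)
    fix j assume "j < length (psums 0 (0 # map l [1..<p + 1] @ [0]))"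
    then have j: "j \<le> p" by (simp add: length_psums One_nat_def del: upt_Suc)
    then have "take j [1..<p + 1] = [1..<j + 1]"
      by (simp add: take_upt One_nat_def del: upt_Suc)
    then have prefix: "take (Suc j) (0 # map l [1..<p + 1] @ [0]) = 0 # map l [1..<j + 1]"
      using j by (simp add: take_map del: upt_Suc)
    have "psums 0 (0 # map l [1..<p + 1] @ [0]) ! j =
        0 + sum_list (take (Suc j) (0 # map l [1..<p + 1] @ [0]))"
      using j by (intro nth_psums) (simp add: One_nat_def del: upt_Suc)
    also have "\<dots> = (\<lambda>m. \<Sum>h\<in>{1..j}. l h m)"
      using sum[of j] unfolding prefix by simp
    also have "\<dots> = partial_sums l p ! j"
      using j by (simp add: nth_partial_sums fun_eq_iff)
    finally show "psums 0 (0 # map l [1..<p + 1] @ [0]) ! j = partial_sums l p ! j" .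
  qed
qed

section \<open>The comparison map\<close>

context based_space
begin

text \<open>The comparison map in coordinates: a tensor of monomials is replaced by its chain of
  partial sums and its total exponent.\<close>

definition psi_model :: "((nat \<Rightarrow> nat) list \<Rightarrow>\<^sub>0 'k) \<Rightarrow> 'k kpoly" where
  "psi_model = lext (\<lambda>es. kos_chain (sum_list es) [1..<n + 1] (psums 0 es))"

lemma flin_psi_model: "flin psi_model"
  by (simp add: psi_model_def flin_lext)

lemma psi_model_pt: "psi_model (pt es) = kos_chain (sum_list es) [1..<n + 1] (psums 0 es)"
  by (simp add: psi_model_def)

lemma keys_psi_model:
  assumes "supp b \<subseteq> words (p + 2)"
  shows "supp (psi_model b) \<subseteq> {(x, is). length is = p \<and> set is \<subseteq> {1..n}}"
  unfolding psi_model_def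
proof (rule keys_lext)
  fix es assume "es \<in> supp b"
  then have "length (psums 0 es) = p + 1"
    using assms by (auto simp: length_psums One_nat_def)
  then have "{(x, is). length is + 1 = length (psums 0 es) \<and> set is \<subseteq> set [1..<n + 1]} =
      ({(x, is). length is = p \<and> set is \<subseteq> {1..n}} :: (((nat \<Rightarrow> nat) \<times> (nat \<Rightarrow> nat)) \<times> nat list) set)"
    by (simp add: atLeastLessThanSuc_atLeastAtMost One_nat_def del: upt_Suc)
  then show "supp (kos_chain (sum_list es) [1..<n + 1] (psums 0 es) :: 'k kpoly) \<subseteq>
      {(x, is). length is = p \<and> set is \<subseteq> {1..n}}"
    using keys_kos_chain[of "sum_list es" "[1..<n + 1]" "psums 0 es"] by (simp only:)
qed

lemma keys_psi_model_degree:
  assumes "supp b \<subseteq> words (p + 2)"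
  shows "supp (psi_model b) \<subseteq> kpoly_degree p"
  using keys_psi_model[OF assms] by auto

lemma kos_diff_psi_model:
  assumes b: "supp b \<subseteq> words (p + 2)"
  shows "kos_diff (psi_model b) = psi_model (bar_diff p b)"
proof (rule flin_eqI[where f = b, OF flin_comp[OF flin_kos_diff flin_psi_model]
      flin_comp[OF flin_psi_model flin_bar_diff]])
  fix es assume "es \<in> supp b"
  then have es: "length es = p + 2" using b by auto
  let ?G = "kos_chain (sum_list es) [1..<n + 1] :: _ \<Rightarrow> 'k kpoly"
  have "kos_diff (psi_model (pt es)) = (\<Sum>j<length (psums 0 es). fscale ((- 1) ^ j) (?G (del j (psums 0 es))))"
    unfolding psi_model_pt
    by (rule kos_diff_kos_chain[OF sorted_psums]) (use psums_upper in fastforce)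
  also have "\<dots> = (\<Sum>j\<in>{0..p}. fscale ((- 1) ^ j) (psi_model (pt (face (+) j es))))"
  proof (rule sum.cong)
    show "{..<length (psums 0 es)} = {0..p}"
      using es by (auto simp: length_psums One_nat_def)
    fix j assume "j \<in> {0..p}"
    then have "j + 1 < length es" using es by simp
    then show "fscale ((- 1) ^ j) (?G (del j (psums 0 es))) = fscale ((- 1) ^ j) (psi_model (pt (face (+) j es)))"
      by (simp only: psi_model_pt psums_face sum_list_face)
  qed
  also have "\<dots> = psi_model (bar_diff p (pt es))"
    by (simp only: bar_diff_def flin_sum[OF flin_psi_model] flin_scale[OF flin_psi_model] lin_ext_pt)
  finally show "kos_diff (psi_model (pt es)) = psi_model (bar_diff p (pt es))" .
qed

lemma sum_exp_at: "(\<Sum>m\<in>{1..n}. exp_at m (e m)) = trunc e"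
  by (rule ext) (auto simp: sum_fun_apply exp_at_def trunc_def)

lemma kos_elt_kos_act_trunc:
  assumes "supp w \<subseteq> kpoly_degree p"
  shows "kos_elt p (kos_act (pt (trunc q, trunc r)) w) = kos_elt p (kos_act (pt (q, r)) w)"
  unfolding kos_elt_smult[OF assms, symmetric] env_elt_pt smon_trunc ..

text \<open>The identity holds only after passing to the Koszul module, because \<open>kos_chain\<close> takes
  into account only the exponents at the indices of the basis.\<close>

lemma kos_elt_psi_model_bar_act:
  assumes b: "supp b \<subseteq> words (p + 2)"
  shows "kos_elt p (psi_model (bar_act P b)) = kos_elt p (kos_act P (psi_model b))"
proof -
  let ?N = "nf (K_rels p)"
  have "?N (kos_rep (psi_model (bar_act P b))) = ?N (kos_rep (kos_act P (psi_model b)))"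
  proof (rule bilin_eqI[where G = "\<lambda>P b. ?N (kos_rep (psi_model (bar_act P b)))" and f = P and g = b])
    show "flin (\<lambda>P. ?N (kos_rep (psi_model (bar_act P b))))"
      "flin (\<lambda>P. ?N (kos_rep (kos_act P (psi_model b))))"
      "flin (\<lambda>b. ?N (kos_rep (psi_model (bar_act (pt x) b))))"
      "flin (\<lambda>b. ?N (kos_rep (kos_act (pt x) (psi_model b))))" for x
      by (intro flin_nf_comp flin_comp[OF flin_kos_rep] flin_comp[OF flin_psi_model]
          flin_bar_act_left flin_bar_act_right flin_kos_act_left flin_kos_act_right flin_psi_model flin_id)+
    fix x :: "(nat \<Rightarrow> nat) \<times> (nat \<Rightarrow> nat)" and es
    assume "es \<in> supp b"
    then have es: "length es = p + 2" using b by auto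
    obtain q r where x: "x = (q, r)" by (cases x)
    have "(\<Prod>m\<leftarrow>[1..<n + 1]. pt (exp_at m (q m), exp_at m (r m)) :: 'k epoly) =
        (\<Prod>m\<in>{1..n}. pt (exp_at m (q m), exp_at m (r m)))"
      by (subst prod.distinct_set_conv_list[symmetric]) (auto intro!: prod.cong)
    also have "\<dots> = pt (trunc q, trunc r)"
      by (simp only: pt_sum[symmetric] finite_atLeastAtMost sum_Pair sum_exp_at)
    finally have prod: "(\<Prod>m\<leftarrow>[1..<n + 1]. pt (exp_at m (q m), exp_at m (r m)) :: 'k epoly) =
        pt (trunc q, trunc r)" .
    have "psi_model (bar_act (pt x) (pt es)) =
        kos_chain (q + sum_list es + r) [1..<n + 1] (map ((+) q) (psums 0 es))"
      using es by (simp only: x bar_act_pt psi_model_pt psums_outer le_add2)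
    also have "\<dots> = kos_act (pt (trunc q, trunc r)) (psi_model (pt es))"
      unfolding prod[symmetric] psi_model_pt
      by (rule kos_chain_shift) (use psums_upper in fastforce)
    finally have "kos_elt p (psi_model (bar_act (pt x) (pt es))) =
        kos_elt p (kos_act (pt (trunc q, trunc r)) (psi_model (pt es)))"
      by (simp only:)
    also have "\<dots> = kos_elt p (kos_act (pt x) (psi_model (pt es)))"
      unfolding x by (intro kos_elt_kos_act_trunc keys_psi_model_degree) (simp add: es)
    finally show "?N (kos_rep (psi_model (bar_act (pt x) (pt es)))) = ?N (kos_rep (kos_act (pt x) (psi_model (pt es))))"
      by (simp only: kos_elt_def nf_eq_iff)
  qed
  then show ?thesis
    by (simp only: kos_elt_def nf_eq_iff)
qed

lemma psi_model_trunc_list: "psi_model (trunc_list b) = psi_model b"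
proof (rule flin_eqI[OF flin_comp[OF flin_psi_model flin_trunc_list] flin_psi_model])
  fix es :: "(nat \<Rightarrow> nat) list"
  have sum: "sum_list (map trunc es) m = sum_list es m" if "m \<in> {1..n}" for m and es :: "(nat \<Rightarrow> nat) list"
    using that by (induction es) (simp_all add: trunc_def)
  have "kos_chain (sum_list (map trunc es)) [1..<n + 1] (psums 0 (map trunc es)) =
      (kos_chain (sum_list es) [1..<n + 1] (psums 0 es) :: 'k kpoly)"
  proof (rule kos_chain_cong)
    fix m assume "m \<in> set [1..<n + 1]"
    then have m: "m \<in> {1..n}" by auto
    then show "sum_list (map trunc es) m = sum_list es m" by (rule sum)
    fix j assume "j < length (psums 0 (map trunc es))"
    then have j: "j + 1 < length es" by (simp add: length_psums)
    then have "psums 0 (map trunc es) ! j = 0 + sum_list (map trunc (take (Suc j) es))"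
      by (subst nth_psums) (simp_all add: take_map)
    moreover have "psums 0 es ! j = 0 + sum_list (take (Suc j) es)"
      using j by (rule nth_psums)
    ultimately show "(psums 0 (map trunc es) ! j) m = (psums 0 es ! j) m"
      using sum[OF m, of "take (Suc j) es"] by (simp only: add_0_left)
  qed (simp add: length_psums)
  then show "psi_model (trunc_list (pt es)) = psi_model (pt es)"
    by (simp only: trunc_list_def lin_ext_pt psi_model_pt)
qed

lemma psi_map_exists:
  obtains f where "f \<in> lin_maps E (Bar scale p) (Kos scale p)"
    and "\<And>b. supp b \<subseteq> words (p + 2) \<Longrightarrow>
      f (bar_elt (p + 2) b) = kos_elt p (psi_model b)"
proof (rule bar_map_exists[where p = p and N = "Kos scale p" and F = "\<lambda>b. kos_elt p (psi_model b)"])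
  fix b c :: "(nat \<Rightarrow> nat) list \<Rightarrow>\<^sub>0 'k" and P
  assume b: "supp b \<subseteq> words (p + 2)"
  show "kos_elt p (psi_model b) \<in> carrier (Kos scale p)"
    by (rule kos_elt_in_Kos[OF keys_psi_model_degree[OF b]])
  show "kos_elt p (psi_model (trunc_list b)) = kos_elt p (psi_model b)"
    by (simp only: psi_model_trunc_list)
  show "kos_elt p (psi_model (b + c)) = kos_elt p (psi_model b) \<oplus>\<^bsub>Kos scale p\<^esub> kos_elt p (psi_model c)"
    by (simp only: kos_elt_add flin_add[OF flin_psi_model])
  show "kos_elt p (psi_model (bar_act P b)) = env_elt P \<odot>\<^bsub>Kos scale p\<^esub> kos_elt p (psi_model b)"
    by (simp only: kos_elt_smult[OF keys_psi_model_degree[OF b]] kos_elt_psi_model_bar_act[OF b])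
qed blast

lemma kos_tens_Q:
  "kos_tens scale (tens S [smon d, smon e]) (map (\<lambda>j. v (i j)) [1..<p + 1]) =
    kos_elt p (pt ((trunc d, trunc e), map i [1..<p + 1]))"
proof -
  have "tens S [smon d, smon e] = env_elt (pt (trunc d, trunc e))"
    by (simp only: env_elt_pt smon_trunc)
  moreover have "map (\<lambda>j. v (i j)) [1..<p + 1] = map v (map i [1..<p + 1])"
    by simp
  ultimately show ?thesis
    using kos_elt_kos_act[of "map i [1..<p + 1]" p "pt (trunc d, trunc e)"]
    by (simp only: kos_act_pt add_0_right length_map length_upt add_diff_cancel_right' simp_thms)
qed

lemma psi_generator:
  "(\<Oplus>\<^bsub>Kos scale p\<^esub>i\<in>index_seqs n p. \<Oplus>\<^bsub>Kos scale p\<^esub>a\<in>(\<Pi>\<^sub>E j\<in>{1..p}. {0..<l j (i j)}).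
      kos_tens scale (tens S [smon (Q n p l i a), smon (Q_hat n p l i a)]) (map (\<lambda>j. v (i j)) [1..<p + 1])) =
    kos_elt p (psi_model (pt (0 # map l [1..<p + 1] @ [0])))"
proof -
  let ?t = "\<lambda>i a. pt ((trunc (Q n p l i a), trunc (Q_hat n p l i a)), map i [1..<p + 1]) :: 'k kpoly"
  let ?A = "\<lambda>i. \<Pi>\<^sub>E j\<in>{1..p}. {0..<l j (i j)}"
  interpret K: presented_group "Kos scale p" "kos_gens p" "K_rels p"
    by (rule presented_Kos)
  have keys: "supp (?t i a) \<subseteq> kpoly_degree p" for i a
    by simp
  have keys_sum: "supp (\<Sum>a\<in>?A i. ?t i a) \<subseteq> kpoly_degree p" for i
    by (rule keys_sum_subset) (rule keys)
  have fin: "finite (?A i)" for i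
    by (rule finite_PiE) simp_all
  have "(\<Oplus>\<^bsub>Kos scale p\<^esub>i\<in>index_seqs n p. \<Oplus>\<^bsub>Kos scale p\<^esub>a\<in>?A i. kos_elt p (?t i a)) =
      (\<Oplus>\<^bsub>Kos scale p\<^esub>i\<in>index_seqs n p. kos_elt p (\<Sum>a\<in>?A i. ?t i a))"
    using kos_elt_finsum[OF fin keys] by (simp only:)
  also have "\<dots> = kos_elt p (\<Sum>i\<in>index_seqs n p. \<Sum>a\<in>?A i. ?t i a)"
    by (rule kos_elt_finsum[OF finite_index_seqs keys_sum])
  also have "(\<Sum>i\<in>index_seqs n p. \<Sum>a\<in>?A i. ?t i a) = psi_model (pt (0 # map l [1..<p + 1] @ [0]))"
    by (simp only: psi_model_pt psums_generator kos_chain_eq_sum sum_exp_at)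
  finally show ?thesis
    by (simp only: kos_tens_Q)
qed

text \<open>In degree \<open>0\<close> the comparison map is not given by its values on generators. For the
  tensor \<open>1 \<otimes> 1\<close> the chain has one member and no variable is selected, so the model gives \<open>1\<close>;
  linearity does the rest.\<close>

lemma Psi_0:
  assumes f: "f \<in> lin_maps E (Bar scale 0) (Kos scale 0)"
    and f_elt: "\<And>b. supp b \<subseteq> words (0 + 2) \<Longrightarrow>
      f (bar_elt (0 + 2) b) = kos_elt 0 (psi_model b)"
  shows "Psi scale n v 0 = f"
proof -
  have "kos_tens scale A [] = f A" if A: "A \<in> carrier (Bar scale 0)" for A
  proof -
    have "A \<in> carrier E"
      using A by (simp add: Bar_def Env_def Let_def numeral_2_eq_2)
    then obtain P where P: "A = env_elt P"
      by (rule Env_carrierE)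
    have keys: "supp (pt [0, 0] :: _ \<Rightarrow>\<^sub>0 'k) \<subseteq> (words (0 + 2) :: (nat \<Rightarrow> nat) list set)"
      by simp
    have "bar_act P (pt [0, 0]) = lin_ext (\<lambda>(q, r). [q, r]) P"
    proof (rule flin_eqI[OF flin_bar_act_left[OF flin_id] flin_lin_ext])
      show "bar_act (pt x) (pt [0, 0]) = lin_ext (\<lambda>(q, r). [q, r]) (pt x)" for x
        by (cases x) (simp add: bar_act_pt outer_def)
    qed
    then have "f A = f (bar_elt (0 + 2) (bar_act P (pt [0, 0])))"
      by (simp only: P env_elt_def add_0_left)
    also have "\<dots> = kos_elt 0 (kos_act P (psi_model (pt [0, 0])))"
      using keys_bar_act[OF le_add2 keys] by (simp only: f_elt kos_elt_psi_model_bar_act[OF keys])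
    also have "psi_model (pt [0, 0]) = pt (0, [])"
    proof -
      have "kos_chain 0 ms [0] = (pt (0, []) :: 'k kpoly)" for ms
        by (induction ms) (simp_all add: mono_fac_def exp_at_0 kos_act_1 One_nat_def flip: zero_prod_def)
      then show ?thesis
        by (simp add: psi_model_pt del: upt_Suc)
    qed
    also have "kos_elt 0 (kos_act P (pt (0, []))) = kos_tens scale A []"
      using kos_elt_kos_act[of "[]" 0 P] by (simp add: P)
    finally show ?thesis ..
  qed
  then have "Psi scale n v 0 = restrict f (carrier (Bar scale 0))"
    unfolding Psi_def Let_def if_P[OF refl] by (intro restrict_ext)
  also have "\<dots> = f"
    using f by (intro extensional_restrict) (auto simp: lin_maps_def PiE_def)
  finally show ?thesis .
qed

lemma
  shows Psi_lin: "Psi scale n v p \<in> lin_maps E (Bar scale p) (Kos scale p)"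
    and Psi_bar_elt: "supp b \<subseteq> words (p + 2) \<Longrightarrow>
      Psi scale n v p (bar_elt (p + 2) b) = kos_elt p (psi_model b)"
proof -
  obtain f where f: "f \<in> lin_maps E (Bar scale p) (Kos scale p)"
    and f_elt: "\<And>b. supp b \<subseteq> words (p + 2) \<Longrightarrow>
      f (bar_elt (p + 2) b) = kos_elt p (psi_model b)"
    by (rule psi_map_exists) blast
  let ?gen = "\<lambda>l. tens S ([\<one>\<^bsub>S\<^esub>] @ map (\<lambda>j. smon (l j)) [1..<p + 1] @ [\<one>\<^bsub>S\<^esub>])"
  let ?sum = "\<lambda>l. \<Oplus>\<^bsub>Kos scale p\<^esub>i\<in>index_seqs n p. \<Oplus>\<^bsub>Kos scale p\<^esub>a\<in>(\<Pi>\<^sub>E j\<in>{1..p}. {0..<l j (i j)}).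
      kos_tens scale (tens S [smon (Q n p l i a), smon (Q_hat n p l i a)]) (map (\<lambda>j. v (i j)) [1..<p + 1])"
  have f_gen: "f (?gen l) = ?sum l" for l
  proof -
    have len: "length (map l [1..<p + 1]) = p" by (simp del: upt_Suc)
    have "map (\<lambda>j. smon (l j)) [1..<p + 1] = map smon (map l [1..<p + 1])"
      by simp
    then have "?gen l = bar_elt (p + 2) (pt (0 # map l [1..<p + 1] @ [0]))"
      by (simp only: tens_generator[OF len])
    moreover have "supp (pt (0 # map l [1..<p + 1] @ [0]) :: _ \<Rightarrow>\<^sub>0 'k) \<subseteq> words (p + 2)"
      by (simp del: upt_Suc)
    ultimately show ?thesis
      by (simp only: f_elt psi_generator)
  qed
  have "Psi scale n v p = f"
  proof (cases "p = 0")
    case True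
    show ?thesis
      using f f_elt unfolding True by (rule Psi_0)
  next
    case False
    show ?thesis
      unfolding Psi_def Let_def if_not_P[OF False]
    proof (rule the_equality)
      show "f \<in> lin_maps E (Bar scale p) (Kos scale p) \<and> (\<forall>l. f (?gen l) = ?sum l)"
        using f f_gen by blast
      fix g assume g: "g \<in> lin_maps E (Bar scale p) (Kos scale p) \<and> (\<forall>l. g (?gen l) = ?sum l)"
      show "g = f"
      proof (rule bar_map_eqI[OF _ f])
        fix es :: "(nat \<Rightarrow> nat) list" assume es: "length es = p"
        have "map smon es = map (\<lambda>j. smon (es ! (j - 1))) [1..<p + 1]"
          by (rule nth_equalityI) (simp_all add: es One_nat_def del: upt_Suc)
        then show "g (tens S ([\<one>\<^bsub>S\<^esub>] @ map smon es @ [\<one>\<^bsub>S\<^esub>])) = f (tens S ([\<one>\<^bsub>S\<^esub>] @ map smon es @ [\<one>\<^bsub>S\<^esub>]))"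
          using g f_gen by (simp only:)
      qed (use g in blast)
    qed
  qed
  then show "Psi scale n v p \<in> lin_maps E (Bar scale p) (Kos scale p)"
    "supp b \<subseteq> words (p + 2) \<Longrightarrow>
      Psi scale n v p (bar_elt (p + 2) b) = kos_elt p (psi_model b)"
    using f f_elt by simp_all
qed

lemma Psi_commutes:
  assumes x: "x \<in> carrier (Bar scale (Suc q))"
  shows "Psi scale n v q (bar_d scale (Suc q) x) = kos_d scale (Suc q) (Psi scale n v (Suc q) x)"
proof -
  obtain b where b: "x = bar_elt (Suc q + 2) b" and keys: "supp b \<subseteq> words (Suc q + 2)"
    using x by (rule Bar_carrierE)
  have keys3: "supp b \<subseteq> words (q + 3)" and b3: "x = bar_elt (q + 3) b"
    using keys b by (simp_all add: numeral_3_eq_3)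
  have keys_diff: "supp (bar_diff (Suc q) b) \<subseteq> words (q + 2)"
    using keys_bar_diff[OF keys] by (simp add: One_nat_def)
  have "Psi scale n v q (bar_d scale (Suc q) x) = kos_elt q (psi_model (bar_diff (Suc q) b))"
    by (simp only: b3 bar_d_bar_elt[OF keys3] Psi_bar_elt[OF keys_diff])
  also have "\<dots> = kos_elt q (kos_diff (psi_model b))"
    by (simp only: kos_diff_psi_model[OF keys])
  also have "\<dots> = kos_d scale (Suc q) (Psi scale n v (Suc q) x)"
    by (simp only: b Psi_bar_elt[OF keys] kos_d_kos_elt[OF keys_psi_model[OF keys]])
  finally show ?thesis .
qed

end

theorem theorem4p4:
  fixes scale :: "'k::field \<Rightarrow> 'v::ab_group_add \<Rightarrow> 'v"
    and n :: nat and v :: "nat \<Rightarrow> 'v"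
  assumes "finite_dimensional_vector_space scale (v ` {1..n})"
    and "inj_on v {1..n}"
  shows "chain_map (Env scale)
           (Bar scale) (bar_d scale) (Kos scale) (kos_d scale) (Psi scale n v)"
proof -
  interpret based_space scale n v
    using assms by (rule based_space.intro)
  show ?thesis
    unfolding chain_map_def
  proof (intro conjI allI impI ballI)
    show "Psi scale n v p \<in> lin_maps (Env scale) (Bar scale p) (Kos scale p)" for p
      by (rule Psi_lin)
    fix p :: nat and x assume "p \<ge> 1" and x: "x \<in> carrier (Bar scale p)"
    then obtain q where p: "p = Suc q" by (cases p) auto
    show "Psi scale n v (p - 1) (bar_d scale p x) = kos_d scale p (Psi scale n v p x)"
      using Psi_commutes[of x q] x by (simp add: p)
  qed
qed

end
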